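(* Let $p$ be a prime, let $K$ be a finite field extension of $\mathbb{Q}_p$ of degree $d$, ramification index $e$ and inertia degree $f$, let $R$ be the ring of integers of $K$, let $\pi\in R$ be a uniformizing parameter, and let $q=p^f$ be the cardinality of the residue field of $R$. Let $l\geq 1$ and $m\geq e$ be integers. Then the following holds. (1) If $(l^2+2l)d\leq p$, then $$\delta(\mathrm{SL}_{l+1}(R))\leq q^{l+(l^2+2l)e}\prod_{i=1}^{l}\left(1-\frac{1}{q^{i+1}}\right)\quad\text{and}\quad \delta(\mathrm{SL}_{l+1}^m(R))\leq q^l.$$ (2) If $(2l^2+l)d\leq p$, then $$\delta(\mathrm{Sp}_{2l}(R))\leq q^{2l+(2l^2+l)e}\prod_{i=1}^{l}\left(1-\frac{1}{q^{2i}}\right)\quad\text{and}\quad \delta(\mathrm{Sp}_{2l}^m(R))\leq q^{2l}.$$ (3) If $l\geq 2$ and $(2l^2-l)d\leq p$, then $$\delta(\mathrm{SO}_{2l}(R))\leq q^{2l-2+(2l^2-l)e}\left(1-\frac{1}{q^l}\right)\prod_{i=1}^{l-1}\left(1-\frac{1}{q^{2i}}\right)\quad\text{and}\quad \delta(\mathrm{SO}_{2l}^m(R))\leq q^{2l-2}.$$ (4) If $(2l^2+l)d\leq p$, then $$\delta(\mathrm{SO}_{2l+1}(R))\leq q^{2l-1+(2l^2+l)e}\prod_{i=1}^{l}\left(1-\frac{1}{q^{2i}}\right)\quad\text{and}\quad \delta(\mathrm{SO}_{2l+1}^m(R))\leq q^{2l-1}.$$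
   Context: Self-similarity of groups: for an integer $\delta\geq 1$, a group $G$ is self-similar of index $\delta$ if it admits a faithful self-similar action on a regular rooted $\delta$-ary tree that is transitive on the first level. Equivalently (known fact), $G$ admits a simple virtual endomorphism of index $\delta$: a group homomorphism $\varphi:D\to G$, where $D\leq G$ is a subgroup of index $\delta$, such that there is no nontrivial normal subgroup $N$ of $G$ with $N\subseteq D$ and $\varphi(N)\subseteq N$. A group is self-similar if it is self-similar of some index. If $G$ is self-similar, $\delta(G)$ denotes the minimum positive integer $\delta$ such that $G$ is self-similar of index $\delta$ (an inequality for $\delta(G)$ is understood to include the assertion that $G$ is self-similar). Classical groups: $\mathrm{SL}_n(R)=\{x\in \mathrm{M}_n(R): \det x=1\}$. For $n=2l$, $\mathrm{Sp}_{n}(R)=\{x\in \mathrm{M}_{n}(R): x^{\mathrm t}sx=s\}$ with $s=\begin{bmatrix}0&\mathrm{Id}_l\\-\mathrm{Id}_l&0\end{bmatrix}$. $\mathrm{SO}_n(R)=\{x\in \mathrm{SL}_n(R): x^{\mathrm t}sx=s\}$ with $s=\begin{bmatrix}0&\mathrm{Id}_l\\ \mathrm{Id}_l&0\end{bmatrix}$ if $n=2l$, and $s=\begin{bmatrix}1&0&0\\0&0&\mathrm{Id}_l\\0&\mathrm{Id}_l&0\end{bmatrix}$ if $n=2l+1$. For $\Sigma\in\{\mathrm{SL},\mathrm{Sp},\mathrm{SO}\}$ and $m\geq 1$, $\Sigma_n^m(R)$ is the kernel of the map $\Sigma_n(R)\to\Sigma_n(R/\pi^mR)$ of reduction modulo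 $\pi^m$. *)

theory Defs
  imports
    Complex_Main
    "HOL-Algebra.Group_Action"
    "HOL-Algebra.Embedded_Algebras"
    "HOL-Algebra.QuotRing"
    "HOL-Algebra.Algebraic_Closure_Type"
    "Jordan_Normal_Form.Determinant"
begin

section \<open>The field of p-adic numbers\<close>

definition padic_norm :: "nat \<Rightarrow> rat \<Rightarrow> real" where
  "padic_norm p x =
     (if x = 0 then 0
      else real p powi (int (multiplicity (int p) (snd (quotient_of x)))
                        - int (multiplicity (int p) (fst (quotient_of x)))))"

definition padic_Cauchy :: "nat \<Rightarrow> (nat \<Rightarrow> rat) \<Rightarrow> bool" where
  "padic_Cauchy p a \<longleftrightarrow>
     (\<forall>\<epsilon>>0. \<exists>N. \<forall>i\<ge>N. \<forall>j\<ge>N. padic_norm p (a i - a j) < \<epsilon>)"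

definition Cauchy_ring :: "nat \<Rightarrow> (nat \<Rightarrow> rat) ring" where
  "Cauchy_ring p =
     \<lparr>carrier = {a. padic_Cauchy p a}, monoid.mult = (\<lambda>a b n. a n * b n), one = (\<lambda>n. 1),
      zero = (\<lambda>n. 0), add = (\<lambda>a b n. a n + b n)\<rparr>"

definition null_ideal :: "nat \<Rightarrow> (nat \<Rightarrow> rat) set" where
  "null_ideal p = {a \<in> carrier (Cauchy_ring p). (\<lambda>n. padic_norm p (a n)) \<longlonglongrightarrow> 0}"

definition padic_field :: "nat \<Rightarrow> (nat \<Rightarrow> rat) set ring" where
  "padic_field p = Cauchy_ring p Quot null_ideal p"

text \<open>The valuation is discrete, so a p-adic number has absolute value at most one if and only
  if it is the limit of rational numbers of absolute value at most one.\<close>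

definition padic_integers :: "nat \<Rightarrow> (nat \<Rightarrow> rat) set set" where
  "padic_integers p =
     {null_ideal p +>\<^bsub>Cauchy_ring p\<^esub> a | a.
        a \<in> carrier (Cauchy_ring p) \<and> (\<forall>n. padic_norm p (a n) \<le> 1)}"


subsection \<open>The p-adic numbers form a field\<close>

lemma null_comparison:
  fixes f g :: "nat \<Rightarrow> real"
  assumes "\<forall>\<^sub>F n in sequentially. norm (f n) \<le> g n" "g \<longlonglongrightarrow> 0"
  shows "f \<longlonglongrightarrow> 0"
proof -
  have "(\<lambda>n. norm (f n)) \<longlonglongrightarrow> 0"
    by (rule tendsto_sandwich[OF _ assms(1) tendsto_const assms(2)]) simp
  then show ?thesis by (rule tendsto_norm_zero_cancel)
qed

lemma padic_norm_divide:
  assumes p: "Factorial_Ring.prime p" and "a \<noteq> 0" "b \<noteq> 0"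
  shows "padic_norm p (of_int a / of_int b)
           = real p powi (int (multiplicity (int p) b) - int (multiplicity (int p) a))"
proof -
  let ?x = "of_int a / of_int b :: rat"
  obtain c d where q: "quotient_of ?x = (c, d)" by force
  have d: "d > 0" using q quotient_of_denom_pos by blast
  have x: "?x = of_int c / of_int d" using q quotient_of_div by blast
  have "c \<noteq> 0" using x assms d by auto
  have eq: "a * d = c * b"
    using x assms d by (simp add: field_simps flip: of_int_mult)
  have pp: "prime_elem (int p)" using p by simp
  have "multiplicity (int p) (a * d) = multiplicity (int p) (c * b)" using eq by simp
  then have "int (multiplicity (int p) a) + int (multiplicity (int p) d)
      = int (multiplicity (int p) c) + int (multiplicity (int p) b)"
    using pp assms d \<open>c \<noteq> 0\<close> by (simp add: prime_elem_multiplicity_mult_distrib)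
  then have "int (multiplicity (int p) d) - int (multiplicity (int p) c)
      = int (multiplicity (int p) b) - int (multiplicity (int p) a)" by simp
  moreover have "?x \<noteq> 0" using assms by simp
  ultimately show ?thesis unfolding padic_norm_def q by simp
qed

lemma rat_cases_ne:
  fixes x :: rat assumes "x \<noteq> 0"
  obtains a b where "x = of_int a / of_int b" "a \<noteq> 0" "b \<noteq> 0"
proof -
  obtain c d where q: "quotient_of x = (c, d)" by force
  have "d > 0" "x = of_int c / of_int d" using q quotient_of_denom_pos quotient_of_div by blast+
  then show ?thesis using that[of c d] assms by auto
qed

lemma padic_norm_zero [simp]: "padic_norm p 0 = 0" by (simp add: padic_norm_def)

lemma padic_norm_nonneg [simp]: "0 \<le> padic_norm p x" by (simp add: padic_norm_def)

lemma padic_norm_pos: "Factorial_Ring.prime p \<Longrightarrow> x \<noteq> 0 \<Longrightarrow> 0 < padic_norm p x"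
  by (simp add: padic_norm_def prime_gt_0_nat)

lemma padic_norm_one [simp]: "padic_norm p 1 = 1" by (simp add: padic_norm_def)

lemma padic_norm_mult:
  assumes p: "Factorial_Ring.prime p"
  shows "padic_norm p (x * y) = padic_norm p x * padic_norm p y"
proof (cases "x = 0 \<or> y = 0")
  case False
  obtain a b where x: "x = of_int a / of_int b" "a \<noteq> 0" "b \<noteq> 0" using rat_cases_ne False by metis
  obtain c d where y: "y = of_int c / of_int d" "c \<noteq> 0" "d \<noteq> 0" using rat_cases_ne False by metis
  have xy: "x * y = of_int (a * c) / of_int (b * d)" using x y by simp
  have p0: "real p \<noteq> 0" using p by auto
  show ?thesis unfolding xy unfolding x(1) y(1)
    using p x y p0
    by (subst (1 2 3) padic_norm_divide)
       (auto simp: prime_elem_multiplicity_mult_distrib power_int_diff power_int_add)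
qed auto

lemma padic_norm_uminus [simp]: "padic_norm p (- x) = padic_norm p x"
  by (cases "quotient_of x") (simp add: padic_norm_def rat_uminus_code)

lemma padic_norm_minus_commute: "padic_norm p (x - y) = padic_norm p (y - x)"
  using padic_norm_uminus[of p "x - y"] by simp

lemma padic_norm_add:
  assumes p: "Factorial_Ring.prime p"
  shows "padic_norm p (x + y) \<le> max (padic_norm p x) (padic_norm p y)"
proof (cases "x = 0 \<or> y = 0 \<or> x + y = 0")
  case True
  then show ?thesis by (auto simp: le_max_iff_disj)
next
  case False
  obtain a b where x: "x = of_int a / of_int b" "a \<noteq> 0" "b \<noteq> 0" using rat_cases_ne False by metis
  obtain c d where y: "y = of_int c / of_int d" "c \<noteq> 0" "d \<noteq> 0" using rat_cases_ne False by metis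
  have x': "x = of_int (a * d) / of_int (b * d)" and y': "y = of_int (c * b) / of_int (b * d)"
    using x y by auto
  have xy: "x + y = of_int (a * d + c * b) / of_int (b * d)"
    unfolding x' y' by (simp add: add_divide_distrib)
  have nz: "a * d \<noteq> 0" "c * b \<noteq> 0" "b * d \<noteq> 0" using x y by auto
  have nz': "a * d + c * b \<noteq> 0" using xy False by (metis div_0 of_int_0)
  have pe: "\<not> is_unit (int p)" using prime_gt_1_nat[OF p] by simp
  let ?k = "min (multiplicity (int p) (a * d)) (multiplicity (int p) (c * b))"
  have "int p ^ ?k dvd a * d + c * b"
    by (intro dvd_add multiplicity_dvd') auto
  then have k: "?k \<le> multiplicity (int p) (a * d + c * b)"
    using nz' pe by (simp add: multiplicity_geI)
  have p1: "real p \<ge> 1" using p prime_ge_1_nat by auto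
  have "real p powi (int (multiplicity (int p) (b * d)) - int (multiplicity (int p) (a * d + c * b)))
     \<le> real p powi (int (multiplicity (int p) (b * d)) - int ?k)"
    by (rule power_int_increasing) (use k p1 in auto)
  also have "\<dots> \<le> max (real p powi (int (multiplicity (int p) (b * d)) - int (multiplicity (int p) (a * d))))
       (real p powi (int (multiplicity (int p) (b * d)) - int (multiplicity (int p) (c * b))))"
    by (simp add: min_def)
  finally show ?thesis
    unfolding xy unfolding x' y'
    by (subst (1 2 3) padic_norm_divide[OF p]) (use nz nz' in auto)
qed

lemma padic_norm_diff:
  assumes p: "Factorial_Ring.prime p"
  shows "padic_norm p (x - y) \<le> max (padic_norm p x) (padic_norm p y)"
  using padic_norm_add[OF p, of x "- y"] by simp

lemma padic_Cauchy_const [simp]: "padic_Cauchy p (\<lambda>n. c)"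
  by (simp add: padic_Cauchy_def)

lemma padic_Cauchy_bounded:
  assumes p: "Factorial_Ring.prime p" and X: "padic_Cauchy p u"
  obtains B where "B > 0" "\<And>n. padic_norm p (u n) \<le> B"
proof -
  obtain N where N: "\<And>i j. i \<ge> N \<Longrightarrow> j \<ge> N \<Longrightarrow> padic_norm p (u i - u j) < 1"
    using X[unfolded padic_Cauchy_def, rule_format, of 1] by auto
  let ?B = "1 + (\<Sum>i\<le>N. padic_norm p (u i))"
  have le: "padic_norm p (u n) \<le> ?B" if "n \<le> N" for n
  proof -
    have "padic_norm p (u n) \<le> (\<Sum>i\<le>N. padic_norm p (u i))"
      by (rule member_le_sum) (use that in auto)
    then show ?thesis by simp
  qed
  have "padic_norm p (u n) \<le> ?B" for n
  proof (cases "n \<le> N")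
    case False
    have "padic_norm p ((u n - u N) + u N) \<le> max (padic_norm p (u n - u N)) (padic_norm p (u N))"
      by (rule padic_norm_add[OF p])
    moreover have "padic_norm p (u n - u N) < 1" using N False by auto
    moreover have "1 \<le> ?B" by (simp add: sum_nonneg)
    ultimately show ?thesis using le[of N] by auto
  qed (rule le)
  moreover have "?B > 0" by (smt (verit) sum_nonneg padic_norm_nonneg)
  ultimately show ?thesis using that by blast
qed

lemma padic_Cauchy_add:
  assumes p: "Factorial_Ring.prime p" and X: "padic_Cauchy p u" and Y: "padic_Cauchy p v"
  shows "padic_Cauchy p (\<lambda>n. u n + v n)"
  unfolding padic_Cauchy_def
proof (intro allI impI)
  fix \<epsilon> :: real assume e: "\<epsilon> > 0"
  obtain M where M: "\<And>i j. i \<ge> M \<Longrightarrow> j \<ge> M \<Longrightarrow> padic_norm p (u i - u j) < \<epsilon>"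
    using X e unfolding padic_Cauchy_def by meson
  obtain N where N: "\<And>i j. i \<ge> N \<Longrightarrow> j \<ge> N \<Longrightarrow> padic_norm p (v i - v j) < \<epsilon>"
    using Y e unfolding padic_Cauchy_def by meson
  have "padic_norm p (u i + v i - (u j + v j)) < \<epsilon>" if "i \<ge> max M N" "j \<ge> max M N" for i j
    using padic_norm_add[OF p, of "u i - u j" "v i - v j"] M[of i j] N[of i j] that
    by (auto simp: algebra_simps)
  then show "\<exists>N. \<forall>i\<ge>N. \<forall>j\<ge>N. padic_norm p (u i + v i - (u j + v j)) < \<epsilon>" by blast
qed

lemma padic_Cauchy_mult:
  assumes p: "Factorial_Ring.prime p" and X: "padic_Cauchy p u" and Y: "padic_Cauchy p v"
  shows "padic_Cauchy p (\<lambda>n. u n * v n)"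
  unfolding padic_Cauchy_def
proof (intro allI impI)
  fix \<epsilon> :: real assume e: "\<epsilon> > 0"
  obtain B where B: "B > 0" "\<And>n. padic_norm p (u n) \<le> B" using padic_Cauchy_bounded[OF p X] by blast
  obtain C where C: "C > 0" "\<And>n. padic_norm p (v n) \<le> C" using padic_Cauchy_bounded[OF p Y] by blast
  obtain M where M: "\<And>i j. i \<ge> M \<Longrightarrow> j \<ge> M \<Longrightarrow> padic_norm p (u i - u j) < \<epsilon> / C"
    using X e C unfolding padic_Cauchy_def by (meson divide_pos_pos)
  obtain N where N: "\<And>i j. i \<ge> N \<Longrightarrow> j \<ge> N \<Longrightarrow> padic_norm p (v i - v j) < \<epsilon> / B"
    using Y e B unfolding padic_Cauchy_def by (meson divide_pos_pos)
  have "padic_norm p (u i * v i - u j * v j) < \<epsilon>" if "i \<ge> max M N" "j \<ge> max M N" for i j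
  proof -
    have eq: "u i * v i - u j * v j = (u i - u j) * v i + u j * (v i - v j)" by (simp add: algebra_simps)
    have "padic_norm p (u i - u j) * padic_norm p (v i) \<le> padic_norm p (u i - u j) * C"
      by (rule mult_left_mono) (use C in auto)
    also have "\<dots> < \<epsilon>" using M[of i j] that C by (simp add: field_simps)
    finally have 1: "padic_norm p ((u i - u j) * v i) < \<epsilon>" by (simp add: padic_norm_mult[OF p])
    have "padic_norm p (u j) * padic_norm p (v i - v j) \<le> B * padic_norm p (v i - v j)"
      by (rule mult_right_mono) (use B in auto)
    also have "\<dots> < \<epsilon>" using N[of i j] that B by (simp add: field_simps)
    finally have 2: "padic_norm p (u j * (v i - v j)) < \<epsilon>" by (simp add: padic_norm_mult[OF p])
    show ?thesis unfolding eq
      using padic_norm_add[OF p, of "(u i - u j) * v i" "u j * (v i - v j)"] 1 2 by linarith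
  qed
  then show "\<exists>N. \<forall>i\<ge>N. \<forall>j\<ge>N. padic_norm p (u i * v i - u j * v j) < \<epsilon>" by blast
qed

lemma padic_Cauchy_uminus: "padic_Cauchy p u \<Longrightarrow> padic_Cauchy p (\<lambda>n. - u n)"
  unfolding padic_Cauchy_def by (simp add: padic_norm_minus_commute)

lemma cring_Cauchy_ring:
  assumes p: "Factorial_Ring.prime p"
  shows "cring (Cauchy_ring p)"
proof (rule cringI)
  show "abelian_group (Cauchy_ring p)"
  proof (rule abelian_groupI)
    fix x assume "x \<in> carrier (Cauchy_ring p)"
    then show "\<exists>y\<in>carrier (Cauchy_ring p). y \<oplus>\<^bsub>Cauchy_ring p\<^esub> x = \<zero>\<^bsub>Cauchy_ring p\<^esub>"
      by (intro bexI[of _ "\<lambda>n. - x n"]) (auto simp: Cauchy_ring_def padic_Cauchy_uminus)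
  qed (auto simp: Cauchy_ring_def padic_Cauchy_add[OF p] algebra_simps)
  show "comm_monoid (Cauchy_ring p)"
    by (rule comm_monoidI) (auto simp: Cauchy_ring_def padic_Cauchy_mult[OF p] algebra_simps)
qed (auto simp: Cauchy_ring_def algebra_simps)

lemma Cauchy_ring_minus:
  assumes p: "Factorial_Ring.prime p" and u: "padic_Cauchy p u"
  shows "\<ominus>\<^bsub>Cauchy_ring p\<^esub> u = (\<lambda>n. - u n)"
proof -
  interpret cring "Cauchy_ring p" by (rule cring_Cauchy_ring[OF p])
  show ?thesis
    by (rule minus_equality) (use u in \<open>auto simp: Cauchy_ring_def padic_Cauchy_uminus\<close>)
qed

lemma ideal_null_ideal:
  assumes p: "Factorial_Ring.prime p"
  shows "ideal (null_ideal p) (Cauchy_ring p)"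
proof -
  interpret C: cring "Cauchy_ring p" by (rule cring_Cauchy_ring[OF p])
  have mult: "(\<lambda>n. u n * v n) \<in> null_ideal p"
    if "u \<in> null_ideal p" "v \<in> carrier (Cauchy_ring p)" for u v
  proof -
    have u: "padic_Cauchy p u" "(\<lambda>n. padic_norm p (u n)) \<longlonglongrightarrow> 0" and v: "padic_Cauchy p v"
      using that by (auto simp: null_ideal_def Cauchy_ring_def)
    obtain B where B: "B > 0" "\<And>n. padic_norm p (v n) \<le> B" using padic_Cauchy_bounded[OF p v] by blast
    have "(\<lambda>n. padic_norm p (u n * v n)) \<longlonglongrightarrow> 0"
    proof (rule null_comparison[where g = "\<lambda>n. padic_norm p (u n) * B"])
      show "\<forall>\<^sub>F n in sequentially. norm (padic_norm p (u n * v n)) \<le> padic_norm p (u n) * B"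
        using B by (auto simp: padic_norm_mult[OF p] intro!: always_eventually mult_left_mono)
      show "(\<lambda>n. padic_norm p (u n) * B) \<longlonglongrightarrow> 0" using tendsto_mult_left_zero[OF u(2)] .
    qed
    then show ?thesis using padic_Cauchy_mult[OF p u(1) v]
      by (auto simp: null_ideal_def Cauchy_ring_def)
  qed
  show ?thesis
  proof (rule idealI)
    show "ring (Cauchy_ring p)" by unfold_locales
    show "subgroup (null_ideal p) (add_monoid (Cauchy_ring p))"
    proof (rule C.add.subgroupI)
      show "null_ideal p \<subseteq> carrier (Cauchy_ring p)" by (auto simp: null_ideal_def)
      have "(\<lambda>n. 0) \<in> null_ideal p" by (simp add: null_ideal_def Cauchy_ring_def)
      then show "null_ideal p \<noteq> {}" by blast
      show "\<ominus>\<^bsub>Cauchy_ring p\<^esub> a \<in> null_ideal p" if "a \<in> null_ideal p" for a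
      proof -
        have *: "padic_Cauchy p a" using that by (simp add: null_ideal_def Cauchy_ring_def)
        show ?thesis unfolding Cauchy_ring_minus[OF p *]
          using that by (auto simp: null_ideal_def Cauchy_ring_def padic_Cauchy_uminus)
      qed
      fix u v assume a: "u \<in> null_ideal p" and b: "v \<in> null_ideal p"
      have "(\<lambda>n. padic_norm p (u n + v n)) \<longlonglongrightarrow> 0"
      proof (rule null_comparison[where g = "\<lambda>n. padic_norm p (u n) + padic_norm p (v n)"])
        show "\<forall>\<^sub>F n in sequentially. norm (padic_norm p (u n + v n)) \<le> padic_norm p (u n) + padic_norm p (v n)"
        proof (intro always_eventually allI)
          fix n
          show "norm (padic_norm p (u n + v n)) \<le> padic_norm p (u n) + padic_norm p (v n)"
            using padic_norm_add[OF p, of "u n" "v n"] padic_norm_nonneg[of p "u n"]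
              padic_norm_nonneg[of p "v n"] padic_norm_nonneg[of p "u n + v n"]
            unfolding real_norm_def by linarith
        qed
        show "(\<lambda>n. padic_norm p (u n) + padic_norm p (v n)) \<longlonglongrightarrow> 0"
          using a b by (auto simp: null_ideal_def intro: tendsto_add_zero)
      qed
      then show "u \<oplus>\<^bsub>Cauchy_ring p\<^esub> v \<in> null_ideal p"
        using a b by (auto simp: null_ideal_def Cauchy_ring_def padic_Cauchy_add[OF p])
    qed
  qed (use mult in \<open>auto simp: Cauchy_ring_def mult.commute\<close>)
qed

lemma padic_Cauchy_eventually_inverse:
  assumes p: "Factorial_Ring.prime p" and u: "padic_Cauchy p u"
    and nn: "\<not> (\<lambda>n. padic_norm p (u n)) \<longlonglongrightarrow> 0"
  shows "padic_Cauchy p (\<lambda>n. inverse (u n))" "\<forall>\<^sub>F n in sequentially. u n \<noteq> 0"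
proof -
  obtain c where c: "c > 0" and inf: "\<And>N. \<exists>n\<ge>N. padic_norm p (u n) \<ge> c"
    using nn unfolding LIMSEQ_iff by (auto simp: not_less)
  obtain N where N: "\<And>i j. i \<ge> N \<Longrightarrow> j \<ge> N \<Longrightarrow> padic_norm p (u i - u j) < c"
    using u c unfolding padic_Cauchy_def by meson
  obtain k where k: "k \<ge> N" "padic_norm p (u k) \<ge> c" using inf by blast
  have lb: "padic_norm p (u n) \<ge> c" if "n \<ge> N" for n
    using padic_norm_add[OF p, of "u k - u n" "u n"] N[of k n] k that by auto
  have nz: "u n \<noteq> 0" if "n \<ge> N" for n using lb[OF that] c by auto
  then show "\<forall>\<^sub>F n in sequentially. u n \<noteq> 0" by (auto simp: eventually_sequentially)
  show "padic_Cauchy p (\<lambda>n. inverse (u n))"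
    unfolding padic_Cauchy_def
  proof (intro allI impI)
    fix \<epsilon> :: real assume e: "\<epsilon> > 0"
    obtain M where M: "\<And>i j. i \<ge> M \<Longrightarrow> j \<ge> M \<Longrightarrow> padic_norm p (u i - u j) < \<epsilon> * (c * c)"
      using u e c unfolding padic_Cauchy_def by (meson mult_pos_pos)
    have "padic_norm p (inverse (u i) - inverse (u j)) < \<epsilon>" if "i \<ge> max M N" "j \<ge> max M N" for i j
    proof -
      have ij: "u i \<noteq> 0" "u j \<noteq> 0" using nz that by auto
      let ?z = "inverse (u i) - inverse (u j)"
      have "?z * (u i * u j) = u j - u i" using ij by (simp add: field_simps)
      then have "padic_norm p ?z * (padic_norm p (u i) * padic_norm p (u j)) < \<epsilon> * (c * c)"
        using M[of j i] that by (simp flip: padic_norm_mult[OF p])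
      moreover have "padic_norm p ?z * (c * c) \<le> padic_norm p ?z * (padic_norm p (u i) * padic_norm p (u j))"
        using lb that c by (intro mult_left_mono mult_mono) auto
      ultimately have "padic_norm p ?z * (c * c) < \<epsilon> * (c * c)" by linarith
      then show ?thesis using c by (simp add: mult_less_cancel_right)
    qed
    then show "\<exists>N. \<forall>i\<ge>N. \<forall>j\<ge>N. padic_norm p (inverse (u i) - inverse (u j)) < \<epsilon>" by blast
  qed
qed

theorem field_padic_field:
  assumes p: "Factorial_Ring.prime p"
  shows "field (padic_field p)"
proof -
  let ?C = "Cauchy_ring p" and ?I = "null_ideal p"
  interpret C: cring ?C by (rule cring_Cauchy_ring[OF p])
  interpret I: ideal ?I ?C by (rule ideal_null_ideal[OF p])
  interpret Q: cring "?C Quot ?I" by (rule I.quotient_is_cring) unfold_locales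
  have "Ring.field (?C Quot ?I)"
  proof (rule Q.cring_fieldI2)
    have "\<one>\<^bsub>?C\<^esub> \<notin> ?I" by (auto simp: null_ideal_def Cauchy_ring_def LIMSEQ_const_iff)
    then show "\<zero>\<^bsub>?C Quot ?I\<^esub> \<noteq> \<one>\<^bsub>?C Quot ?I\<^esub>"
      using I.a_rcos_self[of "\<one>\<^bsub>?C\<^esub>"] by (auto simp: FactRing_def)
    fix a assume a: "a \<in> carrier (?C Quot ?I)" "a \<noteq> \<zero>\<^bsub>?C Quot ?I\<^esub>"
    then obtain u where u: "u \<in> carrier ?C" "a = ?I +>\<^bsub>?C\<^esub> u"
      by (auto simp: FactRing_def A_RCOSETS_def')
    have "u \<notin> ?I" using a(2) u I.a_rcos_const by (auto simp: FactRing_def)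
    then have uc: "padic_Cauchy p u" and nn: "\<not> (\<lambda>n. padic_norm p (u n)) \<longlonglongrightarrow> 0"
      using u by (auto simp: null_ideal_def Cauchy_ring_def)
    note inv = padic_Cauchy_eventually_inverse[OF p uc nn]
    let ?v = "\<lambda>n. inverse (u n)"
    have v: "?v \<in> carrier ?C" using inv by (simp add: Cauchy_ring_def)
    have w: "u \<otimes>\<^bsub>?C\<^esub> ?v \<ominus>\<^bsub>?C\<^esub> \<one>\<^bsub>?C\<^esub> = (\<lambda>n. u n * ?v n - 1)"
      unfolding a_minus_def
      by (subst Cauchy_ring_minus[OF p]) (auto simp: Cauchy_ring_def)
    have "u \<otimes>\<^bsub>?C\<^esub> ?v \<ominus>\<^bsub>?C\<^esub> \<one>\<^bsub>?C\<^esub> \<in> carrier ?C" using u v by simp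
    moreover have "(\<lambda>n. padic_norm p (u n * ?v n - 1)) \<longlonglongrightarrow> 0"
      by (rule tendsto_eventually) (use inv(2) in \<open>auto elim!: eventually_mono\<close>)
    ultimately have "u \<otimes>\<^bsub>?C\<^esub> ?v \<ominus>\<^bsub>?C\<^esub> \<one>\<^bsub>?C\<^esub> \<in> ?I" unfolding w null_ideal_def by blast
    then have "?I +>\<^bsub>?C\<^esub> (u \<otimes>\<^bsub>?C\<^esub> ?v) = ?I +>\<^bsub>?C\<^esub> \<one>\<^bsub>?C\<^esub>"
      using C.quotient_eq_iff_same_a_r_cos[OF I.ideal_axioms C.m_closed[OF u(1) v] C.one_closed] by blast
    then show "\<exists>b\<in>carrier (?C Quot ?I). a \<otimes>\<^bsub>?C Quot ?I\<^esub> b = \<one>\<^bsub>?C Quot ?I\<^esub>"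
      using u v by (intro bexI[of _ "?I +>\<^bsub>?C\<^esub> ?v"])
        (auto simp: FactRing_def I.rcoset_mult_add A_RCOSETS_def')
  qed
  then show ?thesis by (simp add: padic_field_def)
qed


section \<open>Finite extensions of the field of p-adic numbers\<close>

text \<open>The extension field is a type \<^typ>\<open>'a\<close> of class \<^class>\<open>field\<close> together with a (necessarily
  injective) ring homomorphism \<^term>\<open>\<iota>\<close> from the field of p-adic numbers to it.\<close>

abbreviation ring_of_field :: "'a::field ring" where
  "ring_of_field \<equiv> ring_of_type_algebra"

definition padic_extension :: "nat \<Rightarrow> ((nat \<Rightarrow> rat) set \<Rightarrow> 'a::field) \<Rightarrow> nat \<Rightarrow> bool" where
  "padic_extension p \<iota> d \<longleftrightarrow>
     \<iota> \<in> Ring.ring_hom (padic_field p) ring_of_field \<and>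
     ring.dimension ring_of_field d (\<iota> ` carrier (padic_field p)) (UNIV :: 'a set)"

definition integer_ring :: "nat \<Rightarrow> ((nat \<Rightarrow> rat) set \<Rightarrow> 'a::field) \<Rightarrow> 'a ring" where
  "integer_ring p \<iota> =
     ring_of_field\<lparr>carrier :=
       {x. \<exists>P :: 'a poly. Polynomial.lead_coeff P = 1 \<and> range (Polynomial.coeff P) \<subseteq> \<iota> ` padic_integers p
             \<and> Polynomial.poly P x = 0}\<rparr>"

definition uniformizer :: "('a, 'b) ring_scheme \<Rightarrow> 'a \<Rightarrow> bool" where
  "uniformizer R \<pi> \<longleftrightarrow> \<pi> \<in> carrier R \<and> maximalideal (PIdl\<^bsub>R\<^esub> \<pi>) R"

abbreviation residue :: "('a, 'b) ring_scheme \<Rightarrow> 'a \<Rightarrow> 'a \<Rightarrow> 'a set" where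
  "residue R a x \<equiv> (PIdl\<^bsub>R\<^esub> a) +>\<^bsub>R\<^esub> x"

definition has_ramification_index :: "nat \<Rightarrow> 'a::field ring \<Rightarrow> 'a \<Rightarrow> nat \<Rightarrow> bool" where
  "has_ramification_index p R \<pi> e \<longleftrightarrow> PIdl\<^bsub>R\<^esub> (of_nat p) = PIdl\<^bsub>R\<^esub> (\<pi> ^ e)"

text \<open>The residue field of the p-adic integers is identified with its image in the residue field
  of the extension.\<close>

definition has_inertia_degree ::
    "nat \<Rightarrow> ((nat \<Rightarrow> rat) set \<Rightarrow> 'a::field) \<Rightarrow> 'a ring \<Rightarrow> 'a \<Rightarrow> nat \<Rightarrow> bool" where
  "has_inertia_degree p \<iota> R \<pi> f \<longleftrightarrow>
     ring.dimension (R Quot PIdl\<^bsub>R\<^esub> \<pi>) f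
       ((\<lambda>z. residue R \<pi> (\<iota> z)) ` padic_integers p) (carrier (R Quot PIdl\<^bsub>R\<^esub> \<pi>))"


section \<open>Classical groups over a subring of a field\<close>

definition square_mats :: "('a, 'b) ring_scheme \<Rightarrow> nat \<Rightarrow> 'a mat set" where
  "square_mats R n = {x \<in> carrier_mat n n. elements_mat x \<subseteq> carrier R}"

definition mat_group :: "nat \<Rightarrow> 'a::field mat set \<Rightarrow> 'a mat monoid" where
  "mat_group n S = \<lparr>carrier = S, monoid.mult = (*), one = 1\<^sub>m n\<rparr>"

definition symplectic_form :: "nat \<Rightarrow> 'a::field mat" where
  "symplectic_form l = four_block_mat (0\<^sub>m l l) (1\<^sub>m l) (- 1\<^sub>m l) (0\<^sub>m l l)"

definition even_orthogonal_form :: "nat \<Rightarrow> 'a::field mat" where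
  "even_orthogonal_form l = four_block_mat (0\<^sub>m l l) (1\<^sub>m l) (1\<^sub>m l) (0\<^sub>m l l)"

definition orthogonal_form :: "nat \<Rightarrow> 'a::field mat" where
  "orthogonal_form n =
     (if even n then even_orthogonal_form (n div 2)
      else four_block_mat (1\<^sub>m 1) (0\<^sub>m 1 (n - 1)) (0\<^sub>m (n - 1) 1)
             (even_orthogonal_form (n div 2)))"

definition SL :: "'a::field ring \<Rightarrow> nat \<Rightarrow> 'a mat monoid" where
  "SL R n = mat_group n {x \<in> square_mats R n. det x = 1}"

text \<open>Only meaningful for even \<^term>\<open>n\<close>.\<close>

definition Sp :: "'a::field ring \<Rightarrow> nat \<Rightarrow> 'a mat monoid" where
  "Sp R n =
     mat_group n {x \<in> square_mats R n.
       transpose_mat x * symplectic_form (n div 2) * x = symplectic_form (n div 2)}"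

definition SO :: "'a::field ring \<Rightarrow> nat \<Rightarrow> 'a mat monoid" where
  "SO R n =
     mat_group n {x \<in> square_mats R n.
       det x = 1 \<and> transpose_mat x * orthogonal_form n * x = orthogonal_form n}"

text \<open>The kernel of entrywise reduction modulo the ideal generated by \<^term>\<open>a\<close>.\<close>

definition congruence_kernel :: "'a::field ring \<Rightarrow> 'a \<Rightarrow> 'a mat monoid \<Rightarrow> 'a mat monoid" where
  "congruence_kernel R a G =
     G\<lparr>carrier := {x \<in> carrier G. map_mat (residue R a) x = map_mat (residue R a) \<one>\<^bsub>G\<^esub>}\<rparr>"


section \<open>Self-similar groups\<close>

text \<open>The vertices of the regular rooted tree over an alphabet \<^term>\<open>A\<close> are the words
  \<^term>\<open>lists A\<close>; the children of \<^term>\<open>w\<close> are the words \<^term>\<open>w @ [x]\<close>.\<close>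

definition tree_automorphism :: "'x set \<Rightarrow> ('x list \<Rightarrow> 'x list) \<Rightarrow> bool" where
  "tree_automorphism A \<alpha> \<longleftrightarrow>
     bij_betw \<alpha> (lists A) (lists A) \<and> \<alpha> [] = [] \<and>
     (\<forall>w\<in>lists A. \<forall>x\<in>A. \<exists>y\<in>A. \<alpha> (w @ [x]) = \<alpha> w @ [y])"

definition self_similar_action ::
    "('g, 'b) monoid_scheme \<Rightarrow> 'x set \<Rightarrow> ('g \<Rightarrow> 'x list \<Rightarrow> 'x list) \<Rightarrow> bool" where
  "self_similar_action G A \<phi> \<longleftrightarrow>
     group_action G (lists A) \<phi> \<and> (\<forall>g\<in>carrier G. tree_automorphism A (\<phi> g)) \<and>
     (\<forall>g\<in>carrier G. \<forall>x\<in>A. \<exists>h\<in>carrier G. \<exists>y\<in>A. \<forall>w\<in>lists A. \<phi> g (x # w) = y # \<phi> h w)"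

definition self_similar_of_index :: "('g, 'b) monoid_scheme \<Rightarrow> nat \<Rightarrow> bool" where
  "self_similar_of_index G \<delta> \<longleftrightarrow>
     \<delta> \<ge> 1 \<and>
     (\<exists>\<phi>. self_similar_action G {..<\<delta>} \<phi> \<and> faithful_action G (lists {..<\<delta>}) \<phi> \<and>
        (\<forall>x<\<delta>. \<forall>y<\<delta>. \<exists>g\<in>carrier G. \<phi> g [x] = [y]))"

definition self_similar :: "('g, 'b) monoid_scheme \<Rightarrow> bool" where
  "self_similar G \<longleftrightarrow> (\<exists>\<delta>. self_similar_of_index G \<delta>)"

definition self_similarity_index :: "('g, 'b) monoid_scheme \<Rightarrow> nat" where
  "self_similarity_index G = (LEAST \<delta>. self_similar_of_index G \<delta>)"

text \<open>A bound on the index includes the assertion that the group is self-similar.\<close>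

definition self_similarity_index_le :: "('g, 'b) monoid_scheme \<Rightarrow> real \<Rightarrow> bool" where
  "self_similarity_index_le G B \<longleftrightarrow> self_similar G \<and> real (self_similarity_index G) \<le> B"

end

theory Submission
  imports Defs
begin

text \<open>A simple virtual endomorphism of index \<open>\<delta>\<close> gives a self-similar action of index \<open>\<delta>\<close>. In all
  cases the endomorphism is conjugation by a diagonal matrix whose entries are powers of the
  uniformizer; it divides the entries of one column, except the diagonal one, by the uniformizer or
  its square. An invariant normal subgroup therefore fixes the line spanned by the corresponding
  basis vector, hence every line in the orbit of this line under the group, and this forces its
  elements to be scalar. Scalars congruent to 1 are trivial because they are roots of unity of order
  prime to \<open>p\<close>. The index is bounded by counting residues of the column. For the groups of integral
  points the domain consists of elements whose column is congruent to the basis vector; its index is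
  so small that the orders of the finite classical groups are not needed.\<close>

section \<open>Self-similar actions from virtual endomorphisms\<close>

text \<open>The square of the uniformizer is forced by the forms: conjugation by a diagonal matrix
  preserves isometries when the matrix is a similitude, so the weights of paired basis vectors must
  have a constant sum. Weight 0 at the distinguished vector and 1 at the middle ones leaves 2 for
  its partner. Rigidity rests on the fact that the orbit of e_c contains e_c + a u and e_c - a u for
  many u. Together with e_c these are three pairwise independent eigenvectors in one plane, so u has
  the same eigenvalue. In orthogonal groups the orbit consists of isotropic vectors, hence a
  correction term quadratic in a appears and the three vectors leave the plane; there the invariant
  form has to supply the eigenvalues. The size hypotheses make 2, and l + 1 in the linear case,
  prime to p. For integral points the index is at most q^n or q^(2n). The products in the bounds are
  at least 1/2, or 1/4 in case (3), so they cost at most one or two powers of q, and e >= 1 leaves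
  room for these in the exponent.\<close>

primrec tree_act ::
    "('g, 'b) monoid_scheme \<Rightarrow> ('g \<Rightarrow> nat) \<Rightarrow> (nat \<Rightarrow> 'g) \<Rightarrow> ('g \<Rightarrow> 'g) \<Rightarrow> nat list \<Rightarrow> 'g \<Rightarrow> nat list" where
  "tree_act G ind r \<theta> [] g = []"
| "tree_act G ind r \<theta> (i # w) g =
     ind (g \<otimes>\<^bsub>G\<^esub> r i) # tree_act G ind r \<theta> w (\<theta> (inv\<^bsub>G\<^esub> r (ind (g \<otimes>\<^bsub>G\<^esub> r i)) \<otimes>\<^bsub>G\<^esub> (g \<otimes>\<^bsub>G\<^esub> r i)))"

text \<open>The letters of the tree are the left cosets of D with representatives r 0, ..., r
  (\<delta> - 1). By \<open>ind_rep\<close> and \<open>ind_unique\<close> each x lies in r i D for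
  exactly one i, so \<delta> is the index of D.\<close>

locale virtual_endomorphism = group G + D: subgroup D G
  for G (structure) and D +
  fixes \<theta> :: "'a \<Rightarrow> 'a" and \<delta> :: nat and r :: "nat \<Rightarrow> 'a" and ind :: "'a \<Rightarrow> nat"
  assumes endo_closed: "x \<in> D \<Longrightarrow> \<theta> x \<in> carrier G"
    and endo_mult: "x \<in> D \<Longrightarrow> y \<in> D \<Longrightarrow> \<theta> (x \<otimes> y) = \<theta> x \<otimes> \<theta> y"
    and rep_closed: "i < \<delta> \<Longrightarrow> r i \<in> carrier G"
    and ind_less: "x \<in> carrier G \<Longrightarrow> ind x < \<delta>"
    and ind_rep: "x \<in> carrier G \<Longrightarrow> inv r (ind x) \<otimes> x \<in> D"
    and ind_unique: "x \<in> carrier G \<Longrightarrow> i < \<delta> \<Longrightarrow> inv r i \<otimes> x \<in> D \<Longrightarrow> ind x = i"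
    and simple: "N \<lhd> G \<Longrightarrow> N \<subseteq> D \<Longrightarrow> \<theta> ` N \<subseteq> N \<Longrightarrow> N = {\<one>}"
begin

abbreviation "sec g i \<equiv> \<theta> (inv r (ind (g \<otimes> r i)) \<otimes> (g \<otimes> r i))"
abbreviation "act w g \<equiv> tree_act G ind r \<theta> w g"

lemma sec_closed: "g \<in> carrier G \<Longrightarrow> i < \<delta> \<Longrightarrow> sec g i \<in> carrier G"
  by (intro endo_closed ind_rep m_closed rep_closed)

lemma endo_one: "\<theta> \<one> = \<one>"
  using endo_mult[of \<one> \<one>] endo_closed[of \<one>] D.one_closed l_cancel_one by force

text \<open>Write h r_i = r_j d and g r_j = r_k d' with d, d' in D. Then g h r_i = r_k (d' d), so
  indices compose and sections satisfy a cocycle rule; this makes \<open>act\<close> an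
  action.\<close>

lemma ind_mult:
  assumes "g \<in> carrier G" "h \<in> carrier G" "i < \<delta>"
  shows "ind (g \<otimes> h \<otimes> r i) = ind (g \<otimes> r (ind (h \<otimes> r i)))"
    and "sec (g \<otimes> h) i = sec g (ind (h \<otimes> r i)) \<otimes> sec h i"
proof -
  let ?j = "ind (h \<otimes> r i)" let ?k = "ind (g \<otimes> r ?j)"
  have c: "r i \<in> carrier G" "h \<otimes> r i \<in> carrier G" using assms rep_closed by auto
  have j: "?j < \<delta>" "r ?j \<in> carrier G" using ind_less c rep_closed by auto
  have k: "?k < \<delta>" "r ?k \<in> carrier G" using ind_less j assms rep_closed by auto
  have D: "inv r ?j \<otimes> (h \<otimes> r i) \<in> D" "inv r ?k \<otimes> (g \<otimes> r ?j) \<in> D"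
    using ind_rep c j assms by auto
  have canc: "r ?j \<otimes> (inv r ?j \<otimes> (h \<otimes> r i)) = h \<otimes> r i"
    using c j by (simp flip: m_assoc)
  have eq: "(inv r ?k \<otimes> (g \<otimes> r ?j)) \<otimes> (inv r ?j \<otimes> (h \<otimes> r i)) = inv r ?k \<otimes> (g \<otimes> h \<otimes> r i)"
    using c j k assms canc by (simp add: m_assoc)
  show *: "ind (g \<otimes> h \<otimes> r i) = ?k"
    using D.m_closed[OF D(2,1)] c k assms by (intro ind_unique) (auto simp: eq)
  show "sec (g \<otimes> h) i = sec g ?j \<otimes> sec h i"
    unfolding * eq[symmetric] by (rule endo_mult[OF D(2,1)])
qed

lemma ind_rep_self: "i < \<delta> \<Longrightarrow> ind (r i) = i"
  using rep_closed by (intro ind_unique) (auto simp: D.one_closed)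

lemma act_one: "w \<in> lists {..<\<delta>} \<Longrightarrow> act w \<one> = w"
  by (induction w) (auto simp: ind_rep_self rep_closed endo_one)

lemma act_closed: "w \<in> lists {..<\<delta>} \<Longrightarrow> g \<in> carrier G \<Longrightarrow> act w g \<in> lists {..<\<delta>}"
  by (induction w arbitrary: g) (auto simp: ind_less rep_closed sec_closed)

lemma act_mult:
  "w \<in> lists {..<\<delta>} \<Longrightarrow> g \<in> carrier G \<Longrightarrow> h \<in> carrier G \<Longrightarrow> act w (g \<otimes> h) = act (act w h) g"
proof (induction w arbitrary: g h)
  case (Cons i w)
  then have i: "i < \<delta>" and w: "w \<in> lists {..<\<delta>}" by auto
  have j: "ind (h \<otimes> r i) < \<delta>" using i Cons.prems rep_closed ind_less by auto
  show ?case
    using Cons.IH[OF w sec_closed[OF Cons.prems(2) j] sec_closed[OF Cons.prems(3) i]]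
    by (simp add: ind_mult(1)[OF Cons.prems(2,3) i] flip: ind_mult(2)[OF Cons.prems(2,3) i])
qed simp

lemma act_snoc:
  "w \<in> lists {..<\<delta>} \<Longrightarrow> x < \<delta> \<Longrightarrow> g \<in> carrier G \<Longrightarrow> \<exists>y<\<delta>. act (w @ [x]) g = act w g @ [y]"
  by (induction w arbitrary: g) (auto simp: ind_less rep_closed sec_closed)

lemma act_bij: "g \<in> carrier G \<Longrightarrow> bij_betw (\<lambda>w. act w g) (lists {..<\<delta>}) (lists {..<\<delta>})"
proof (rule bij_betwI[where g = "\<lambda>w. act w (inv g)"])
  fix w assume "g \<in> carrier G" "w \<in> lists {..<\<delta>}"
  then show "act (act w g) (inv g) = w" "act (act w (inv g)) g = w"
    by (simp_all add: act_one flip: act_mult del: in_lists_conv_set)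
qed (auto simp: act_closed simp del: in_lists_conv_set)

text \<open>The kernel of the action is normal, lies in \<^term>\<open>D\<close> and is invariant under \<^term>\<open>\<theta>\<close>.\<close>

lemma act_faithful:
  assumes g: "g \<in> carrier G" and triv: "\<And>w. w \<in> lists {..<\<delta>} \<Longrightarrow> act w g = w"
  shows "g = \<one>"
proof -
  define N where "N = {g \<in> carrier G. \<forall>w \<in> lists {..<\<delta>}. act w g = w}"
  have inv_N: "inv g \<in> N" if "g \<in> N" for g
  proof -
    have "act w (inv g) = w" if w: "w \<in> lists {..<\<delta>}" for w
    proof -
      have "act w (inv g \<otimes> g) = act (act w g) (inv g)"
        using w \<open>g \<in> N\<close> by (intro act_mult) (auto simp: N_def)
      then show ?thesis using w \<open>g \<in> N\<close> by (simp add: N_def act_one del: in_lists_conv_set)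
    qed
    then show ?thesis using that by (simp add: N_def)
  qed
  have sub: "subgroup N G"
  proof (rule subgroupI)
    have "\<one> \<in> N" by (simp add: N_def act_one del: in_lists_conv_set)
    then show "N \<noteq> {}" by blast
  qed (use inv_N in \<open>auto simp: N_def act_mult simp del: in_lists_conv_set\<close>)
  have conj: "x \<otimes> h \<otimes> inv x \<in> N" if x: "x \<in> carrier G" and h: "h \<in> N" for x h
  proof -
    have "act w (x \<otimes> h \<otimes> inv x) = w" if w: "w \<in> lists {..<\<delta>}" for w
    proof -
      have c: "act w (inv x) \<in> lists {..<\<delta>}" using w x by (intro act_closed) auto
      have "act w (x \<otimes> h \<otimes> inv x) = act (act w (inv x)) (x \<otimes> h)"
        using w x h by (intro act_mult) (auto simp: N_def)
      also have "\<dots> = act (act w (inv x)) x"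
        using act_mult[OF c, of x h] c x h by (auto simp: N_def simp del: in_lists_conv_set)
      also have "\<dots> = act w (x \<otimes> inv x)" using w x by (intro act_mult[symmetric]) auto
      finally show ?thesis using w x by (simp add: act_one del: in_lists_conv_set)
    qed
    then show ?thesis using x h by (simp add: N_def)
  qed
  have normal: "N \<lhd> G" using sub conj by (simp add: normal_inv_iff)
  have \<delta>: "\<delta> > 0" using ind_less[of \<one>] by auto
  \<comment> \<open>The letter of the coset D. Its representative may differ from the identity but
    lies in D, so conjugation by its image under \<theta> relates the section at i0 to \<theta>
    itself.\<close>
  define i0 where "i0 = ind \<one>"
  have i0: "i0 < \<delta>" using ind_less[of \<one>] by (auto simp: i0_def)
  let ?r = "r i0"
  have r: "?r \<in> carrier G" and rD: "inv ?r \<in> D"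
    using rep_closed[OF i0] ind_rep[of \<one>] by (auto simp: i0_def)
  have rD': "?r \<in> D" using D.m_inv_closed[OF rD] r by simp
  have sec_N: "inv ?r \<otimes> (h \<otimes> ?r) \<in> D" "\<theta> (inv ?r \<otimes> (h \<otimes> ?r)) \<in> N" if h: "h \<in> N" for h
  proof -
    have hc: "h \<in> carrier G" using h by (auto simp: N_def)
    have "act (i0 # w) h = i0 # w" if "w \<in> lists {..<\<delta>}" for w
      using h i0 that by (simp add: N_def del: tree_act.simps)
    then have *: "ind (h \<otimes> ?r) = i0" "w \<in> lists {..<\<delta>} \<Longrightarrow> act w (sec h i0) = w" for w
      using lists.Nil by fastforce+
    show "inv ?r \<otimes> (h \<otimes> ?r) \<in> D" using ind_rep[of "h \<otimes> ?r"] *(1) hc r by auto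
    show "\<theta> (inv ?r \<otimes> (h \<otimes> ?r)) \<in> N"
      using * sec_closed[OF hc i0] by (simp add: N_def del: in_lists_conv_set)
  qed
  have ND: "N \<subseteq> D"
  proof
    fix h assume h: "h \<in> N"
    then have hc: "h \<in> carrier G" by (auto simp: N_def)
    have "?r \<otimes> (inv ?r \<otimes> (h \<otimes> ?r)) \<otimes> inv ?r \<in> D" using sec_N(1)[OF h] rD rD' by auto
    moreover have "?r \<otimes> (inv ?r \<otimes> (h \<otimes> ?r)) = h \<otimes> ?r" using hc r by (simp flip: m_assoc)
    moreover have "h \<otimes> ?r \<otimes> inv ?r = h" using hc r by (simp add: m_assoc)
    ultimately show "h \<in> D" by simp
  qed
  have "\<theta> ` N \<subseteq> N"
  proof
    fix y assume "y \<in> \<theta> ` N"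
    then obtain h where h: "h \<in> N" "y = \<theta> h" by auto
    have hc: "h \<in> carrier G" and hD: "h \<in> D" using h ND by (auto simp: N_def)
    let ?h = "inv ?r \<otimes> (h \<otimes> ?r)"
    have "?r \<otimes> ?h = h \<otimes> ?r" using hc r by (simp flip: m_assoc)
    then have "\<theta> ?r \<otimes> \<theta> ?h = \<theta> h \<otimes> \<theta> ?r"
      using endo_mult[OF rD' sec_N(1)[OF h(1)]] endo_mult[OF hD rD'] by simp
    then have "\<theta> h = \<theta> ?r \<otimes> \<theta> ?h \<otimes> inv (\<theta> ?r)"
      using endo_closed[OF rD'] endo_closed[OF hD] by (simp add: m_assoc)
    then show "y \<in> N" using conj[OF endo_closed[OF rD'] sec_N(2)[OF h(1)]] h by simp
  qed
  then have "N = {\<one>}" using simple normal ND by blast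
  then show ?thesis using g triv by (auto simp: N_def)
qed

theorem self_similar: "self_similar_of_index G \<delta>"
proof -
  \<comment> \<open>Elements of \<open>BijGroup\<close> are extensional, hence the restriction to
    words over the alphabet.\<close>
  define \<phi> where "\<phi> g = restrict (\<lambda>w. act w g) (lists {..<\<delta>})" for g
  let ?L = "lists {..<\<delta>}"
  have Bij: "\<phi> g \<in> Bij ?L" if "g \<in> carrier G" for g
    using act_bij[OF that] by (auto simp: Bij_def \<phi>_def bij_betw_restrict_eq simp del: in_lists_conv_set)
  have hom: "group_hom G (BijGroup ?L) \<phi>"
  proof -
    have "\<phi> (g \<otimes> h) = compose ?L (\<phi> g) (\<phi> h)" if "g \<in> carrier G" "h \<in> carrier G" for g h
      using that act_closed[OF _ that(2)]
      by (auto simp: \<phi>_def compose_def restrict_def fun_eq_iff act_mult simp del: in_lists_conv_set)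
    then have "\<phi> \<in> hom G (BijGroup ?L)"
      using Bij by (intro homI) (auto simp: BijGroup_def)
    then show ?thesis
      by (simp add: group_hom_def group_hom_axioms_def group_BijGroup is_group)
  qed
  have ga: "group_action G ?L \<phi>" using hom by (simp add: group_action_def)
  have tree: "tree_automorphism {..<\<delta>} (\<phi> g)" if g: "g \<in> carrier G" for g
    unfolding tree_automorphism_def
  proof (intro conjI ballI)
    show "bij_betw (\<phi> g) ?L ?L" using Bij[OF g] by (auto simp: Bij_def)
    show "\<phi> g [] = []" by (simp add: \<phi>_def)
    fix w x assume "w \<in> ?L" "x \<in> {..<\<delta>}"
    then show "\<exists>y\<in>{..<\<delta>}. \<phi> g (w @ [x]) = \<phi> g w @ [y]"
      using act_snoc[of w x g] g by (auto simp: \<phi>_def)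
  qed
  have ss: "self_similar_action G {..<\<delta>} \<phi>"
    unfolding self_similar_action_def
  proof (intro conjI ballI ga)
    fix g x assume g: "g \<in> carrier G" and x: "x \<in> {..<\<delta>}"
    then have x': "x < \<delta>" by simp
    show "\<exists>h\<in>carrier G. \<exists>y\<in>{..<\<delta>}. \<forall>w\<in>?L. \<phi> g (x # w) = y # \<phi> h w"
      using sec_closed[OF g x'] ind_less[OF m_closed[OF g rep_closed[OF x']]] x
      by (intro bexI[of _ "sec g x"] bexI[of _ "ind (g \<otimes> r x)"]) (auto simp: \<phi>_def)
  qed (use tree in auto)
  have inj: "inj_on \<phi> (carrier G)"
  proof (rule inj_onI)
    fix g h assume g: "g \<in> carrier G" and h: "h \<in> carrier G" and eq: "\<phi> g = \<phi> h"
    have e: "act w g = act w h" if "w \<in> ?L" for w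
      using fun_cong[OF eq, of w] that by (simp add: \<phi>_def)
    have "act w (inv h \<otimes> g) = w" if w: "w \<in> ?L" for w
      using act_mult[OF w, of "inv h" g] act_mult[OF w, of "inv h" h] e[OF w] g h w
      by (simp add: act_one del: in_lists_conv_set)
    then have "inv h \<otimes> g = \<one>" using act_faithful[of "inv h \<otimes> g"] g h by auto
    then show "g = h" using g h by (metis inv_closed inv_equality inv_inv)
  qed
  have faithful: "faithful_action G ?L \<phi>"
    using ga inj by (simp add: faithful_action_def faithful_action_axioms_def)
  have trans: "\<exists>g\<in>carrier G. \<phi> g [x] = [y]" if x: "x < \<delta>" and y: "y < \<delta>" for x y
  proof (intro bexI)
    have "r y \<otimes> inv r x \<otimes> r x = r y"
      using rep_closed[OF x] rep_closed[OF y] by (simp add: m_assoc)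
    then show "\<phi> (r y \<otimes> inv r x) [x] = [y]" using x y by (simp add: \<phi>_def ind_rep_self)
  qed (use rep_closed[OF x] rep_closed[OF y] in auto)
  have "\<delta> \<ge> 1" using ind_less[of \<one>] by auto
  then show ?thesis unfolding self_similar_of_index_def using ss faithful trans by blast
qed

end

text \<open>The map \<^term>\<open>\<kappa>\<close> bounds the index of the domain: it separates the left cosets of \<^term>\<open>D\<close>.\<close>

theorem self_similarity_index_leI:
  fixes G (structure)
  assumes G: "group G" and D: "subgroup D G"
    and hom: "\<And>x. x \<in> D \<Longrightarrow> \<theta> x \<in> carrier G" "\<And>x y. x \<in> D \<Longrightarrow> y \<in> D \<Longrightarrow> \<theta> (x \<otimes> y) = \<theta> x \<otimes> \<theta> y"
    and simple: "\<And>N. N \<lhd> G \<Longrightarrow> N \<subseteq> D \<Longrightarrow> \<theta> ` N \<subseteq> N \<Longrightarrow> N = {\<one>}"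
    and T: "finite T" "\<And>x. x \<in> carrier G \<Longrightarrow> \<kappa> x \<in> T" "real (card T) \<le> B"
    and sep: "\<And>x y. x \<in> carrier G \<Longrightarrow> y \<in> carrier G \<Longrightarrow> \<kappa> x = \<kappa> y \<Longrightarrow> inv x \<otimes> y \<in> D"
  shows "self_similarity_index_le G B"
proof -
  interpret group G by fact
  interpret D: subgroup D G by fact
  define cl where "cl x = x <# D" for x
  define Q where "Q = cl ` carrier G"
  have cl_eq: "cl x = cl y \<longleftrightarrow> inv x \<otimes> y \<in> D" if "x \<in> carrier G" "y \<in> carrier G" for x y
  proof
    assume "cl x = cl y"
    moreover have "y \<in> cl y" using that D.one_closed by (force simp: cl_def l_coset_def)
    ultimately obtain d where "d \<in> D" "y = x \<otimes> d" by (auto simp: cl_def l_coset_def)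
    then show "inv x \<otimes> y \<in> D" using that by (simp flip: m_assoc)
  next
    assume a: "inv x \<otimes> y \<in> D"
    have "y = x \<otimes> (inv x \<otimes> y)" using that by (simp flip: m_assoc)
    then have "y \<in> x <# D" using a by (force simp: l_coset_def)
    then show "cl x = cl y" unfolding cl_def using that D by (metis l_repr_independence)
  qed
  \<comment> \<open>The value of \<kappa> determines the coset, so choosing an arbitrary element for
    each value covers all cosets by an image of T; finiteness and the bound follow together.\<close>
  have "Q \<subseteq> (\<lambda>t. cl (SOME x. x \<in> carrier G \<and> \<kappa> x = t)) ` T"
  proof
    fix c assume "c \<in> Q"
    then obtain x where x: "x \<in> carrier G" "c = cl x" by (auto simp: Q_def)
    let ?y = "SOME y. y \<in> carrier G \<and> \<kappa> y = \<kappa> x"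
    have "?y \<in> carrier G \<and> \<kappa> ?y = \<kappa> x" by (rule someI[of _ x]) (use x in auto)
    then have "cl ?y = c" using sep[of ?y x] cl_eq x by auto
    then show "c \<in> (\<lambda>t. cl (SOME x. x \<in> carrier G \<and> \<kappa> x = t)) ` T" using T(2)[OF x(1)] by force
  qed
  then have fin: "finite Q" and card: "card Q \<le> card T"
    using T(1) by (auto intro: finite_subset surj_card_le)
  obtain e where e: "bij_betw e {0..<card Q} Q" using ex_bij_betw_nat_finite[OF fin] by blast
  define ind where "ind x = inv_into {0..<card Q} e (cl x)" for x
  define r where "r i = (SOME x. x \<in> carrier G \<and> cl x = e i)" for i
  have r: "r i \<in> carrier G \<and> cl (r i) = e i" if "i < card Q" for i
  proof -
    have "e i \<in> Q" using e that by (auto simp: bij_betw_def)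
    then show ?thesis unfolding r_def by (intro someI_ex[of "\<lambda>x. x \<in> carrier G \<and> cl x = e i"]) (auto simp: Q_def)
  qed
  have ind: "ind x < card Q" "e (ind x) = cl x" if "x \<in> carrier G" for x
  proof -
    have "cl x \<in> e ` {0..<card Q}" using e that by (auto simp: bij_betw_def Q_def)
    then show "ind x < card Q" "e (ind x) = cl x"
      using inv_into_into[of "cl x" e "{0..<card Q}"] f_inv_into_f[of "cl x" e "{0..<card Q}"]
      by (auto simp: ind_def)
  qed
  interpret virtual_endomorphism G D \<theta> "card Q" r ind
  proof
    fix x assume x: "x \<in> carrier G"
    then show "inv r (ind x) \<otimes> x \<in> D" using ind[OF x] r[of "ind x"] cl_eq by metis
    fix i assume i: "i < card Q" "inv r i \<otimes> x \<in> D"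
    then have "cl x = e i" using cl_eq r x by metis
    then show "ind x = i"
      using e i unfolding ind_def by (auto simp: bij_betw_def)
  qed (use hom r ind simple in auto)
  have "self_similarity_index G \<le> card Q"
    unfolding self_similarity_index_def by (rule Least_le) (rule self_similar)
  then show ?thesis
    using self_similar card T(3) unfolding self_similarity_index_le_def self_similar_def by auto
qed

section \<open>The ring of integers\<close>

text \<open>All facts on the ring of integers that the group theory uses, phrased inside the field.
  Separation of classes modulo \<pi> by the numbers \<rho> a < q expresses that there are at most q
  classes.\<close>

locale uniformized_ring =
  fixes S :: "'a::field set" and \<pi> :: 'a and p q :: nat
  assumes zero_closed [simp, intro]: "0 \<in> S" and one_closed [simp, intro]: "1 \<in> S"
    and add_closed [simp, intro]: "x \<in> S \<Longrightarrow> y \<in> S \<Longrightarrow> x + y \<in> S"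
    and uminus_closed [simp, intro]: "x \<in> S \<Longrightarrow> - x \<in> S"
    and mult_closed [simp, intro]: "x \<in> S \<Longrightarrow> y \<in> S \<Longrightarrow> x * y \<in> S"
    and uniformizer_closed [simp, intro]: "\<pi> \<in> S" and uniformizer_nonzero [simp]: "\<pi> \<noteq> 0"
    and uniformizer_nonunit: "a \<in> S \<Longrightarrow> \<pi> * a \<noteq> 1"
    and prime: "Factorial_Ring.prime p" and dvd_prime: "\<exists>a\<in>S. of_nat p = \<pi> * a"
    and separated: "x \<in> S \<Longrightarrow> (\<And>k. \<exists>a\<in>S. x = \<pi> ^ k * a) \<Longrightarrow> x = 0"
    and residues: "\<exists>\<rho>. (\<forall>a\<in>S. \<rho> a < q) \<and> (\<forall>a\<in>S. \<forall>b\<in>S. \<rho> a = (\<rho> b :: nat) \<longrightarrow> (\<exists>c\<in>S. a - b = \<pi> * c))"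

section \<open>The p-adic integers inside the extension field, by Cauchy sequences\<close>

lemma padic_norm_of_nat_prime:
  assumes p: "Factorial_Ring.prime p"
  shows "padic_norm p (of_nat p) = 1 / real p"
proof -
  have "padic_norm p (of_int (int p) / of_int 1) = 1 / real p"
    by (subst padic_norm_divide[OF p]) (use p in \<open>auto simp: power_int_minus divide_inverse\<close>)
  then show ?thesis by simp
qed

lemma padic_norm_power:
  "Factorial_Ring.prime p \<Longrightarrow> padic_norm p (x ^ k) = padic_norm p x ^ k"
  by (induction k) (auto simp: padic_norm_mult)

text \<open>Nonzero norms are integral powers of p, so none lies strictly between 1/p and 1.\<close>

lemma padic_norm_lt_one:
  assumes p: "Factorial_Ring.prime p" and "padic_norm p x < 1"
  shows "padic_norm p x \<le> 1 / real p"
proof (cases "x = 0")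
  case False
  obtain a b where x: "x = of_int a / of_int b" "a \<noteq> 0" "b \<noteq> 0" using rat_cases_ne False by metis
  let ?k = "int (multiplicity (int p) b) - int (multiplicity (int p) a)"
  have eq: "padic_norm p x = real p powi ?k" unfolding x(1) by (rule padic_norm_divide[OF p x(2,3)])
  have p1: "real p > 1" using prime_gt_1_nat[OF p] by simp
  have "?k \<le> -1"
  proof (rule ccontr)
    assume "\<not> ?k \<le> -1"
    then have "real p powi 0 \<le> real p powi ?k" using p1 by (intro power_int_increasing) auto
    then show False using eq assms(2) by simp
  qed
  then have "real p powi ?k \<le> real p powi (-1)" using p1 by (intro power_int_increasing) auto
  then show ?thesis using eq by (simp add: power_int_minus divide_inverse)
qed simp

text \<open>With x = c/d in lowest terms, norm at most 1 forces p not to divide d. The digit is c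
  times the inverse v of d modulo p.\<close>

lemma padic_integer_near_nat:
  assumes p: "Factorial_Ring.prime p" and x: "padic_norm p x \<le> 1"
  obtains i where "i < p" "padic_norm p (x - of_nat i) < 1"
proof (cases "x = 0")
  case True
  then show ?thesis using that[of 0] prime_gt_0_nat[OF p] by simp
next
  case False
  obtain c d where q: "quotient_of x = (c, d)" by force
  have d: "d > 0" and xq: "x = of_int c / of_int d" and cop: "coprime c d"
    using q quotient_of_denom_pos quotient_of_div quotient_of_coprime by blast+
  have c: "c \<noteq> 0" using xq False by auto
  have pp: "Factorial_Ring.prime (int p)" using p by simp
  have p1: "real p > 1" using prime_gt_1_nat[OF p] by simp
  have ndvd: "\<not> int p dvd d"
  proof
    assume dv: "int p dvd d"
    then have "\<not> int p dvd c" using cop pp by (meson coprime_common_divisor not_prime_unit)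
    then have "multiplicity (int p) c = 0" by (rule not_dvd_imp_multiplicity_0)
    moreover have "multiplicity (int p) d \<ge> 1"
      using dv d pp by (intro multiplicity_geI) auto
    ultimately have "real p powi 1 \<le> padic_norm p x" unfolding xq padic_norm_divide[OF p c less_imp_neq[OF d, symmetric]]
      using p1 by (intro power_int_increasing) auto
    then show False using x p1 by simp
  qed
  then have "coprime (int p) d" using pp by (simp add: prime_imp_coprime)
  then obtain u v where uv: "u * int p + v * d = 1"
    using bezout_int[of "int p" d] by (metis coprime_imp_gcd_eq_1)
  define i where "i = nat ((c * v) mod int p)"
  have p0: "int p > 0" using pp prime_gt_0_int by blast
  have i: "i < p" "int i = (c * v) mod int p" using p0 by (auto simp: i_def nat_less_iff)
  have "int p dvd c * v - int i" unfolding i(2) by (simp add: minus_mod_eq_mult_div)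
  moreover have "c - int i * d = c * (u * int p) + (c * v - int i) * d"
  proof -
    have "c - int i * d = c * (u * int p + v * d) - int i * d" using uv by simp
    then show ?thesis by (simp add: algebra_simps)
  qed
  ultimately have dv: "int p dvd c - int i * d" by simp
  have "padic_norm p (x - of_nat i) < 1"
  proof (cases "c - int i * d = 0")
    case True
    have "x - of_nat i = of_int (c - int i * d) / of_int d" using d by (simp add: xq field_simps)
    then show ?thesis using True by simp
  next
    case nz: False
    have eq: "x - of_nat i = of_int (c - int i * d) / of_int d" using d by (simp add: xq field_simps)
    have "multiplicity (int p) d = 0" using ndvd by (rule not_dvd_imp_multiplicity_0)
    moreover have "multiplicity (int p) (c - int i * d) \<ge> 1"
      using dv nz pp by (intro multiplicity_geI) auto
    ultimately have "padic_norm p (x - of_nat i) \<le> real p powi (-1)"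
      unfolding eq padic_norm_divide[OF p nz less_imp_neq[OF d, symmetric]]
      using p1 by (intro power_int_increasing) auto
    also have "real p powi (-1) < 1" using p1 by (simp add: power_int_minus field_simps)
    finally show ?thesis .
  qed
  then show ?thesis using that i by blast
qed

locale padic_embedding =
  fixes p :: nat and \<iota> :: "(nat \<Rightarrow> rat) set \<Rightarrow> 'a::field"
  assumes prime: "Factorial_Ring.prime p"
    and hom: "\<iota> \<in> Ring.ring_hom (padic_field p) ring_of_field"
begin

text \<open>The image in the extension field of the p-adic number represented by the Cauchy
  sequence; calculations in the field become termwise calculations with rationals.\<close>

definition lim :: "(nat \<Rightarrow> rat) \<Rightarrow> 'a" where
  "lim a = \<iota> (null_ideal p +>\<^bsub>Cauchy_ring p\<^esub> a)"

definition Z :: "'a set" where "Z = \<iota> ` padic_integers p"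

lemma carrier_Cauchy: "carrier (Cauchy_ring p) = {a. padic_Cauchy p a}"
  by (simp add: Cauchy_ring_def)

lemma coset_closed: "padic_Cauchy p a \<Longrightarrow> null_ideal p +>\<^bsub>Cauchy_ring p\<^esub> a \<in> carrier (padic_field p)"
  by (auto simp: padic_field_def FactRing_def A_RCOSETS_def' carrier_Cauchy)

lemma lim_add: "padic_Cauchy p a \<Longrightarrow> padic_Cauchy p b \<Longrightarrow> lim (\<lambda>n. a n + b n) = lim a + lim b"
proof -
  interpret I: ideal "null_ideal p" "Cauchy_ring p" by (rule ideal_null_ideal[OF prime])
  assume ab: "padic_Cauchy p a" "padic_Cauchy p b"
  have "null_ideal p +>\<^bsub>Cauchy_ring p\<^esub> (\<lambda>n. a n + b n) =
    (null_ideal p +>\<^bsub>Cauchy_ring p\<^esub> a) \<oplus>\<^bsub>padic_field p\<^esub> (null_ideal p +>\<^bsub>Cauchy_ring p\<^esub> b)"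
    using I.a_rcos_sum[of a b] ab by (simp add: padic_field_def FactRing_def carrier_Cauchy Cauchy_ring_def)
  then show ?thesis
    using ring_hom_add[OF hom coset_closed[OF ab(1)] coset_closed[OF ab(2)]]
    by (simp add: lim_def ring_of_type_algebra_def)
qed

lemma lim_mult: "padic_Cauchy p a \<Longrightarrow> padic_Cauchy p b \<Longrightarrow> lim (\<lambda>n. a n * b n) = lim a * lim b"
proof -
  interpret I: ideal "null_ideal p" "Cauchy_ring p" by (rule ideal_null_ideal[OF prime])
  assume ab: "padic_Cauchy p a" "padic_Cauchy p b"
  have "null_ideal p +>\<^bsub>Cauchy_ring p\<^esub> (\<lambda>n. a n * b n) =
    (null_ideal p +>\<^bsub>Cauchy_ring p\<^esub> a) \<otimes>\<^bsub>padic_field p\<^esub> (null_ideal p +>\<^bsub>Cauchy_ring p\<^esub> b)"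
    using I.rcoset_mult_add[of a b] ab by (simp add: padic_field_def FactRing_def carrier_Cauchy Cauchy_ring_def)
  then show ?thesis
    using ring_hom_mult[OF hom coset_closed[OF ab(1)] coset_closed[OF ab(2)]]
    by (simp add: lim_def ring_of_type_algebra_def)
qed

lemma lim_one: "lim (\<lambda>n. 1) = 1"
  using ring_hom_one[OF hom]
  by (simp add: lim_def ring_of_type_algebra_def padic_field_def FactRing_def Cauchy_ring_def)

lemma lim_zero: "lim (\<lambda>n. 0) = 0"
proof -
  have "lim (\<lambda>n. 0) + lim (\<lambda>n. 0) = lim (\<lambda>n. 0) + 0"
    using lim_add[of "\<lambda>n. 0" "\<lambda>n. 0"] by (simp only: add_0_right padic_Cauchy_const)
  then show ?thesis by (rule add_left_imp_eq)
qed

lemma lim_of_nat: "lim (\<lambda>n. of_nat k) = of_nat k"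
  by (induction k) (simp_all add: lim_zero lim_add lim_one)

lemma lim_uminus: "padic_Cauchy p a \<Longrightarrow> lim (\<lambda>n. - a n) = - lim a"
  using lim_add[of a "\<lambda>n. - a n"] padic_Cauchy_uminus[of p a] by (simp add: lim_zero eq_neg_iff_add_eq_0 add.commute)

text \<open>Injectivity of the embedding in terms of sequences: a Cauchy sequence that is not null
  has a termwise inverse up to finitely many terms, so its limit is invertible.\<close>

lemma null_cases:
  assumes "padic_Cauchy p a"
  obtains "(\<lambda>n. padic_norm p (a n)) \<longlonglongrightarrow> 0" "lim a = 0"
  | "\<not> (\<lambda>n. padic_norm p (a n)) \<longlonglongrightarrow> 0" "lim a \<noteq> 0"
proof (cases "(\<lambda>n. padic_norm p (a n)) \<longlonglongrightarrow> 0")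
  case True
  interpret I: ideal "null_ideal p" "Cauchy_ring p" by (rule ideal_null_ideal[OF prime])
  have "a \<in> null_ideal p" "(\<lambda>n. 0) \<in> null_ideal p"
    using True assms by (auto simp: null_ideal_def carrier_Cauchy)
  then have "lim a = lim (\<lambda>n. 0)" by (simp add: lim_def I.a_rcos_const)
  then show ?thesis using True that lim_zero by simp
next
  case False
  note inv = padic_Cauchy_eventually_inverse[OF prime assms False]
  let ?b = "\<lambda>n. inverse (a n)"
  let ?c = "\<lambda>n. a n * ?b n + - 1"
  interpret I: ideal "null_ideal p" "Cauchy_ring p" by (rule ideal_null_ideal[OF prime])
  have c: "padic_Cauchy p ?c"
    by (intro padic_Cauchy_add padic_Cauchy_mult prime assms inv padic_Cauchy_const)
  have "(\<lambda>n. padic_norm p (?c n)) \<longlonglongrightarrow> 0"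
    by (rule tendsto_eventually) (use inv(2) in \<open>auto elim!: eventually_mono\<close>)
  then have "?c \<in> null_ideal p" "(\<lambda>n. 0) \<in> null_ideal p"
    using c by (auto simp: null_ideal_def carrier_Cauchy)
  then have "lim ?c = lim (\<lambda>n. 0)" by (simp add: lim_def I.a_rcos_const)
  moreover have "lim ?c = lim a * lim ?b + lim (\<lambda>n. - 1)"
    using lim_add[OF padic_Cauchy_mult[OF prime assms inv(1)] padic_Cauchy_const[of p "-1"]]
      lim_mult[OF assms inv(1)] by simp
  moreover have "lim (\<lambda>n. - 1) = - 1" using lim_uminus[of "\<lambda>n. 1"] lim_one by simp
  ultimately have "lim a * lim ?b = 1" by (simp add: lim_zero)
  then have "lim a \<noteq> 0" by auto
  then show ?thesis using False that by blast
qed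

lemma ZI: "padic_Cauchy p a \<Longrightarrow> (\<And>n. padic_norm p (a n) \<le> 1) \<Longrightarrow> lim a \<in> Z"
  unfolding Z_def padic_integers_def lim_def carrier_Cauchy by blast

lemma ZE:
  assumes "z \<in> Z"
  obtains a where "padic_Cauchy p a" "\<And>n. padic_norm p (a n) \<le> 1" "z = lim a"
  using assms unfolding Z_def padic_integers_def lim_def carrier_Cauchy by blast

lemma lim_tail:
  assumes "padic_Cauchy p a" "padic_Cauchy p b" "\<forall>\<^sub>F n in sequentially. a n = b n"
  shows "lim a = lim b"
proof -
  let ?c = "\<lambda>n. a n + - b n"
  have c: "padic_Cauchy p ?c" by (intro padic_Cauchy_add prime assms padic_Cauchy_uminus)
  have "(\<lambda>n. padic_norm p (?c n)) \<longlonglongrightarrow> 0"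
    by (rule tendsto_eventually) (use assms(3) in \<open>auto elim!: eventually_mono\<close>)
  then have "lim ?c = 0" using null_cases[OF c] by blast
  moreover have "lim ?c = lim a - lim b"
    using lim_add[OF assms(1) padic_Cauchy_uminus[OF assms(2)]] lim_uminus[OF assms(2)] by simp
  ultimately show ?thesis by simp
qed

text \<open>Membership in \<open>padic_integers\<close> asks for the norm bound at every term, so
  the terms before N are replaced by the N-th one.\<close>

lemma ZI_eventually:
  assumes a: "padic_Cauchy p a" and ev: "\<forall>\<^sub>F n in sequentially. padic_norm p (a n) \<le> 1"
  shows "lim a \<in> Z"
proof -
  obtain N where N: "\<And>n. n \<ge> N \<Longrightarrow> padic_norm p (a n) \<le> 1" using ev by (auto simp: eventually_sequentially)
  let ?b = "\<lambda>n. a (max n N)"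
  have b: "padic_Cauchy p ?b"
    unfolding padic_Cauchy_def
  proof (intro allI impI)
    fix \<epsilon> :: real assume "\<epsilon> > 0"
    then obtain M where "\<And>i j. i \<ge> M \<Longrightarrow> j \<ge> M \<Longrightarrow> padic_norm p (a i - a j) < \<epsilon>"
      using a unfolding padic_Cauchy_def by meson
    then show "\<exists>M. \<forall>i\<ge>M. \<forall>j\<ge>M. padic_norm p (a (max i N) - a (max j N)) < \<epsilon>"
      by (metis max.coboundedI1)
  qed
  have "lim a = lim ?b"
    by (rule lim_tail[OF a b]) (auto simp: eventually_sequentially max_def intro!: exI[of _ N])
  then show ?thesis using ZI[OF b] N by auto
qed

lemma Z_add: "x \<in> Z \<Longrightarrow> y \<in> Z \<Longrightarrow> x + y \<in> Z"
proof -
  assume "x \<in> Z" "y \<in> Z"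
  then obtain a b where ab: "padic_Cauchy p a" "\<And>n. padic_norm p (a n) \<le> 1" "x = lim a"
    "padic_Cauchy p b" "\<And>n. padic_norm p (b n) \<le> 1" "y = lim b" by (metis ZE)
  have "lim (\<lambda>n. a n + b n) \<in> Z"
  proof (intro ZI padic_Cauchy_add prime ab)
    fix n
    show "padic_norm p (a n + b n) \<le> 1" using padic_norm_add[OF prime, of "a n" "b n"] ab(2,5)[of n] by simp
  qed
  then show ?thesis using ab lim_add by metis
qed

lemma Z_mult: "x \<in> Z \<Longrightarrow> y \<in> Z \<Longrightarrow> x * y \<in> Z"
proof -
  assume "x \<in> Z" "y \<in> Z"
  then obtain a b where ab: "padic_Cauchy p a" "\<And>n. padic_norm p (a n) \<le> 1" "x = lim a"
    "padic_Cauchy p b" "\<And>n. padic_norm p (b n) \<le> 1" "y = lim b" by (metis ZE)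
  have "lim (\<lambda>n. a n * b n) \<in> Z"
    by (intro ZI padic_Cauchy_mult prime ab) (simp add: padic_norm_mult[OF prime] ab mult_le_one)
  then show ?thesis using ab lim_mult by metis
qed

lemma Z_uminus: "x \<in> Z \<Longrightarrow> - x \<in> Z"
  by (metis ZE ZI lim_uminus padic_Cauchy_uminus padic_norm_uminus)

lemma Z_zero: "0 \<in> Z" and Z_one: "1 \<in> Z"
  using ZI[of "\<lambda>n. 0"] ZI[of "\<lambda>n. 1"] by (auto simp: lim_zero lim_one)

lemma Z_of_nat: "of_nat k \<in> Z"
  by (induction k) (auto intro: Z_zero Z_one Z_add)

text \<open>The inverse sequence has bounded norm, and multiplication by p^k divides this norm by
  p^k; a large k makes it integral.\<close>

lemma Z_dvd_prime_power:
  assumes "z \<in> Z" "z \<noteq> 0"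
  obtains w k where "w \<in> Z" "z * w = of_nat p ^ k"
proof -
  obtain a where a: "padic_Cauchy p a" "z = lim a" using assms by (metis ZE)
  have nn: "\<not> (\<lambda>n. padic_norm p (a n)) \<longlonglongrightarrow> 0" using null_cases[OF a(1)] a assms by blast
  note inv = padic_Cauchy_eventually_inverse[OF prime a(1) nn]
  obtain B where B: "B > 0" "\<And>n. padic_norm p (inverse (a n)) \<le> B"
    using padic_Cauchy_bounded[OF prime inv(1)] by blast
  have p1: "real p > 1" using prime_gt_1_nat[OF prime] by simp
  obtain k where k: "B < real p ^ k" using real_arch_pow[OF p1] by blast
  let ?b = "\<lambda>n. of_nat p ^ k * inverse (a n)"
  have b: "padic_Cauchy p ?b" by (intro padic_Cauchy_mult prime inv padic_Cauchy_const)
  have "padic_norm p (?b n) \<le> 1" for n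
  proof -
    have "padic_norm p (?b n) = padic_norm p (inverse (a n)) / real p ^ k"
      by (simp add: padic_norm_mult[OF prime] padic_norm_power[OF prime]
          padic_norm_of_nat_prime[OF prime] power_one_over)
    then show ?thesis using B(2)[of n] k p1 by (simp add: divide_le_eq)
  qed
  then have "lim ?b \<in> Z" by (rule ZI[OF b])
  moreover have "z * lim ?b = of_nat p ^ k"
  proof -
    have "z * lim ?b = lim (\<lambda>n. a n * ?b n)" using lim_mult[OF a(1) b] a by simp
    also have "\<dots> = lim (\<lambda>n. of_nat (p ^ k))"
      by (rule lim_tail[OF padic_Cauchy_mult[OF prime a(1) b] padic_Cauchy_const])
        (rule eventually_mono[OF inv(2)], simp)
    finally show ?thesis using lim_of_nat[of "p ^ k"] by simp
  qed
  ultimately show ?thesis using that by blast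
qed

text \<open>A Cauchy sequence of integral rationals is eventually constant modulo p, so a single
  digit serves the whole tail and the rest is divisible by p.\<close>

lemma Z_digit:
  assumes "z \<in> Z"
  obtains i w where "i < p" "w \<in> Z" "z = of_nat i + of_nat p * w"
proof -
  obtain a where a: "padic_Cauchy p a" "\<And>n. padic_norm p (a n) \<le> 1" "z = lim a" using assms by (metis ZE)
  obtain N where N: "\<And>i j. i \<ge> N \<Longrightarrow> j \<ge> N \<Longrightarrow> padic_norm p (a i - a j) < 1"
    using a(1)[unfolded padic_Cauchy_def, rule_format, of 1] by auto
  obtain i where i: "i < p" "padic_norm p (a N - of_nat i) < 1"
    using padic_integer_near_nat[OF prime a(2)] by blast
  have p0: "p \<noteq> 0" using prime by auto
  let ?b = "\<lambda>n. inverse (of_nat p) * (a n + - of_nat i)"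
  have b: "padic_Cauchy p ?b"
    by (intro padic_Cauchy_mult padic_Cauchy_add prime a padic_Cauchy_const)
  have "padic_norm p (?b n) \<le> 1" if n: "n \<ge> N" for n
  proof -
    have "padic_norm p ((a n - a N) + (a N - of_nat i)) < 1"
      using padic_norm_add[OF prime, of "a n - a N" "a N - of_nat i"] N[of n N] i n by simp
    then have "padic_norm p (a n - of_nat i) < 1" by simp
    then have le: "padic_norm p (a n - of_nat i) \<le> 1 / real p" by (rule padic_norm_lt_one[OF prime])
    have "padic_norm p (of_nat p) * padic_norm p (?b n) = padic_norm p (a n - of_nat i)"
      using p0 by (simp flip: padic_norm_mult[OF prime] mult.assoc)
    then show ?thesis
      using le p0 by (simp add: padic_norm_of_nat_prime[OF prime] field_simps)
  qed
  then have w: "lim ?b \<in> Z" by (intro ZI_eventually[OF b]) (auto simp: eventually_sequentially)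
  have "lim (\<lambda>n. of_nat i + of_nat p * ?b n) = of_nat i + of_nat p * lim ?b"
    using lim_add[OF padic_Cauchy_const[of p "of_nat i"] padic_Cauchy_mult[OF prime padic_Cauchy_const[of p "of_nat p"] b]]
      lim_mult[OF padic_Cauchy_const[of p "of_nat p"] b] by (simp add: lim_of_nat)
  moreover have "(\<lambda>n. of_nat i + of_nat p * ?b n) = a" using p0 by (simp flip: mult.assoc)
  ultimately show ?thesis using that i w a by metis
qed

lemma of_nat_prime_nonzero: "of_nat p \<noteq> (0 :: 'a)"
proof -
  have "\<not> (\<lambda>n. padic_norm p (of_nat p)) \<longlonglongrightarrow> 0"
    using prime_gt_0_nat[OF prime] by (simp add: LIMSEQ_const_iff padic_norm_of_nat_prime[OF prime])
  then show ?thesis using null_cases[of "\<lambda>n. of_nat p"] by (auto simp: lim_of_nat)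
qed

lemma prime_nonunit_Z: "z \<in> Z \<Longrightarrow> of_nat p * z \<noteq> 1"
proof
  assume "z \<in> Z" and eq: "of_nat p * z = 1"
  then obtain a where a: "padic_Cauchy p a" "\<And>n. padic_norm p (a n) \<le> 1" "z = lim a" by (metis ZE)
  let ?c = "\<lambda>n. of_nat p * a n + - 1"
  have c: "padic_Cauchy p ?c" by (intro padic_Cauchy_add padic_Cauchy_mult prime a padic_Cauchy_const)
  have "lim ?c = of_nat p * z + - 1"
    using lim_add[OF padic_Cauchy_mult[OF prime padic_Cauchy_const[of p "of_nat p"] a(1)] padic_Cauchy_const[of p "-1"]]
      lim_mult[OF padic_Cauchy_const[of p "of_nat p"] a(1)] lim_uminus[of "\<lambda>n. 1"] a
    by (simp add: lim_of_nat lim_one)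
  then have "lim ?c = 0" using eq by simp
  then have *: "(\<lambda>n. padic_norm p (?c n)) \<longlonglongrightarrow> 0" using null_cases[OF c] by blast
  have p1: "real p > 1" using prime_gt_1_nat[OF prime] by simp
  \<comment> \<open>Write 1 = p a_n - (p a_n - 1). The first term has norm below 1, so by the
    ultrametric inequality the second has norm at least 1 and cannot tend to 0.\<close>
  have "1 \<le> padic_norm p (?c n)" for n
  proof -
    have "padic_norm p (of_nat p * a n) \<le> 1 / real p"
      using a(2)[of n] p1 by (simp add: padic_norm_mult[OF prime] padic_norm_of_nat_prime[OF prime] field_simps)
    moreover have "1 / real p < 1" using p1 by simp
    moreover have "1 \<le> max (padic_norm p (of_nat p * a n)) (padic_norm p (?c n))"
      using padic_norm_diff[OF prime, of "of_nat p * a n" "?c n"] by simp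
    ultimately show ?thesis by linarith
  qed
  then have "1 \<le> (0::real)" using * by (intro LIMSEQ_le_const[OF *]) auto
  then show False by simp
qed

section \<open>Integral elements of the extension field\<close>

definition S :: "'a set" where
  "S = {x. \<exists>P :: 'a poly. Polynomial.lead_coeff P = 1 \<and> range (Polynomial.coeff P) \<subseteq> Z \<and> Polynomial.poly P x = 0}"

lemma carrier_integer_ring: "carrier (integer_ring p \<iota>) = S"
  by (simp add: integer_ring_def S_def Z_def)

lemma Z_subset_S: "Z \<subseteq> S"
proof
  fix z assume z: "z \<in> Z"
  have "range (Polynomial.coeff [:-z, 1:]) \<subseteq> Z"
    using z by (auto simp: coeff_pCons Z_zero Z_one Z_uminus split: nat.splits)
  then show "z \<in> S" unfolding S_def by (intro CollectI exI[of _ "[:-z, 1:]"]) auto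
qed

text \<open>Multiplying the value at 1/p by p^degree turns every term but the leading one into a
  multiple of p. A monic equation for 1/p would therefore make p a unit among the p-adic
  integers.\<close>

lemma poly_at_prime_inverse:
  assumes y: "of_nat p * y = 1" and "range (Polynomial.coeff P) \<subseteq> Z"
  shows "\<exists>z\<in>Z. of_nat p ^ Polynomial.degree P * Polynomial.poly P y
           = Polynomial.lead_coeff P + of_nat p * z"
  using assms(2)
proof (induction P)
  case 0
  then show ?case by (auto intro: bexI[of _ 0] Z_zero)
next
  case (pCons c Q)
  have c: "c \<in> Z" and Q: "range (Polynomial.coeff Q) \<subseteq> Z"
  proof -
    have *: "Polynomial.coeff (pCons c Q) i \<in> Z" for i using pCons.prems by blast
    show "c \<in> Z" using *[of 0] by simp
    show "range (Polynomial.coeff Q) \<subseteq> Z" using *[of "Suc i" for i] by auto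
  qed
  show ?case
  proof (cases "Q = 0")
    case True
    then show ?thesis by (auto intro: bexI[of _ 0] Z_zero)
  next
    case False
    obtain z where z: "z \<in> Z" "of_nat p ^ Polynomial.degree Q * Polynomial.poly Q y
        = Polynomial.lead_coeff Q + of_nat p * z" using pCons.IH[OF Q] by blast
    let ?n = "Polynomial.degree Q"
    have "of_nat p ^ Suc ?n * (c + y * Polynomial.poly Q y)
      = of_nat p * (of_nat p ^ ?n * c) + (of_nat p * y) * (of_nat p ^ ?n * Polynomial.poly Q y)"
      by (simp add: algebra_simps)
    also have "\<dots> = Polynomial.lead_coeff Q + of_nat p * (of_nat p ^ ?n * c + z)"
      using y z by (simp add: algebra_simps)
    finally have "of_nat p ^ Polynomial.degree (pCons c Q) * Polynomial.poly (pCons c Q) y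
      = Polynomial.lead_coeff (pCons c Q) + of_nat p * (of_nat p ^ ?n * c + z)"
      using False by simp
    moreover have "of_nat p ^ ?n * c + z \<in> Z"
      using Z_of_nat[of "p ^ ?n"] c z by (auto intro: Z_add Z_mult)
    ultimately show ?thesis by blast
  qed
qed

lemma prime_nonunit_S: "y \<in> S \<Longrightarrow> of_nat p * y \<noteq> 1"
proof
  assume "y \<in> S" and y: "of_nat p * y = 1"
  then obtain P where P: "Polynomial.lead_coeff P = 1" "range (Polynomial.coeff P) \<subseteq> Z" "Polynomial.poly P y = 0"
    by (auto simp: S_def)
  obtain z where "z \<in> Z" "0 = 1 + of_nat p * z" using poly_at_prime_inverse[OF y P(2)] P by auto
  then have "- z \<in> Z" "of_nat p * (- z) = 1" by (auto simp: Z_uminus add_eq_0_iff)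
  then show False using prime_nonunit_Z by blast
qed

text \<open>A nonzero integral element divides the constant term of its equation, hence a power of \<^term>\<open>p\<close>.\<close>

lemma S_dvd_prime_power:
  assumes ring: "\<And>x y. x \<in> S \<Longrightarrow> y \<in> S \<Longrightarrow> x + y \<in> S" "\<And>x y. x \<in> S \<Longrightarrow> y \<in> S \<Longrightarrow> x * y \<in> S"
    and "x \<in> S" "x \<noteq> 0"
  shows "\<exists>y\<in>S. \<exists>k. x * y = of_nat p ^ k"
proof -
  have eval: "Polynomial.poly Q x \<in> S" if "range (Polynomial.coeff Q) \<subseteq> Z" for Q
    using that
  proof (induction Q)
    case 0
    then show ?case using Z_zero Z_subset_S by auto
  next
    case (pCons c Q)
    have *: "Polynomial.coeff (pCons c Q) i \<in> Z" for i using pCons.prems by blast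
    have "c \<in> S" "range (Polynomial.coeff Q) \<subseteq> Z" using *[of 0] *[of "Suc i" for i] Z_subset_S by auto
    then show ?case using pCons.IH ring assms(3) by auto
  qed
  obtain P where "Polynomial.lead_coeff P = 1" "range (Polynomial.coeff P) \<subseteq> Z" "Polynomial.poly P x = 0"
    using assms(3) by (auto simp: S_def)
  then show ?thesis
  proof (induction P)
    case (pCons c Q)
    have *: "Polynomial.coeff (pCons c Q) i \<in> Z" for i using pCons.prems by blast
    have c: "c \<in> Z" and Q: "range (Polynomial.coeff Q) \<subseteq> Z" using *[of 0] *[of "Suc i" for i] by auto
    have eq: "c = x * - Polynomial.poly Q x" using pCons.prems(3) by (simp add: eq_neg_iff_add_eq_0)
    show ?case
    proof (cases "c = 0")
      \<comment> \<open>A vanishing constant term is removed by cancelling the nonzero factor x; the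
        quotient polynomial is again monic.\<close>
      case True
      then have "Polynomial.poly Q x = 0" using eq assms(4) by simp
      moreover have "Q \<noteq> 0" using pCons.hyps True by auto
      then have "Polynomial.lead_coeff Q = 1" using pCons.prems(1) by simp
      ultimately show ?thesis using pCons.IH Q by blast
    next
      case False
      obtain w k where w: "w \<in> Z" "c * w = of_nat p ^ k" using Z_dvd_prime_power[OF c False] .
      have "- 1 \<in> S" using Z_uminus[OF Z_one] Z_subset_S by blast
      then have "- 1 * Polynomial.poly Q x * w \<in> S" 
        using eval[OF Q] w(1) Z_subset_S by (intro ring(2)) auto
      moreover have "x * (- 1 * Polynomial.poly Q x * w) = of_nat p ^ k" using w eq by (simp add: mult.assoc)
      ultimately show ?thesis by blast
    qed
  qed simp
qed

end

text \<open>Each step of the dimension adds a line K v, and K v + E is an image of K \<times>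
  E.\<close>

lemma (in ring) card_dimension_le:
  assumes "dimension n K E" "finite K"
  shows "finite E \<and> card E \<le> card K ^ n"
  using assms
proof (induction rule: dimension.induct)
  case (Suc_dim v E n K)
  have eq: "line_extension K v E = (\<lambda>(k, u). k \<otimes> v \<oplus> u) ` (K \<times> E)"
    by (auto simp: line_extension_mem_iff; blast)
  have "card (line_extension K v E) \<le> card (K \<times> E)"
    unfolding eq by (rule card_image_le) (use Suc_dim in auto)
  also have "\<dots> \<le> card K * card K ^ n" using Suc_dim by (simp add: card_cartesian_product)
  finally show ?case using Suc_dim eq by auto
qed simp

text \<open>By the ramification index p and \<pi>^e divide each other, which transfers nonunit and
  separation properties from p to \<pi>; the inertia degree bounds the number of residues.\<close>

theorem uniformized_integer_ring:
  fixes \<iota> :: "(nat \<Rightarrow> rat) set \<Rightarrow> 'a::field"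
  assumes p: "Factorial_Ring.prime p" and ext: "padic_extension p \<iota> d"
    and R: "R = integer_ring p \<iota>" and unif: "uniformizer R \<pi>"
    and ram: "has_ramification_index p R \<pi> e" and inert: "has_inertia_degree p \<iota> R \<pi> f"
  shows "uniformized_ring (carrier R) \<pi> p (p ^ f)" "e \<ge> 1" "d \<ge> 1"
proof -
  have \<iota>: "\<iota> \<in> Ring.ring_hom (padic_field p) ring_of_field"
    and dim: "ring.dimension ring_of_field d (\<iota> ` carrier (padic_field p)) (UNIV :: 'a set)"
    using ext by (auto simp: padic_extension_def)
  interpret padic_embedding p \<iota> using p \<iota> by unfold_locales
  have S: "carrier R = S" using carrier_integer_ring R by simp
  have ops: "a \<otimes>\<^bsub>R\<^esub> b = a * b" "a \<oplus>\<^bsub>R\<^esub> b = a + b" "\<one>\<^bsub>R\<^esub> = 1" "\<zero>\<^bsub>R\<^esub> = 0" for a b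
    by (simp_all add: R integer_ring_def ring_of_type_algebra_def)
  have \<pi>: "\<pi> \<in> S" and max: "maximalideal (PIdl\<^bsub>R\<^esub> \<pi>) R" using unif by (auto simp: uniformizer_def S)
  \<comment> \<open>This locale contains the ring axioms of R; closure of the integral elements
    under addition and multiplication is read off from it.\<close>
  interpret M: maximalideal "PIdl\<^bsub>R\<^esub> \<pi>" R by (rule max)
  have PI: "PIdl\<^bsub>R\<^esub> a = {x * a | x. x \<in> S}" for a by (simp add: cgenideal_def ops S)
  have zero: "0 \<in> S" and one: "1 \<in> S" using M.zero_closed M.one_closed by (auto simp: ops S)
  have add: "x + y \<in> S" and mult: "x * y \<in> S" if "x \<in> S" "y \<in> S" for x y
    using M.a_closed[of x y] M.m_closed[of x y] that by (auto simp: ops S)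
  have uminus: "- x \<in> S" if "x \<in> S" for x
    using M.a_inv_closed[of x] M.l_neg[of x] that by (auto simp: ops S add_eq_0_iff2)
  have "e \<noteq> 0"
  proof
    \<comment> \<open>Then p would generate the unit ideal, although 1/p is not integral.\<close>
    assume "e = 0"
    then have "1 \<in> PIdl\<^bsub>R\<^esub> (of_nat p)" using ram one by (auto simp: has_ramification_index_def PI)
    then show False using prime_nonunit_S by (auto simp: PI mult.commute)
  qed
  then show e: "e \<ge> 1" by simp
  have pow: "x ^ k \<in> S" if "x \<in> S" for x k by (induction k) (use one mult that in auto)
  have "a \<in> PIdl\<^bsub>R\<^esub> a" for a using one by (auto simp: PI intro: exI[of _ 1])
  then have "of_nat p \<in> PIdl\<^bsub>R\<^esub> (\<pi> ^ e)" "\<pi> ^ e \<in> PIdl\<^bsub>R\<^esub> (of_nat p)"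
    using ram unfolding has_ramification_index_def by metis+
  then obtain s r where s: "s \<in> S" "of_nat p = s * \<pi> ^ e" and r: "r \<in> S" "\<pi> ^ e = r * of_nat p"
    unfolding PI by blast
  have \<pi>0: "\<pi> \<noteq> 0" using s(2) of_nat_prime_nonzero e by auto
  have nonunit: "\<pi> * a \<noteq> 1" if "a \<in> S" for a
  proof
    assume eq: "\<pi> * a = 1"
    have "x \<in> PIdl\<^bsub>R\<^esub> \<pi>" if x: "x \<in> S" for x
    proof -
      have "x = (x * a) * \<pi>" using eq by (simp only: mult.assoc mult.commute[of a] mult_1_right)
      then show ?thesis unfolding PI using mult[OF x \<open>a \<in> S\<close>] by blast
    qed
    then show False using M.I_notcarr M.a_subset S by blast
  qed
  have sep: "x = 0" if x: "x \<in> S" and all: "\<And>k. \<exists>a\<in>S. x = \<pi> ^ k * a" for x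
  proof (rule ccontr)
    \<comment> \<open>x divides some p^k, and p divides \<pi>^e, so x divides \<pi>^(e k). If x were
      divisible by the next power of \<pi>, then \<pi> would be a unit.\<close>
    assume "x \<noteq> 0"
    then obtain y k where y: "y \<in> S" "x * y = of_nat p ^ k" using S_dvd_prime_power[OF add mult x] by blast
    obtain a where a: "a \<in> S" "x = \<pi> ^ Suc (e * k) * a" using all by blast
    have "\<pi> ^ (e * k) = r ^ k * (x * y)" unfolding y(2) power_mult r(2) by (simp add: power_mult_distrib)
    also have "\<dots> = \<pi> ^ (e * k) * (\<pi> * (a * (y * r ^ k)))" unfolding a(2) by simp
    finally have "\<pi> * (a * (y * r ^ k)) = 1" using \<pi>0 by simp
    moreover have "a * (y * r ^ k) \<in> S" by (intro mult pow a y r)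
    ultimately show False using nonunit by blast
  qed
  let ?Q = "R Quot PIdl\<^bsub>R\<^esub> \<pi>"
  let ?K = "(\<lambda>z. residue R \<pi> (\<iota> z)) ` padic_integers p"
  \<comment> \<open>Since p lies in the ideal of \<pi>, the digits below p exhaust the residues of
    p-adic integers. So the base field of \<open>dimension\<close> has at most p elements and the
    residue field of R at most p^f.\<close>
  have Kn: "?K \<subseteq> (\<lambda>i. residue R \<pi> (of_nat i)) ` {..<p}"
  proof
    fix c assume "c \<in> ?K"
    then obtain z where z: "z \<in> Z" "c = residue R \<pi> z" by (auto simp: Z_def)
    obtain i w where w: "i < p" "w \<in> Z" "z = of_nat i + of_nat p * w" using Z_digit[OF z(1)] .
    have "of_nat p * w = (s * \<pi> ^ (e - 1) * w) * \<pi>"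
      unfolding s(2) using e by (simp flip: power_Suc2)
    then have "of_nat p * w \<in> PIdl\<^bsub>R\<^esub> \<pi>"
      unfolding PI using mult[OF mult[OF s(1) pow[OF \<pi>]]] w(2) Z_subset_S by blast
    then have "z \<in> residue R \<pi> (of_nat i)"
      unfolding w(3) by (auto simp: a_r_coset_def' ops add.commute)
    moreover have "of_nat i \<in> carrier R" using Z_of_nat Z_subset_S S by auto
    ultimately have "residue R \<pi> z = residue R \<pi> (of_nat i)"
      by (rule M.a_repr_independence'[symmetric])
    then show "c \<in> (\<lambda>i. residue R \<pi> (of_nat i)) ` {..<p}" using z w by auto
  qed
  have ringQ: "ring ?Q" by (rule M.quotient_is_ring)
  have finK: "finite ?K" by (rule finite_subset[OF Kn]) simp
  have cardK: "card ?K \<le> p"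
    using card_mono[OF _ Kn] card_image_le[of "{..<p}" "\<lambda>i. residue R \<pi> (of_nat i)"]
    by auto
  have "ring.dimension ?Q f ?K (carrier ?Q)" using inert by (simp add: has_inertia_degree_def)
  then have "finite (carrier ?Q) \<and> card (carrier ?Q) \<le> card ?K ^ f"
    using ring.card_dimension_le[OF ringQ] finK by blast
  then have fin: "finite (carrier ?Q)" and card: "card (carrier ?Q) \<le> p ^ f"
    using power_mono[OF cardK, of f] by auto
  obtain h where h: "bij_betw h (carrier ?Q) {0..<card (carrier ?Q)}"
    using ex_bij_betw_finite_nat[OF fin] by blast
  have res: "residue R \<pi> a \<in> carrier ?Q" if "a \<in> S" for a
    using that S by (auto simp: FactRing_def A_RCOSETS_def')
  have digits: "\<exists>\<rho>. (\<forall>a\<in>S. \<rho> a < p ^ f) \<and>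
      (\<forall>a\<in>S. \<forall>b\<in>S. \<rho> a = (\<rho> b :: nat) \<longrightarrow> (\<exists>c\<in>S. a - b = \<pi> * c))"
  proof (intro exI[of _ "\<lambda>a. h (residue R \<pi> a)"] conjI ballI impI)
    fix a assume a: "a \<in> S"
    have "h (residue R \<pi> a) \<in> {0..<card (carrier ?Q)}" using bij_betwE[OF h] res[OF a] by blast
    then show "h (residue R \<pi> a) < p ^ f" using card by simp
    fix b assume b: "b \<in> S" and "h (residue R \<pi> a) = h (residue R \<pi> b)"
    then have "residue R \<pi> a = residue R \<pi> b"
      using h res[OF a] res[OF b] by (auto simp: bij_betw_def inj_on_def)
    then have "a \<in> residue R \<pi> b" using M.a_rcos_self a S by metis
    then obtain c where "c \<in> S" "a = c * \<pi> + b" by (auto simp: a_r_coset_def' ops PI)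
    then show "\<exists>c\<in>S. a - b = \<pi> * c" by (auto simp: mult.commute)
  qed
  have dp: "\<exists>a\<in>S. of_nat p = \<pi> * a"
  proof
    show "of_nat p = \<pi> * (s * \<pi> ^ (e - 1))" unfolding s(2) using e by (cases e) auto
  qed (use mult s pow \<pi> in auto)
  show "uniformized_ring (carrier R) \<pi> p (p ^ f)"
    unfolding S by (intro uniformized_ring.intro zero one add uminus mult \<pi> \<pi>0 nonunit p dp sep digits)
  show "d \<ge> 1"
  proof (rule ccontr)
    assume "\<not> d \<ge> 1"
    then have "d = 0" by simp
    then have "ring.dimension ring_of_field 0 (\<iota> ` carrier (padic_field p)) (UNIV :: 'a set)"
      using dim by simp
    then have "(UNIV :: 'a set) = {\<zero>\<^bsub>ring_of_field\<^esub>}"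
      by (rule ring.dimension.cases[OF ring_from_type_algebra]) auto
    then have eq: "(UNIV :: 'a set) = {0}" by (simp add: ring_of_type_algebra_def)
    have "(1::'a) \<in> {0}" unfolding eq[symmetric] by simp
    then show False by simp
  qed
qed

section \<open>The filtration of the ring by powers of the uniformizer\<close>

context uniformized_ring
begin

definition level :: "nat \<Rightarrow> 'a set" where "level k = (\<lambda>a. \<pi> ^ k * a) ` S"

lemma sum_closed [intro]: "(\<And>i. i \<in> A \<Longrightarrow> f i \<in> S) \<Longrightarrow> sum f A \<in> S"
  by (induction A rule: infinite_finite_induct) auto

lemma prod_closed [intro]: "(\<And>i. i \<in> A \<Longrightarrow> f i \<in> S) \<Longrightarrow> prod f A \<in> S"
  by (induction A rule: infinite_finite_induct) auto

lemma power_closed [simp, intro]: "x \<in> S \<Longrightarrow> x ^ k \<in> S"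
  by (induction k) auto

lemma diff_closed [simp, intro]: "x \<in> S \<Longrightarrow> y \<in> S \<Longrightarrow> x - y \<in> S"
  using add_closed[of x "- y"] by simp

lemma of_nat_closed [simp, intro]: "of_nat k \<in> S"
  by (induction k) auto

lemma of_int_closed [simp, intro]: "of_int k \<in> S"
  by (cases k) (auto simp del: of_nat_Suc)

lemma numeral_closed [simp, intro]: "numeral k \<in> S"
  using of_nat_closed[of "numeral k"] by simp

lemma level_0 [simp]: "level 0 = S"
  by (simp add: level_def)

lemma level_subset: "level k \<subseteq> S"
  by (auto simp: level_def)

lemma level_zero [simp, intro]: "0 \<in> level k"
  unfolding level_def by (rule image_eqI[of _ _ 0]) auto

lemma power_level [simp, intro]: "\<pi> ^ k \<in> level k"
  unfolding level_def by (rule image_eqI[of _ _ 1]) auto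

lemma level_add [intro]: "x \<in> level k \<Longrightarrow> y \<in> level k \<Longrightarrow> x + y \<in> level k"
  by (auto simp: level_def simp flip: distrib_left)

lemma level_uminus [intro]: "x \<in> level k \<Longrightarrow> - x \<in> level k"
  by (auto simp: level_def simp flip: mult_minus_right)

lemma level_diff [intro]: "x \<in> level k \<Longrightarrow> y \<in> level k \<Longrightarrow> x - y \<in> level k"
  using level_add[of x k "- y"] by auto

lemma level_sum [intro]: "(\<And>i. i \<in> A \<Longrightarrow> f i \<in> level k) \<Longrightarrow> sum f A \<in> level k"
  by (induction A rule: infinite_finite_induct) auto

lemma level_mult: "x \<in> level j \<Longrightarrow> y \<in> level k \<Longrightarrow> x * y \<in> level (j + k)"
  by (auto simp: level_def power_add intro!: image_eqI[of _ _ "_ * _"])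

lemma level_mult_left [intro]: "a \<in> S \<Longrightarrow> x \<in> level k \<Longrightarrow> a * x \<in> level k"
  using level_mult[of a 0 x k] by simp

lemma level_mult_right [intro]: "a \<in> S \<Longrightarrow> x \<in> level k \<Longrightarrow> x * a \<in> level k"
  using level_mult[of x k a 0] by simp

lemma level_antimono: "x \<in> level k \<Longrightarrow> j \<le> k \<Longrightarrow> x \<in> level j"
proof -
  assume "x \<in> level k" "j \<le> k"
  then obtain a where "a \<in> S" "x = \<pi> ^ j * (\<pi> ^ (k - j) * a)"
    by (auto simp: level_def simp flip: mult.assoc power_add)
  then show ?thesis unfolding level_def by blast
qed

lemma level_divide: "x \<in> level (k + j) \<Longrightarrow> x / \<pi> ^ j \<in> level k"
  by (auto simp: level_def power_add)

lemma level_separated: "(\<And>k. x \<in> level k) \<Longrightarrow> x = 0"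
  using separated[of x] level_subset unfolding level_def by blast

lemma one_not_level: "1 \<notin> level 1"
  using uniformizer_nonunit by (auto simp: level_def)

text \<open>Elements congruent to 1 modulo the uniformizer need not be shown to be units: the geometric
  series inverts them modulo each power of the uniformizer.\<close>

definition near_inverse :: "nat \<Rightarrow> 'a \<Rightarrow> 'a" where
  "near_inverse N u = (\<Sum>j<N. (1 - u) ^ j)"

lemma near_inverse:
  assumes "u \<in> S" "u - 1 \<in> level 1"
  shows "near_inverse N u \<in> S" "near_inverse N u * u - 1 \<in> level N"
proof -
  have "1 - u \<in> level 1" using level_uminus[OF assms(2)] by simp
  then have "(1 - u) ^ N \<in> level N"
  proof (induction N)
    case (Suc N)
    then show ?case using level_mult[of "1 - u" 1 "(1 - u) ^ N" N] by simp
  qed simp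
  moreover have "near_inverse N u * u = 1 - (1 - u) ^ N"
    using one_diff_power_eq[of "1 - u" N] by (simp add: near_inverse_def mult.commute)
  ultimately show "near_inverse N u * u - 1 \<in> level N" by auto
  show "near_inverse N u \<in> S" using assms(1) by (auto simp: near_inverse_def)
qed

text \<open>An inverse v of u modulo \<pi>^k is enough: in a = v (u a) - (v u - 1) a both terms lie
  in \<open>level k\<close>.\<close>

lemma level_cancel:
  assumes u: "u \<in> S" "u - 1 \<in> level 1" and a: "a \<in> S" and "u * a \<in> level k"
  shows "a \<in> level k"
proof -
  let ?v = "near_inverse k u"
  have "a = ?v * (u * a) - (?v * u - 1) * a" by (simp add: algebra_simps)
  then show ?thesis using near_inverse[OF u, of k] assms by (metis level_diff level_mult_left level_mult_right)
qed

text \<open>In the Bezout relation u k + v p = 1 the second term is divisible by \<pi>.\<close>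

lemma of_nat_near_inverse:
  assumes "coprime k p"
  obtains w where "w \<in> S" "w * of_nat k - 1 \<in> level 1"
proof -
  obtain u v where uv: "u * int k + v * int p = 1"
    using bezout_int[of "int k" "int p"] assms by (metis coprime_imp_gcd_eq_1 coprime_int_iff)
  obtain s where s: "s \<in> S" "of_nat p = \<pi> * s" using dvd_prime by blast
  have "of_int (u * int k + v * int p) = (1 :: 'a)" unfolding uv by simp
  then have "of_int u * of_nat k - 1 = \<pi> * (s * - of_int v)"
    using s by (simp add: algebra_simps eq_diff_eq diff_eq_eq)
  moreover have "\<pi> * (s * - of_int v) \<in> level 1"
    unfolding level_def power_one_right using s by (intro imageI) auto
  ultimately show ?thesis using that[of "of_int u"] by auto
qed

lemma of_nat_not_level: "coprime k p \<Longrightarrow> of_nat k \<notin> level 1"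
proof
  assume "coprime k p" and k: "of_nat k \<in> level 1"
  then obtain w where w: "w \<in> S" "w * of_nat k - 1 \<in> level 1" using of_nat_near_inverse by blast
  have "1 = w * of_nat k - (w * of_nat k - 1)" by simp
  then have "1 \<in> level 1" using w level_mult_left[OF w(1) k] by (metis level_diff)
  then show False using one_not_level by simp
qed

lemma of_nat_nonzero: "coprime k p \<Longrightarrow> of_nat k \<noteq> (0 :: 'a)"
  using of_nat_not_level level_zero by metis

lemma of_nat_cancel:
  assumes "coprime k p" "a \<in> S" "of_nat k * a \<in> level j"
  shows "a \<in> level j"
proof -
  obtain w where w: "w \<in> S" "w * of_nat k - 1 \<in> level 1" using of_nat_near_inverse assms by blast
  show ?thesis
    using level_cancel[OF _ w(2) assms(2)] w(1) assms(3) by (auto simp: mult.assoc)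
qed

text \<open>If x differs from 1, the sum of x^i over i < k vanishes. But it is congruent to k modulo
  \<pi>, and k is prime to p.\<close>

lemma root_of_unity:
  assumes "coprime k p" "x \<in> S" "x - 1 \<in> level 1" "x ^ k = 1"
  shows "x = 1"
proof (rule ccontr)
  assume "x \<noteq> 1"
  then have "(\<Sum>i<k. x ^ i) = 0" using power_diff_1_eq[of x k] assms(4) by simp
  moreover have "(\<Sum>i<k. x ^ i) - of_nat k \<in> level 1"
  proof -
    have "x ^ i - 1 \<in> level 1" for i
    proof -
      have "x ^ i - 1 = (x - 1) * (\<Sum>j<i. x ^ j)" by (rule power_diff_1_eq)
      then show ?thesis using assms(2,3) by auto
    qed
    then have "(\<Sum>i<k. x ^ i - 1) \<in> level 1" by auto
    then show ?thesis by (simp add: sum_subtractf)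
  qed
  ultimately have "- of_nat k \<in> level 1" by simp
  then have "of_nat k \<in> level 1" using level_uminus by fastforce
  then show False using of_nat_not_level assms(1) by blast
qed

text \<open>Expansion to the base \<pi>: the code of a is its lowest digit plus q times the code of
  the remaining quotient.\<close>

lemma residues_level:
  "\<exists>\<rho>. (\<forall>a\<in>S. \<rho> a < q ^ k) \<and> (\<forall>a\<in>S. \<forall>b\<in>S. \<rho> a = (\<rho> b :: nat) \<longrightarrow> a - b \<in> level k)"
proof (induction k)
  case 0
  show ?case by (rule exI[of _ "\<lambda>_. 0"]) auto
next
  case (Suc k)
  obtain \<rho> where \<rho>: "\<And>a. a \<in> S \<Longrightarrow> \<rho> a < q ^ k"
    "\<And>a b. a \<in> S \<Longrightarrow> b \<in> S \<Longrightarrow> \<rho> a = (\<rho> b :: nat) \<Longrightarrow> a - b \<in> level k" using Suc by blast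
  obtain \<sigma> where \<sigma>: "\<And>a. a \<in> S \<Longrightarrow> \<sigma> a < q"
    "\<And>a b. a \<in> S \<Longrightarrow> b \<in> S \<Longrightarrow> \<sigma> a = (\<sigma> b :: nat) \<Longrightarrow> \<exists>c\<in>S. a - b = \<pi> * c" using residues by blast
  \<comment> \<open>The representative depends on the digit alone, so elements with equal digits
    lose the same summand and differ by \<pi> times the difference of their quotients.\<close>
  define rep where "rep i = (SOME a. a \<in> S \<and> \<sigma> a = i)" for i
  have rep: "rep (\<sigma> a) \<in> S" "\<sigma> (rep (\<sigma> a)) = \<sigma> a" if "a \<in> S" for a
    using someI[of "\<lambda>b. b \<in> S \<and> \<sigma> b = \<sigma> a" a] that by (auto simp: rep_def)
  define quo where "quo a = (a - rep (\<sigma> a)) / \<pi>" for a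
  have quo: "quo a \<in> S" "a = rep (\<sigma> a) + \<pi> * quo a" if "a \<in> S" for a
    using \<sigma>(2)[OF that rep(1)[OF that]] rep(2)[OF that] by (auto simp: quo_def)
  show ?case
  proof (intro exI[of _ "\<lambda>a. \<sigma> a + q * \<rho> (quo a)"] conjI ballI impI)
    fix a assume a: "a \<in> S"
    have "\<sigma> a + q * \<rho> (quo a) < q * Suc (\<rho> (quo a))" using \<sigma>(1)[OF a] by simp
    also have "\<dots> \<le> q * q ^ k" using \<rho>(1)[OF quo(1)[OF a]] by (intro mult_le_mono) auto
    finally show "\<sigma> a + q * \<rho> (quo a) < q ^ Suc k" by simp
    fix b assume b: "b \<in> S" and eq: "\<sigma> a + q * \<rho> (quo a) = \<sigma> b + q * \<rho> (quo b)"
    have q: "q \<noteq> 0" using \<sigma>(1)[OF a] by simp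
    have "\<sigma> a = (\<sigma> a + q * \<rho> (quo a)) mod q" "\<sigma> b = (\<sigma> b + q * \<rho> (quo b)) mod q"
      using \<sigma>(1) a b by auto
    then have s: "\<sigma> a = \<sigma> b" using eq by simp
    then have "\<rho> (quo a) = \<rho> (quo b)" using eq q by simp
    then have "quo a - quo b \<in> level k" using \<rho>(2) quo(1) a b by blast
    then obtain c where c: "c \<in> S" "quo a - quo b = \<pi> ^ k * c" by (auto simp: level_def)
    have "a - b = \<pi> * (quo a - quo b)"
      using quo(2)[OF a] quo(2)[OF b] s by (metis add_diff_cancel_left right_diff_distrib)
    then have "a - b = \<pi> ^ Suc k * c" using c by simp
    then show "a - b \<in> level (Suc k)" unfolding level_def using c(1) by blast
  qed
qed

definition residue_code :: "nat \<Rightarrow> 'a \<Rightarrow> nat" where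
  "residue_code k = (SOME \<rho>. (\<forall>a\<in>S. \<rho> a < q ^ k) \<and> (\<forall>a\<in>S. \<forall>b\<in>S. \<rho> a = \<rho> b \<longrightarrow> a - b \<in> level k))"

lemma residue_code: "a \<in> S \<Longrightarrow> residue_code k a < q ^ k"
  "a \<in> S \<Longrightarrow> b \<in> S \<Longrightarrow> residue_code k a = residue_code k b \<Longrightarrow> a - b \<in> level k"
  using someI_ex[OF residues_level[of k]] unfolding residue_code_def by blast+

text \<open>0 and 1 have different codes, which excludes q = 1 and hence f = 0. The numerical
  estimates use the consequence q >= 2.\<close>

lemma residue_count_ge: "p \<le> q" if "q = p ^ f" for f
proof -
  have "residue_code 1 0 \<noteq> residue_code 1 1"
  proof
    assume "residue_code 1 0 = residue_code 1 1"
    then have "1 - 0 \<in> level 1" using residue_code(2)[of 1 0 1] by simp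
    then show False using one_not_level by simp
  qed
  then have "q \<noteq> 1" using residue_code(1)[of 0 1] residue_code(1)[of 1 1] by auto
  then have "f \<noteq> 0" using that by auto
  then show ?thesis using that prime_gt_0_nat[OF prime] by (cases f) auto
qed

end

section \<open>Congruence subgroups of matrix groups\<close>

lemma mat_mult_entry:
  assumes "x \<in> carrier_mat n n" "y \<in> carrier_mat n n" "i < n" "j < n"
  shows "(x * y) $$ (i, j) = (\<Sum>k<n. x $$ (i, k) * y $$ (k, j))"
  using assms by (auto simp: scalar_prod_def lessThan_atLeast0 intro!: sum.cong)

text \<open>\<^term>\<open>A\<close> is the group of points over the field and \<^term>\<open>H m\<close> is its \<^term>\<open>m\<close>-th congruence subgroup;
  \<^term>\<open>H 0\<close> is the group of integral points. The virtual endomorphism is conjugation by the diagonal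
  matrix with entries \<^term>\<open>1 / \<pi> ^ k i\<close>, where the weight \<^term>\<open>k\<close> vanishes exactly at \<^term>\<open>c\<close>.\<close>

locale weighted_group = uniformized_ring S \<pi> p q
  for S :: "'a::field set" and \<pi> p q +
  fixes n c :: nat and k :: "nat \<Rightarrow> nat" and A :: "'a mat set"
  assumes c_less: "c < n" and k_c: "k c = 0" and k_pos: "i < n \<Longrightarrow> i \<noteq> c \<Longrightarrow> 1 \<le> k i"
    and A_carrier: "x \<in> A \<Longrightarrow> x \<in> carrier_mat n n" and A_one: "1\<^sub>m n \<in> A"
    and A_mult: "x \<in> A \<Longrightarrow> y \<in> A \<Longrightarrow> x * y \<in> A"
    and A_inverse: "x \<in> A \<Longrightarrow> (\<And>i j. i < n \<Longrightarrow> j < n \<Longrightarrow> x $$ (i, j) \<in> S) \<Longrightarrow>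
      \<exists>y\<in>A. y * x = 1\<^sub>m n \<and> (\<forall>i<n. \<forall>j<n. y $$ (i, j) \<in> S)"
    and A_conj: "x \<in> A \<Longrightarrow> mat n n (\<lambda>(i, j). \<pi> ^ k j * x $$ (i, j) / \<pi> ^ k i) \<in> A"
begin

definition delta :: "nat \<Rightarrow> nat \<Rightarrow> 'a" where "delta i j = (if i = j then 1 else 0)"

definition H :: "nat \<Rightarrow> 'a mat set" where
  "H m = {x \<in> A. \<forall>i<n. \<forall>j<n. x $$ (i, j) \<in> S \<and> x $$ (i, j) - delta i j \<in> level m}"

abbreviation "G m \<equiv> mat_group n (H m)"

definition cj :: "'a mat \<Rightarrow> 'a mat" where
  "cj x = mat n n (\<lambda>(i, j). \<pi> ^ k j * x $$ (i, j) / \<pi> ^ k i)"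

text \<open>Conjugation by a diagonal matrix fixes scalar matrices, so these could form an invariant
  normal subgroup. The condition on the diagonal entry makes all eigenvalues that occur congruent to
  1, which leaves the trivial scalar.\<close>

definition dom :: "nat \<Rightarrow> 'a mat set" where
  "dom m = {x \<in> H m. cj x \<in> H m \<and> x $$ (c, c) - 1 \<in> level 1}"

lemma delta_closed [simp, intro]: "delta i j \<in> S"
  by (simp add: delta_def)

lemma H_entry:
  assumes "x \<in> H m" "i < n" "j < n"
  shows "x $$ (i, j) \<in> S" "x $$ (i, j) - delta i j \<in> level m"
  using assms by (auto simp: H_def)

lemma H_offdiag: "x \<in> H m \<Longrightarrow> i < n \<Longrightarrow> j < n \<Longrightarrow> i \<noteq> j \<Longrightarrow> x $$ (i, j) \<in> level m"
  using H_entry(2)[of x m i j] by (simp add: delta_def)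

lemma H_carrier [simp, intro]: "x \<in> H m \<Longrightarrow> x \<in> carrier_mat n n"
  using A_carrier by (auto simp: H_def)

lemma sum_delta [simp]:
  "i < n \<Longrightarrow> (\<Sum>j<n. delta i j * f j) = f i" "i < n \<Longrightarrow> (\<Sum>j<n. f j * delta j i) = f i"
  "i < n \<Longrightarrow> (\<Sum>j<n. f j * delta i j) = f i" "i < n \<Longrightarrow> (\<Sum>j<n. delta j i * f j) = f i"
  by (simp_all add: delta_def if_distrib[of "\<lambda>x. x * _"] if_distrib[of "\<lambda>x. _ * x"] cong: if_cong)

lemma one_entry: "i < n \<Longrightarrow> j < n \<Longrightarrow> (1\<^sub>m n) $$ (i, j) = delta i j"
  by (simp add: delta_def)

lemma H_one: "1\<^sub>m n \<in> H m"
  by (auto simp: H_def A_one one_entry simp del: index_one_mat)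

lemma H_mult:
  assumes x: "x \<in> H m" and y: "y \<in> H m"
  shows "x * y \<in> H m"
proof -
  have "(x * y) $$ (i, j) \<in> S \<and> (x * y) $$ (i, j) - delta i j \<in> level m" if ij: "i < n" "j < n" for i j
  proof
    have e: "(x * y) $$ (i, j) = (\<Sum>k<n. x $$ (i, k) * y $$ (k, j))"
      using x y ij by (intro mat_mult_entry) auto
    show "(x * y) $$ (i, j) \<in> S"
      unfolding e using x y ij by (intro sum_closed mult_closed) (auto intro: H_entry)
    have "(x * y) $$ (i, j) - delta i j
        = (\<Sum>k<n. (x $$ (i, k) - delta i k) * y $$ (k, j)) + (y $$ (i, j) - delta i j)"
      using ij by (simp add: e left_diff_distrib sum_subtractf)
    also have "\<dots> \<in> level m"
      using x y ij by (intro level_add level_sum level_mult_right) (auto intro: H_entry)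
    finally show "(x * y) $$ (i, j) - delta i j \<in> level m" .
  qed
  then show ?thesis using x y by (auto simp: H_def A_mult)
qed

lemma H_inverse:
  assumes x: "x \<in> H m"
  obtains y where "y \<in> H m" "y * x = 1\<^sub>m n" "x * y = 1\<^sub>m n"
proof -
  obtain y where y: "y \<in> A" "y * x = 1\<^sub>m n" "\<And>i j. i < n \<Longrightarrow> j < n \<Longrightarrow> y $$ (i, j) \<in> S"
    using A_inverse[of x] x by (auto simp: H_def)
  have "y $$ (i, j) - delta i j \<in> level m" if ij: "i < n" "j < n" for i j
  proof -
    have "(\<Sum>k<n. y $$ (i, k) * x $$ (k, j)) = delta i j"
      using mat_mult_entry[of y n x i j] y A_carrier x ij by (auto simp: one_entry simp del: index_one_mat)
    \<comment> \<open>From y x = 1 follows y - 1 = - y (x - 1), so y inherits the congruence from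
      x.\<close>
    then have "y $$ (i, j) - delta i j = - (\<Sum>k<n. y $$ (i, k) * (x $$ (k, j) - delta k j))"
      using ij by (simp add: right_diff_distrib sum_subtractf)
    also have "\<dots> \<in> level m"
      using x y ij by (intro level_uminus level_sum level_mult_left) (auto intro: H_entry)
    finally show ?thesis .
  qed
  then have "y \<in> H m" using y by (auto simp: H_def)
  moreover have "x * y = 1\<^sub>m n" using mat_mult_left_right_inverse[of y n x] y A_carrier x by auto
  ultimately show ?thesis using that y by blast
qed

lemma group_H: "group (G m)"
proof (rule groupI)
  fix x assume "x \<in> carrier (G m)"
  then show "\<exists>y\<in>carrier (G m). y \<otimes>\<^bsub>G m\<^esub> x = \<one>\<^bsub>G m\<^esub>"
    using H_inverse[of x m] by (auto simp: mat_group_def)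
qed (auto simp: mat_group_def H_one H_mult intro: assoc_mult_mat left_mult_one_mat)

lemma H_inv:
  assumes x: "x \<in> H m"
  shows "inv\<^bsub>G m\<^esub> x \<in> H m" "inv\<^bsub>G m\<^esub> x * x = 1\<^sub>m n" "x * inv\<^bsub>G m\<^esub> x = 1\<^sub>m n"
  using group.inv_closed[OF group_H, of x m] group.l_inv[OF group_H, of x m]
    group.r_inv[OF group_H, of x m] x by (auto simp: mat_group_def)

lemma cj_carrier [simp]: "cj x \<in> carrier_mat n n"
  by (simp add: cj_def)

lemma cj_entry: "i < n \<Longrightarrow> j < n \<Longrightarrow> cj x $$ (i, j) = \<pi> ^ k j * x $$ (i, j) / \<pi> ^ k i"
  by (simp add: cj_def)

lemma cj_mult:
  assumes x: "x \<in> carrier_mat n n" and y: "y \<in> carrier_mat n n"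
  shows "cj (x * y) = cj x * cj y"
proof (rule eq_matI)
  fix i j assume "i < dim_row (cj x * cj y)" "j < dim_col (cj x * cj y)"
  then have ij: "i < n" "j < n" by (auto simp: cj_def)
  have "cj (x * y) $$ (i, j) = (\<Sum>l<n. \<pi> ^ k j * (x $$ (i, l) * y $$ (l, j)) / \<pi> ^ k i)"
    using ij x y by (simp only: cj_entry mat_mult_entry sum_distrib_left sum_divide_distrib)
  also have "\<dots> = (cj x * cj y) $$ (i, j)"
    unfolding mat_mult_entry[OF cj_carrier cj_carrier ij]
    using ij by (intro sum.cong) (auto simp: cj_entry)
  finally show "cj (x * y) $$ (i, j) = (cj x * cj y) $$ (i, j)" .
qed (use x y in \<open>auto simp: cj_def\<close>)

lemma cj_one: "cj (1\<^sub>m n) = 1\<^sub>m n"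
  by (rule eq_matI) (auto simp: cj_def)

lemma cj_diag: "i < n \<Longrightarrow> cj x $$ (i, i) = x $$ (i, i)"
  by (simp add: cj_entry)

text \<open>As the weight vanishes at c, conjugation divides this entry by \<pi>^(k i), and the
  quotient is integral.\<close>

lemma dom_first_column:
  assumes x: "x \<in> dom m" and i: "i < n" "i \<noteq> c"
  shows "x $$ (i, c) \<in> level 1"
proof -
  have "cj x $$ (i, c) \<in> S" using x i c_less by (auto simp: dom_def intro: H_entry)
  then have "\<pi> ^ k i * (x $$ (i, c) / \<pi> ^ k i) \<in> level (k i)"
    unfolding level_def using i c_less by (intro imageI) (simp add: cj_entry k_c)
  then have "x $$ (i, c) \<in> level (k i)" by simp
  then show ?thesis using k_pos[OF i] by (rule level_antimono)
qed

text \<open>Modulo \<pi> the distinguished column of a domain element is the basis vector. The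
  condition on the diagonal entry thus belongs to the stabilizer of a vector and passes to products
  and inverses.\<close>

lemma subgroup_dom: "subgroup (dom m) (G m)"
proof
  show "dom m \<subseteq> carrier (G m)" by (auto simp: mat_group_def dom_def)
  show "\<one>\<^bsub>G m\<^esub> \<in> dom m" using c_less by (simp add: mat_group_def dom_def cj_one H_one)
next
  fix x y assume x: "x \<in> dom m" and y: "y \<in> dom m"
  then have H: "x \<in> H m" "y \<in> H m" "cj x \<in> H m" "cj y \<in> H m" by (auto simp: dom_def)
  have "(x * y) $$ (c, c) = x $$ (c, c) * y $$ (c, c) + (\<Sum>l\<in>{..<n} - {c}. x $$ (c, l) * y $$ (l, c))"
    using mat_mult_entry[OF H_carrier[OF H(1)] H_carrier[OF H(2)] c_less c_less] c_less
    by (simp add: sum.remove[of "{..<n}" c])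
  then have "(x * y) $$ (c, c) - 1 = (x $$ (c, c) - 1) * y $$ (c, c) + (y $$ (c, c) - 1)
      + (\<Sum>l\<in>{..<n} - {c}. x $$ (c, l) * y $$ (l, c))" by (simp add: algebra_simps)
  also have "\<dots> \<in> level 1"
  proof (intro level_add level_sum)
    show "(x $$ (c, c) - 1) * y $$ (c, c) \<in> level 1"
      using x H c_less by (intro level_mult_right) (auto simp: dom_def intro: H_entry)
    show "y $$ (c, c) - 1 \<in> level 1" using y by (simp add: dom_def)
    fix l assume "l \<in> {..<n} - {c}"
    then show "x $$ (c, l) * y $$ (l, c) \<in> level 1"
      using H c_less dom_first_column[OF y] by (intro level_mult_left) (auto intro: H_entry)
  qed
  finally show "x \<otimes>\<^bsub>G m\<^esub> y \<in> dom m"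
    using H H_mult by (simp add: mat_group_def dom_def cj_mult)
next
  fix x assume x: "x \<in> dom m"
  then have H: "x \<in> H m" "cj x \<in> H m" by (auto simp: dom_def)
  let ?y = "inv\<^bsub>G m\<^esub> x"
  note y = H_inv[OF H(1)]
  \<comment> \<open>The conjugate of the inverse is a left inverse of \<open>cj x\<close>, so it
    equals z, which is known to lie in H m.\<close>
  obtain z where z: "z \<in> H m" "cj x * z = 1\<^sub>m n" using H_inverse[OF H(2)] by blast
  have "cj ?y * cj x = 1\<^sub>m n" using cj_mult[of ?y x] y H by (auto simp: cj_one)
  then have "cj ?y * (cj x * z) = z"
    using z H left_mult_one_mat[of z n n] by (subst assoc_mult_mat[of _ n n _ n _ n, symmetric]) auto
  then have cy: "cj ?y \<in> H m" using z right_mult_one_mat[OF cj_carrier[of ?y]] by simp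
  have "(\<Sum>l<n. ?y $$ (c, l) * x $$ (l, c)) = 1"
    using mat_mult_entry[of ?y n x c c] y H c_less by auto
  then have "?y $$ (c, c) * x $$ (c, c) + (\<Sum>l\<in>{..<n} - {c}. ?y $$ (c, l) * x $$ (l, c)) = 1"
    using c_less by (simp add: sum.remove[of "{..<n}" c])
  then have "?y $$ (c, c) - 1
      = - (?y $$ (c, c) * (x $$ (c, c) - 1)) - (\<Sum>l\<in>{..<n} - {c}. ?y $$ (c, l) * x $$ (l, c))"
    by (simp add: algebra_simps)
  also have "\<dots> \<in> level 1"
  proof (intro level_diff[OF level_uminus level_sum])
    show "?y $$ (c, c) * (x $$ (c, c) - 1) \<in> level 1"
      using x y c_less by (intro level_mult_left) (auto simp: dom_def intro: H_entry)
    fix l assume "l \<in> {..<n} - {c}"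
    then show "?y $$ (c, l) * x $$ (l, c) \<in> level 1"
      using y c_less dom_first_column[OF x] by (intro level_mult_left) (auto intro: H_entry)
  qed
  finally show "?y \<in> dom m" using y cy by (simp add: dom_def)
qed

text \<open>Iterating the endomorphism divides the entries below the distinguished one by arbitrarily high
  powers of the uniformizer.\<close>

lemma invariant_first_column:
  assumes N: "N \<subseteq> dom m" "cj ` N \<subseteq> N" and x: "x \<in> N" and i: "i < n" "i \<noteq> c"
  shows "x $$ (i, c) = 0"
proof -
  have iter: "(cj ^^ r) x \<in> N \<and> (cj ^^ r) x $$ (i, c) = x $$ (i, c) / \<pi> ^ (r * k i)" for r
    using N(2) x i c_less by (induction r) (auto simp: cj_entry k_c power_add mult.commute)
  have "x $$ (i, c) \<in> level r" for r
  proof -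
    have "(cj ^^ r) x \<in> H m" using iter N(1) by (auto simp: dom_def)
    then have "x $$ (i, c) / \<pi> ^ (r * k i) \<in> S" using iter[of r] i c_less H_entry(1) by metis
    then have "\<pi> ^ (r * k i) * (x $$ (i, c) / \<pi> ^ (r * k i)) \<in> level (r * k i)"
      unfolding level_def by (rule imageI)
    then have "x $$ (i, c) \<in> level (r * k i)" by simp
    moreover have "r \<le> r * k i" using k_pos[OF i] by simp
    ultimately show ?thesis by (rule level_antimono)
  qed
  then show ?thesis by (rule level_separated)
qed

text \<open>y^-1 x y lies in N again, so by \<open>invariant_first_column\<close> it multiplies the
  basis vector e_c by its diagonal entry. Applying y shows that x multiplies y e_c by the same
  scalar.\<close>

lemma invariant_eigenvector:
  assumes N: "N \<lhd> G m" "N \<subseteq> dom m" "cj ` N \<subseteq> N" and x: "x \<in> N" and y: "y \<in> H m"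
  shows "\<exists>\<mu>. \<mu> \<in> S \<and> \<mu> - 1 \<in> level 1 \<and> (\<forall>i<n. (x * y) $$ (i, c) = \<mu> * y $$ (i, c))"
proof -
  interpret normal N "G m" by fact
  let ?y = "inv\<^bsub>G m\<^esub> y" let ?z = "?y * x * y"
  note y' = H_inv[OF y]
  have xH: "x \<in> H m" using x N(2) by (auto simp: dom_def)
  have z: "?z \<in> N" using inv_op_closed1[of y x] x y by (simp add: mat_group_def)
  then have zd: "?z \<in> dom m" and zH: "?z \<in> H m" using N(2) by (auto simp: dom_def)
  have z0: "?z $$ (i, c) = 0" if "i < n" "i \<noteq> c" for i
    using invariant_first_column[OF N(2,3) z that] .
  have car: "x \<in> carrier_mat n n" "y \<in> carrier_mat n n" "?y \<in> carrier_mat n n"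
    using xH y y'(1) by auto
  have "y * ?z = y * (?y * (x * y))" using car by (simp add: assoc_mult_mat[of _ n n _ n _ n])
  also have "\<dots> = y * ?y * (x * y)" using car by (intro assoc_mult_mat[symmetric]) auto
  also have "\<dots> = x * y" using car y'(3) left_mult_one_mat[of "x * y" n n] by simp
  finally have eq: "x * y = y * ?z" by simp
  have "(x * y) $$ (i, c) = ?z $$ (c, c) * y $$ (i, c)" if i: "i < n" for i
  proof -
    have "(x * y) $$ (i, c) = (\<Sum>l<n. y $$ (i, l) * ?z $$ (l, c))"
      unfolding eq using y zH i c_less by (intro mat_mult_entry) auto
    also have "\<dots> = y $$ (i, c) * ?z $$ (c, c)"
      using c_less z0 by (subst sum.remove[of _ c]) (auto intro!: sum.neutral)
    finally show ?thesis by (simp add: mult.commute)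
  qed
  then show ?thesis using zd H_entry(1)[OF zH c_less c_less] by (auto simp: dom_def)
qed

text \<open>Splits the work for each group into rigidity, which gives simplicity, and a separating
  map \<kappa>, which bounds the index. The inverse of x enters as a matrix z, so that both tasks
  concern matrices alone.\<close>

lemma self_similar_dom:
  assumes rigid: "\<And>x. x \<in> H m \<Longrightarrow>
      (\<And>y. y \<in> H m \<Longrightarrow> \<exists>\<mu>. \<mu> \<in> S \<and> \<mu> - 1 \<in> level 1 \<and> (\<forall>i<n. (x * y) $$ (i, c) = \<mu> * y $$ (i, c))) \<Longrightarrow> x = 1\<^sub>m n"
    and T: "finite T" "\<And>x. x \<in> H m \<Longrightarrow> \<kappa> x \<in> T" "real (card T) \<le> B"
    and sep: "\<And>x y z. x \<in> H m \<Longrightarrow> y \<in> H m \<Longrightarrow> z \<in> H m \<Longrightarrow> z * x = 1\<^sub>m n \<Longrightarrow> \<kappa> x = \<kappa> y \<Longrightarrow> z * y \<in> dom m"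
  shows "self_similarity_index_le (G m) B"
proof (rule self_similarity_index_leI[where D = "dom m" and \<theta> = cj and \<kappa> = \<kappa>, OF group_H subgroup_dom])
  fix N assume N: "N \<lhd> G m" "N \<subseteq> dom m" "cj ` N \<subseteq> N"
  have "x = 1\<^sub>m n" if x: "x \<in> N" for x
  proof (rule rigid)
    show "x \<in> H m" using x N(2) by (auto simp: dom_def)
  qed (use invariant_eigenvector[OF N x] in blast)
  moreover have "1\<^sub>m n \<in> N"
    using subgroup.one_closed[OF normal_imp_subgroup[OF N(1)]] by (simp add: mat_group_def)
  ultimately have "N = {1\<^sub>m n}" by blast
  then show "N = {\<one>\<^bsub>G m\<^esub>}" by (simp add: mat_group_def)
next
  fix x y assume "x \<in> carrier (G m)" "y \<in> carrier (G m)" "\<kappa> x = \<kappa> y"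
  then show "inv\<^bsub>G m\<^esub> x \<otimes>\<^bsub>G m\<^esub> y \<in> dom m"
    using sep[of x y "inv\<^bsub>G m\<^esub> x"] H_inv[of x m] by (simp add: mat_group_def)
qed (use T in \<open>auto simp: mat_group_def dom_def cj_mult\<close>)

text \<open>Conjugation multiplies the entry (i, j) by \<pi>^(k j - k i), so divisibility is at
  stake only where k j < k i.\<close>

lemma cj_H:
  assumes x: "x \<in> H m"
    and le: "\<And>i j. i < n \<Longrightarrow> j < n \<Longrightarrow> i \<noteq> j \<Longrightarrow> k j < k i \<Longrightarrow> x $$ (i, j) \<in> level (m + (k i - k j))"
  shows "cj x \<in> H m"
proof -
  have "cj x \<in> A" using A_conj x by (simp add: H_def cj_def)
  moreover have "cj x $$ (i, j) \<in> S \<and> cj x $$ (i, j) - delta i j \<in> level m"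
    if ij: "i < n" "j < n" for i j
  proof (cases "i = j")
    case True
    then show ?thesis using cj_diag H_entry[OF x ij] ij by simp
  next
    case False
    have "x $$ (i, j) \<in> level (m + (k i - k j))"
      using le[OF ij False] H_offdiag[OF x ij False] by (cases "k j < k i") auto
    then have l: "\<pi> ^ k j * x $$ (i, j) \<in> level (k j + (m + (k i - k j)))"
      by (intro level_mult power_level)
    have "\<pi> ^ k j * x $$ (i, j) \<in> level (m + k i)"
      by (rule level_antimono[OF l]) simp
    then have "cj x $$ (i, j) \<in> level m" using ij by (simp add: cj_entry level_divide)
    then show ?thesis using False level_subset by (auto simp: delta_def)
  qed
  ultimately show ?thesis by (auto simp: H_def)
qed

text \<open>The reduction of the distinguished column modulo a power of the uniformizer separates cosets.\<close>

theorem integral_points_index_le: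
  assumes rigid: "\<And>x. x \<in> H 0 \<Longrightarrow>
      (\<And>y. y \<in> H 0 \<Longrightarrow> \<exists>\<mu>. \<mu> \<in> S \<and> \<mu> - 1 \<in> level 1 \<and> (\<forall>i<n. (x * y) $$ (i, c) = \<mu> * y $$ (i, c))) \<Longrightarrow> x = 1\<^sub>m n"
    and suff: "\<And>x. x \<in> H 0 \<Longrightarrow> (\<And>i. i < n \<Longrightarrow> x $$ (i, c) - delta i c \<in> level w) \<Longrightarrow> cj x \<in> H 0"
    and w: "1 \<le> w" and B: "real q ^ (w * n) \<le> B"
  shows "self_similarity_index_le (G 0) B"
proof (rule self_similar_dom[where \<kappa> = "\<lambda>x. \<lambda>i\<in>{..<n}. residue_code w (x $$ (i, c))"
      and T = "{..<n} \<rightarrow>\<^sub>E {..<q ^ w}", OF rigid])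
  show "real (card ({..<n} \<rightarrow>\<^sub>E {..<q ^ w})) \<le> B"
    using B by (simp add: card_PiE power_mult)
  fix x assume x: "x \<in> H 0"
  show "(\<lambda>i\<in>{..<n}. residue_code w (x $$ (i, c))) \<in> {..<n} \<rightarrow>\<^sub>E {..<q ^ w}"
    using x c_less residue_code(1) by (auto intro: H_entry)
  fix y z assume y: "y \<in> H 0" and z: "z \<in> H 0" "z * x = 1\<^sub>m n"
    and eq: "(\<lambda>i\<in>{..<n}. residue_code w (x $$ (i, c))) = (\<lambda>i\<in>{..<n}. residue_code w (y $$ (i, c)))"
  have yx: "y $$ (i, c) - x $$ (i, c) \<in> level w" if "i < n" for i
    using fun_cong[OF eq, of i] that c_less x y by (intro residue_code(2)) (auto intro: H_entry)
  have zy: "z * y \<in> H 0" using z y by (intro H_mult)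
  have col: "(z * y) $$ (i, c) - delta i c \<in> level w" if i: "i < n" for i
  proof -
    have "(\<Sum>l<n. z $$ (i, l) * x $$ (l, c)) = delta i c"
      using mat_mult_entry[of z n x i c] z x i c_less by (auto simp: one_entry simp del: index_one_mat)
    \<comment> \<open>Since z x = 1, this is z applied to the difference of the two columns.\<close>
    then have "(z * y) $$ (i, c) - delta i c = (\<Sum>l<n. z $$ (i, l) * (y $$ (l, c) - x $$ (l, c)))"
      using mat_mult_entry[of z n y i c] z y i c_less by (simp add: right_diff_distrib sum_subtractf)
    also have "\<dots> \<in> level w"
      using z i yx by (intro level_sum level_mult_left) (auto intro: H_entry)
    finally show ?thesis .
  qed
  show "z * y \<in> dom 0"
    using zy suff[OF zy col] col[OF c_less] level_antimono[OF _ w] by (auto simp: dom_def delta_def)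
qed (auto simp: finite_PiE)

text \<open>Here the column is used as a point of projective space: it is normalized by the approximate
  inverse of its distinguished entry.\<close>

theorem congruence_subgroup_index_le:
  assumes m: "1 \<le> m"
    and rigid: "\<And>x. x \<in> H m \<Longrightarrow>
      (\<And>y. y \<in> H m \<Longrightarrow> \<exists>\<mu>. \<mu> \<in> S \<and> \<mu> - 1 \<in> level 1 \<and> (\<forall>i<n. (x * y) $$ (i, c) = \<mu> * y $$ (i, c))) \<Longrightarrow> x = 1\<^sub>m n"
    and suff: "\<And>x. x \<in> H m \<Longrightarrow> (\<And>i. i < n \<Longrightarrow> i \<noteq> c \<Longrightarrow> x $$ (i, c) \<in> level (m + h i)) \<Longrightarrow> cj x \<in> H m"
    and h: "\<And>i. i < n \<Longrightarrow> h i \<le> 2" "\<And>i j. i < n \<Longrightarrow> j < n \<Longrightarrow> j \<noteq> c \<Longrightarrow> h i \<le> Suc (h j)"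
    and B: "real q ^ (\<Sum>i\<in>{..<n} - {c}. h i) \<le> B"
  shows "self_similarity_index_le (G m) B"
proof -
  \<comment> \<open>Precision m + 2 is chosen because h never exceeds 2, so every congruence below
    is modulo \<pi>^(m + 2) at most.\<close>
  define v where "v x = near_inverse (m + 2) (x $$ (c, c))" for x :: "'a mat"
  have u1: "x $$ (c, c) - 1 \<in> level m" if "x \<in> H m" for x
    using H_entry(2)[OF that c_less c_less] by (simp add: delta_def)
  have u2: "x $$ (c, c) - 1 \<in> level 1" if "x \<in> H m" for x
    using level_antimono[OF u1[OF that] m] .
  have v: "v x \<in> S" "v x * x $$ (c, c) - 1 \<in> level (m + 2)" if "x \<in> H m" for x
    using near_inverse[OF H_entry(1)[OF that c_less c_less] u2[OF that]] by (auto simp: v_def)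
  \<comment> \<open>Outside c the entries of the column are divisible by \<pi>^m; after
    normalization only the next h i digits are recorded.\<close>
  define \<kappa> where "\<kappa> x = (\<lambda>i\<in>{..<n} - {c}. residue_code (h i) (v x * x $$ (i, c) / \<pi> ^ m))" for x
  have quo: "v x * x $$ (i, c) / \<pi> ^ m \<in> S" if "x \<in> H m" "i < n" "i \<noteq> c" for x i
  proof -
    have "v x * x $$ (i, c) \<in> level (0 + m)"
      using v(1)[OF that(1)] H_offdiag[OF that(1,2) c_less that(3)] by auto
    then show ?thesis using level_divide[of _ 0 m] by simp
  qed
  let ?T = "PiE ({..<n} - {c}) (\<lambda>i. {..<q ^ h i})"
  show ?thesis
  proof (rule self_similar_dom[where \<kappa> = \<kappa> and T = ?T, OF rigid])
    show "real (card ?T) \<le> B" using B by (simp add: card_PiE power_sum)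
    fix x assume x: "x \<in> H m"
    show "\<kappa> x \<in> ?T" using residue_code(1) quo[OF x] by (auto simp: \<kappa>_def)
    fix y z assume y: "y \<in> H m" and z: "z \<in> H m" "z * x = 1\<^sub>m n" and eq: "\<kappa> x = \<kappa> y"
    define e where "e i = v y * y $$ (i, c) - v x * x $$ (i, c)" for i
    have e1: "e i \<in> level (m + h i)" if i: "i < n" "i \<noteq> c" for i
    proof -
      have "v y * y $$ (i, c) / \<pi> ^ m - v x * x $$ (i, c) / \<pi> ^ m \<in> level (h i)"
        using fun_cong[OF eq, of i] i quo[OF x i] quo[OF y i] by (intro residue_code(2)) (auto simp: \<kappa>_def)
      then have "\<pi> ^ m * (v y * y $$ (i, c) / \<pi> ^ m - v x * x $$ (i, c) / \<pi> ^ m) \<in> level (m + h i)"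
        by (intro level_mult power_level)
      then show ?thesis by (simp add: e_def right_diff_distrib)
    qed
    have e2: "e c \<in> level (m + 2)"
    proof -
      have "e c = (v y * y $$ (c, c) - 1) - (v x * x $$ (c, c) - 1)" by (simp add: e_def)
      then show ?thesis using level_diff[OF v(2)[OF y] v(2)[OF x]] by simp
    qed
    have zy: "z * y \<in> H m" using z y by (intro H_mult)
    have zy_S: "(z * y) $$ (i, c) \<in> S" if "i < n" for i using H_entry(1)[OF zy that c_less] .
    have col: "(z * y) $$ (i, c) \<in> level (m + h i)" if i: "i < n" "i \<noteq> c" for i
    proof -
      have "(\<Sum>l<n. z $$ (i, l) * x $$ (l, c)) = 0"
        using mat_mult_entry[of z n x i c] z x i c_less by auto
      \<comment> \<open>z maps the column of x to e_c, which vanishes at i, so only the difference e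
        of the normalized columns contributes.\<close>
      moreover have "v y * (z * y) $$ (i, c)
          = (\<Sum>l<n. z $$ (i, l) * e l) + v x * (\<Sum>l<n. z $$ (i, l) * x $$ (l, c))"
        using mat_mult_entry[of z n y i c] z y i c_less
        by (simp add: e_def algebra_simps sum_subtractf sum_distrib_left)
      ultimately have *: "v y * (z * y) $$ (i, c) = (\<Sum>l<n. z $$ (i, l) * e l)" by simp
      have "z $$ (i, l) * e l \<in> level (m + h i)" if l: "l < n" for l
      proof (cases "l = i")
        case True
        then show ?thesis using e1[OF i] H_entry(1)[OF z(1) i(1) i(1)] by auto
      next
        case False
        have zl: "z $$ (i, l) \<in> level m" using H_offdiag[OF z(1) i(1) l] False by auto
        show ?thesis
        proof (cases "l = c")
          case True
          show ?thesis
            using level_antimono[OF level_mult[OF zl e2[folded True]], of "m + h i"] h(1)[OF i(1)] by simp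
        next
          \<comment> \<open>The exponents add up to 2 m + h l, which is at least m + h i because h i
            <= h l + 1 and m >= 1.\<close>
          case lc: False
          show ?thesis
            using level_antimono[OF level_mult[OF zl e1[OF l lc]], of "m + h i"] h(2)[OF i(1) l lc] m by simp
        qed
      qed
      then have "v y * (z * y) $$ (i, c) \<in> level (m + h i)" unfolding * by auto
      \<comment> \<open>The normalizing factor is removed by multiplying with y_cc, since v y * y_cc
        is congruent to 1.\<close>
      then have "y $$ (c, c) * (v y * (z * y) $$ (i, c)) \<in> level (m + h i)"
        using H_entry(1)[OF y c_less c_less] by auto
      then have **: "v y * y $$ (c, c) * (z * y) $$ (i, c) \<in> level (m + h i)" by (simp add: mult_ac)
      show ?thesis
        by (rule level_cancel[OF _ level_antimono[OF v(2)[OF y]] zy_S[OF i(1)] **])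
          (use v(1)[OF y] H_entry(1)[OF y c_less c_less] in auto)
    qed
    show "z * y \<in> dom m" using zy suff[OF zy col] u2[OF zy] by (simp add: dom_def)
  qed (auto simp: finite_PiE)
qed

end

section \<open>Vectors that are eigenvectors along the orbit of a basis vector\<close>

context weighted_group
begin

text \<open>Vectors are functions on all naturals, so that linear combinations are plain lambda
  terms; only their values below n enter.\<close>

definition app :: "'a mat \<Rightarrow> (nat \<Rightarrow> 'a) \<Rightarrow> nat \<Rightarrow> 'a" where
  "app x w i = (\<Sum>j<n. x $$ (i, j) * w j)"

lemma app_add: "app x (\<lambda>j. v j + a * w j) i = app x v i + a * app x w i"
  by (simp add: app_def algebra_simps sum.distrib sum_distrib_left)

lemma app_delta: "j < n \<Longrightarrow> app x (\<lambda>i. delta i j) i = x $$ (i, j)"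
  by (simp add: app_def)

lemma app_column:
  assumes "x \<in> carrier_mat n n" "y \<in> carrier_mat n n" "i < n" "\<And>j. j < n \<Longrightarrow> y $$ (j, c) = w j"
  shows "(x * y) $$ (i, c) = app x w i"
  using mat_mult_entry[OF assms(1,2,3) c_less] assms(4) by (simp add: app_def)

definition rigid_hyp :: "nat \<Rightarrow> 'a mat \<Rightarrow> bool" where
  "rigid_hyp m x \<longleftrightarrow> (\<forall>y\<in>H m. \<exists>\<mu>. \<mu> \<in> S \<and> \<mu> - 1 \<in> level 1 \<and> (\<forall>i<n. (x * y) $$ (i, c) = \<mu> * y $$ (i, c)))"

lemma rigid_hypE:
  assumes "rigid_hyp m x" "x \<in> H m" "y \<in> H m" "\<And>i. i < n \<Longrightarrow> y $$ (i, c) = w i"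
  obtains \<mu> where "\<mu> \<in> S" "\<mu> - 1 \<in> level 1" "\<And>i. i < n \<Longrightarrow> app x w i = \<mu> * w i"
proof -
  obtain \<mu> where \<mu>: "\<mu> \<in> S" "\<mu> - 1 \<in> level 1" "\<And>i. i < n \<Longrightarrow> (x * y) $$ (i, c) = \<mu> * y $$ (i, c)"
    using assms(1,3) unfolding rigid_hyp_def by blast
  have "app x w i = \<mu> * w i" if "i < n" for i
    using \<mu>(3)[OF that] app_column[OF H_carrier[OF assms(2)] H_carrier[OF assms(3)] that assms(4)]
      assms(4)[OF that] by simp
  then show ?thesis using that \<mu> by blast
qed

text \<open>Adding the equations for e_c + a u and e_c - a u gives 2 \<alpha> e_c = (\<mu> + \<nu>)
  e_c + (\<mu> - \<nu>) a u. As u has a nonzero coordinate outside c, this yields \<mu> = \<nu> and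
  then \<alpha> = \<mu>.\<close>

lemma eigenvector_of_pair:
  assumes two: "(2::'a) \<noteq> 0" and a: "a \<noteq> 0" and u: "i0 < n" "i0 \<noteq> c" "u i0 \<noteq> 0"
    and e: "\<And>i. i < n \<Longrightarrow> app x (\<lambda>i. delta i c) i = \<alpha> * delta i c"
    and plus: "\<And>i. i < n \<Longrightarrow> app x (\<lambda>i. delta i c + a * u i) i = \<mu> * (delta i c + a * u i)"
    and minus: "\<And>i. i < n \<Longrightarrow> app x (\<lambda>i. delta i c + - a * u i) i = \<nu> * (delta i c + - a * u i)"
    and i: "i < n"
  shows "app x u i = \<alpha> * u i"
proof -
  have p: "\<alpha> * delta j c + a * app x u j = \<mu> * (delta j c + a * u j)"
    and m: "\<alpha> * delta j c - a * app x u j = \<nu> * (delta j c - a * u j)" if "j < n" for j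
    using plus[OF that] minus[OF that] e[OF that] app_add[of x "\<lambda>i. delta i c" a u j]
      app_add[of x "\<lambda>i. delta i c" "- a" u j] by simp_all
  have d: "2 * \<alpha> * delta j c = (\<mu> + \<nu>) * delta j c + (\<mu> - \<nu>) * a * u j" if "j < n" for j
  proof -
    have "2 * \<alpha> * delta j c = (\<alpha> * delta j c + a * app x u j) + (\<alpha> * delta j c - a * app x u j)" by simp
    also have "\<dots> = (\<mu> + \<nu>) * delta j c + (\<mu> - \<nu>) * a * u j"
      unfolding p[OF that] m[OF that] by (simp add: algebra_simps)
    finally show ?thesis .
  qed
  have "\<mu> = \<nu>" using d[OF u(1)] u a by (simp add: delta_def)
  then have "2 * \<alpha> = 2 * \<mu>" using d[OF c_less] by (simp add: delta_def)
  then have "\<alpha> = \<mu>" using two by simp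
  then have "a * app x u i = a * (\<alpha> * u i)" using p[OF i] by (simp add: algebra_simps)
  then show ?thesis using a by simp
qed

end

section \<open>Determinants and adjugates over the ring\<close>

context uniformized_ring
begin

lemma det_closed:
  assumes M: "M \<in> carrier_mat n n" and "\<And>i j. i < n \<Longrightarrow> j < n \<Longrightarrow> M $$ (i, j) \<in> S"
  shows "det M \<in> S"
  unfolding det_def'[OF M]
proof (intro sum_closed mult_closed prod_closed)
  fix \<sigma> i assume "\<sigma> \<in> {\<sigma>. \<sigma> permutes {0..<n}}"
  then show "signof \<sigma> \<in> S" by auto
  assume "i \<in> {0..<n}"
  then show "M $$ (i, \<sigma> i) \<in> S"
    using \<open>\<sigma> \<in> _\<close> permutes_in_image[of \<sigma> "{0..<n}" i] by (intro assms(2)) auto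
qed

lemma adj_mat_closed:
  assumes M: "M \<in> carrier_mat n n" and S: "\<And>i j. i < n \<Longrightarrow> j < n \<Longrightarrow> M $$ (i, j) \<in> S"
    and ij: "i < n" "j < n"
  shows "adj_mat M $$ (i, j) \<in> S"
proof -
  have "det (mat_delete M j i) \<in> S"
  proof (rule det_closed)
    show "mat_delete M j i \<in> carrier_mat (n - 1) (n - 1)" using M by (rule mat_delete_carrier)
    fix a b assume "a < n - 1" "b < n - 1"
    then show "mat_delete M j i $$ (a, b) \<in> S" using M S ij by (auto simp: mat_delete_def)
  qed
  then show ?thesis using M ij by (auto simp: adj_mat_def cofactor_def)
qed

lemma det_conj_diagonal:
  assumes x: "x \<in> carrier_mat n n"
  shows "det (mat n n (\<lambda>(i, j). \<pi> ^ k j * x $$ (i, j) / \<pi> ^ k i)) = det x"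
proof -
  let ?P = "mat_diag n (\<lambda>i. \<pi> ^ k i)" and ?Q = "mat_diag n (\<lambda>i. 1 / \<pi> ^ k i)"
  have "mat n n (\<lambda>(i, j). \<pi> ^ k j * x $$ (i, j) / \<pi> ^ k i) = ?Q * (x * ?P)"
    using x by (subst mat_diag_mult_right[of _ n], simp, subst mat_diag_mult_left[of _ _ n])
      (auto intro!: eq_matI)
  then have "det (mat n n (\<lambda>(i, j). \<pi> ^ k j * x $$ (i, j) / \<pi> ^ k i)) = det ?Q * (det x * det ?P)"
    using x by (simp add: det_mult[of _ n])
  also have "\<dots> = det (?Q * ?P) * det x" by (simp add: det_mult[of _ n] del: mat_diag_diag)
  also have "?Q * ?P = 1\<^sub>m n" by simp
  finally show ?thesis by simp
qed

lemma two_nonzero: "coprime 2 p \<Longrightarrow> (2::'a) \<noteq> 0"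
  using of_nat_nonzero[of 2] by simp

end

section \<open>The special linear group\<close>

locale special_linear = uniformized_ring S \<pi> p q for S :: "'a::field set" and \<pi> p q +
  fixes n :: nat
  assumes n_pos: "0 < n" and n_coprime: "coprime n p" and odd: "coprime 2 p"
begin

lemma SL_inverse:
  assumes "x \<in> carrier_mat n n" "det x = 1" "\<And>i j. i < n \<Longrightarrow> j < n \<Longrightarrow> x $$ (i, j) \<in> S"
  shows "\<exists>y\<in>{x \<in> carrier_mat n n. det x = 1}. y * x = 1\<^sub>m n \<and> (\<forall>i<n. \<forall>j<n. y $$ (i, j) \<in> S)"
proof
  have adj: "adj_mat x * x = 1\<^sub>m n" "adj_mat x \<in> carrier_mat n n"
    using adj_mat[OF assms(1)] assms(2) by auto
  have "det (adj_mat x) = 1" using det_mult[OF adj(2) assms(1)] adj assms(2) by simp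
  then show "adj_mat x \<in> {x \<in> carrier_mat n n. det x = 1}" using adj by simp
  show "adj_mat x * x = 1\<^sub>m n \<and> (\<forall>i<n. \<forall>j<n. adj_mat x $$ (i, j) \<in> S)"
    using adj adj_mat_closed[OF assms(1,3)] by simp
qed

sublocale weighted_group S \<pi> p q n 0 "\<lambda>i. if i = 0 then 0 else 1" "{x \<in> carrier_mat n n. det x = 1}"
proof
  fix x :: "'a mat" assume x: "x \<in> {x \<in> carrier_mat n n. det x = 1}"
  then show "x \<in> carrier_mat n n" by simp
  show "mat n n (\<lambda>(i, j). \<pi> ^ (if j = 0 then 0 else 1) * x $$ (i, j) / \<pi> ^ (if i = 0 then 0 else 1))
      \<in> {x \<in> carrier_mat n n. det x = 1}"
    using x det_conj_diagonal[of x n "\<lambda>i. if i = 0 then 0 else 1"] by simp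
  show "\<exists>y\<in>{x \<in> carrier_mat n n. det x = 1}. y * x = 1\<^sub>m n \<and> (\<forall>i<n. \<forall>j<n. y $$ (i, j) \<in> S)"
    if "\<And>i j. i < n \<Longrightarrow> j < n \<Longrightarrow> x $$ (i, j) \<in> S"
    by (rule SL_inverse[OF _ _ that]) (use x in auto)
  fix y :: "'a mat" assume "y \<in> {x \<in> carrier_mat n n. det x = 1}"
  then show "x * y \<in> {x \<in> carrier_mat n n. det x = 1}"
    using x by (simp add: det_mult[of _ n] mult_carrier_mat[of _ n n])
qed (use n_pos in auto)

text \<open>Elementary matrices with entry \<pi>^m or -\<pi>^m at (j, 0) move e_0 by that multiple
  of e_j, so e_j shares the eigenvalue \<alpha> of e_0. The determinant gives \<alpha>^n = 1, and
  \<alpha> is congruent to 1.\<close>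

lemma rigid:
  assumes x: "x \<in> H m" and hyp: "rigid_hyp m x"
  shows "x = 1\<^sub>m n"
proof -
  obtain \<alpha> where l: "\<alpha> \<in> S" "\<alpha> - 1 \<in> level 1"
    "\<And>i. i < n \<Longrightarrow> app x (\<lambda>i. delta i 0) i = \<alpha> * delta i 0"
    using rigid_hypE[OF hyp x H_one, of "\<lambda>i. delta i 0"] n_pos by (auto simp: delta_def)
  have entry: "x $$ (i, j) = \<alpha> * delta i j" if ij: "i < n" "j < n" for i j
  proof (cases "j = 0")
    case True
    then show ?thesis using l(3)[OF ij(1)] app_delta[OF n_pos] by simp
  next
    case False
    have y: "addrow_mat n a j 0 \<in> H m"
      "i < n \<Longrightarrow> addrow_mat n a j 0 $$ (i, 0) = delta i 0 + a * delta i j" if a: "a \<in> level m" for a i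
    proof -
      have e: "addrow_mat n a j 0 $$ (i', j') = delta i' j' + a * (delta i' j * delta j' 0)"
        if "i' < n" "j' < n" for i' j'
        using that by (auto simp: addrow_mat_def delta_def)
      have l: "a * (delta i' j * delta j' 0) \<in> level m" for i' j' using a by auto
      have "addrow_mat n a j 0 $$ (i', j') \<in> S
          \<and> addrow_mat n a j 0 $$ (i', j') - delta i' j' \<in> level m" if "i' < n" "j' < n" for i' j'
        unfolding e[OF that] using l[of i' j'] subsetD[OF level_subset l[of i' j']] by simp
      moreover have "addrow_mat n a j 0 \<in> {x \<in> carrier_mat n n. det x = 1}"
        using det_addrow_mat[OF False] by simp
      ultimately show "addrow_mat n a j 0 \<in> H m" unfolding H_def by blast
      show "addrow_mat n a j 0 $$ (i, 0) = delta i 0 + a * delta i j" if "i < n"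
        using e[OF that n_pos] by (simp add: delta_def)
    qed
    obtain \<mu> where \<mu>: "\<And>i. i < n \<Longrightarrow>
        app x (\<lambda>i. delta i 0 + \<pi> ^ m * delta i j) i = \<mu> * (delta i 0 + \<pi> ^ m * delta i j)"
      using rigid_hypE[OF hyp x y(1)[OF power_level] y(2)[OF power_level]] by metis
    obtain \<nu> where \<nu>: "\<And>i. i < n \<Longrightarrow>
        app x (\<lambda>i. delta i 0 + - (\<pi> ^ m) * delta i j) i = \<nu> * (delta i 0 + - (\<pi> ^ m) * delta i j)"
      using rigid_hypE[OF hyp x y(1)[OF level_uminus[OF power_level]] y(2)[OF level_uminus[OF power_level]]]
      by metis
    have "app x (\<lambda>i. delta i j) i = \<alpha> * delta i j"
      by (rule eigenvector_of_pair[OF two_nonzero[OF odd] _ ij(2) False _ l(3) \<mu> \<nu> ij(1)])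
        (auto simp: delta_def)
    then show ?thesis using app_delta[OF ij(2)] by simp
  qed
  have "x = \<alpha> \<cdot>\<^sub>m 1\<^sub>m n"
  proof (rule eq_matI)
    fix i j assume "i < dim_row (\<alpha> \<cdot>\<^sub>m 1\<^sub>m n)" "j < dim_col (\<alpha> \<cdot>\<^sub>m 1\<^sub>m n)"
    then have "i < n" "j < n" by simp_all
    then show "x $$ (i, j) = (\<alpha> \<cdot>\<^sub>m 1\<^sub>m n) $$ (i, j)" using entry[of i j] by (simp add: delta_def)
  qed (use carrier_matD[OF H_carrier[OF x]] in simp_all)
  moreover have "det x = 1" using x unfolding H_def by blast
  ultimately have "\<alpha> ^ n = 1" by (metis det_one det_smult index_one_mat(3) mult.right_neutral)
  then have "\<alpha> = 1" using root_of_unity[OF n_coprime l(1,2)] by simp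
  then show ?thesis using \<open>x = \<alpha> \<cdot>\<^sub>m 1\<^sub>m n\<close> by (auto intro: eq_matI)
qed

text \<open>Weights differ by at most 1, so the column modulo \<pi> decides, and it takes at most
  q^n values.\<close>

theorem SL_index_le: "real q ^ n \<le> B \<Longrightarrow> self_similarity_index_le (G 0) B"
proof (rule integral_points_index_le[where w = 1])
  fix x assume x: "x \<in> H 0" and col: "\<And>i. i < n \<Longrightarrow> x $$ (i, 0) - delta i 0 \<in> level 1"
  show "cj x \<in> H 0"
  proof (rule cj_H[OF x])
    fix i j :: nat assume "i < n" and "(if j = 0 then 0 else 1) < (if i = 0 then 0 else 1 :: nat)"
    then show "x $$ (i, j) \<in> level (0 + ((if i = 0 then 0 else 1) - (if j = 0 then 0 else 1)))"
      using col[of i] by (cases "i = 0"; cases "j = 0") (auto simp: delta_def)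
  qed
qed (auto intro: rigid simp: rigid_hyp_def)

theorem SL_congruence_index_le:
  assumes "1 \<le> m" "real q ^ (n - 1) \<le> B"
  shows "self_similarity_index_le (G m) B"
proof (rule congruence_subgroup_index_le[where h = "\<lambda>i. if i = 0 then 0 else 1", OF assms(1)])
  fix x assume x: "x \<in> H m"
    and col: "\<And>i. i < n \<Longrightarrow> i \<noteq> 0 \<Longrightarrow> x $$ (i, 0) \<in> level (m + (if i = 0 then 0 else 1))"
  show "cj x \<in> H m"
  proof (rule cj_H[OF x])
    fix i j :: nat assume "i < n" and "(if j = 0 then 0 else 1) < (if i = 0 then 0 else 1 :: nat)"
    then show "x $$ (i, j) \<in> level (m + ((if i = 0 then 0 else 1) - (if j = 0 then 0 else 1)))"
      using col[of i] by (cases "i = 0"; cases "j = 0") auto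
  qed
next
  have "(\<Sum>i\<in>{..<n} - {0}. if i = 0 then 0 else 1) = (\<Sum>i\<in>{..<n} - {0}. 1 :: nat)"
    by (rule sum.cong) auto
  also have "\<dots> = n - 1" using n_pos by simp
  finally show "real q ^ (\<Sum>i\<in>{..<n} - {0}. if i = 0 then 0 else 1) \<le> B" using assms(2) by simp
qed (auto intro: rigid simp: rigid_hyp_def)

end

section \<open>Symplectic and orthogonal groups\<close>

text \<open>Both forms are given by a signed permutation matrix: \<^term>\<open>\<tau>\<close> is the involution that pairs the
  basis vectors and \<^term>\<open>\<epsilon>\<close> gives the signs. The flag \<^term>\<open>b\<close> distinguishes the special orthogonal
  case from the symplectic one.\<close>

locale form_group = uniformized_ring S \<pi> p q for S :: "'a::field set" and \<pi> p q +
  fixes n c :: nat and \<tau> :: "nat \<Rightarrow> nat" and \<epsilon> :: "nat \<Rightarrow> 'a" and b :: bool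
  assumes c_less: "c < n" and \<tau>_less: "i < n \<Longrightarrow> \<tau> i < n" and \<tau>_\<tau>: "i < n \<Longrightarrow> \<tau> (\<tau> i) = i"
    and \<tau>_c: "\<tau> c \<noteq> c" and sign: "i < n \<Longrightarrow> \<epsilon> i = 1 \<or> \<epsilon> i = - 1"
    and sign_\<tau>: "i < n \<Longrightarrow> \<epsilon> (\<tau> i) = (if b then \<epsilon> i else - \<epsilon> i)"
    and sign_orth: "b \<Longrightarrow> i < n \<Longrightarrow> \<epsilon> i = 1"
    and odd: "coprime 2 p" and rank: "b \<Longrightarrow> \<exists>i<n. i \<noteq> c \<and> i \<noteq> \<tau> c"
begin

definition gram :: "'a mat" where
  "gram = mat n n (\<lambda>(i, j). if j = \<tau> i then \<epsilon> i else 0)"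

definition wt :: "nat \<Rightarrow> nat" where
  "wt i = (if i = c then 0 else if i = \<tau> c then 2 else 1)"

definition isom :: "'a mat set" where
  "isom = {x \<in> carrier_mat n n. transpose_mat x * gram * x = gram \<and> (b \<longrightarrow> det x = 1)}"

lemma gram_carrier [simp]: "gram \<in> carrier_mat n n"
  by (simp add: gram_def)

lemma sign_closed: "i < n \<Longrightarrow> \<epsilon> i \<in> S"
  using sign[of i] by auto

lemma sign_square: "i < n \<Longrightarrow> \<epsilon> i * \<epsilon> i = 1"
  using sign[of i] by auto

lemma sign_nonzero: "i < n \<Longrightarrow> \<epsilon> i \<noteq> 0"
  using sign[of i] by auto

lemma \<tau>_eq: "i < n \<Longrightarrow> j < n \<Longrightarrow> j = \<tau> i \<longleftrightarrow> i = \<tau> j"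
  using \<tau>_\<tau> by auto

lemma transport_entry:
  assumes x: "x \<in> carrier_mat n n" and ij: "i < n" "j < n"
  shows "(transpose_mat x * gram * x) $$ (i, j) = (\<Sum>l<n. x $$ (l, i) * \<epsilon> l * x $$ (\<tau> l, j))"
proof -
  have "transpose_mat x * gram * x = transpose_mat x * (gram * x)"
    using x by (intro assoc_mult_mat[of _ n n _ n _ n]) auto
  moreover have "(gram * x) $$ (l, j) = \<epsilon> l * x $$ (\<tau> l, j)" if "l < n" for l
  proof -
    have "(gram * x) $$ (l, j) = (\<Sum>k<n. (if k = \<tau> l then \<epsilon> l else 0) * x $$ (k, j))"
      using mat_mult_entry[OF gram_carrier x that ij(2)] that by (simp add: gram_def)
    also have "\<dots> = (\<Sum>k<n. if k = \<tau> l then \<epsilon> l * x $$ (k, j) else 0)"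
      by (rule sum.cong) auto
    finally show ?thesis using \<tau>_less[OF that] by simp
  qed
  ultimately show ?thesis
    using x ij mat_mult_entry[of "transpose_mat x" n "gram * x" i j]
    by (simp add: mult.assoc mult_carrier_mat[of _ n n])
qed

lemma form_iff:
  assumes x: "x \<in> carrier_mat n n"
  shows "transpose_mat x * gram * x = gram \<longleftrightarrow>
    (\<forall>i<n. \<forall>j<n. (\<Sum>l<n. x $$ (l, i) * \<epsilon> l * x $$ (\<tau> l, j)) = (if j = \<tau> i then \<epsilon> i else 0))"
proof
  assume eq: "transpose_mat x * gram * x = gram"
  show "\<forall>i<n. \<forall>j<n. (\<Sum>l<n. x $$ (l, i) * \<epsilon> l * x $$ (\<tau> l, j)) = (if j = \<tau> i then \<epsilon> i else 0)"
  proof (intro allI impI)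
    fix i j assume ij: "i < n" "j < n"
    show "(\<Sum>l<n. x $$ (l, i) * \<epsilon> l * x $$ (\<tau> l, j)) = (if j = \<tau> i then \<epsilon> i else 0)"
      using transport_entry[OF x ij] ij unfolding eq by (simp add: gram_def)
  qed
next
  assume *: "\<forall>i<n. \<forall>j<n. (\<Sum>l<n. x $$ (l, i) * \<epsilon> l * x $$ (\<tau> l, j)) = (if j = \<tau> i then \<epsilon> i else 0)"
  show "transpose_mat x * gram * x = gram"
  proof (rule eq_matI)
    fix i j assume "i < dim_row gram" "j < dim_col gram"
    then have ij: "i < n" "j < n" by (auto simp: gram_def)
    have "(transpose_mat x * gram * x) $$ (i, j) = (if j = \<tau> i then \<epsilon> i else 0)"
      using transport_entry[OF x ij] * ij by simp
    then show "(transpose_mat x * gram * x) $$ (i, j) = gram $$ (i, j)" using ij by (simp add: gram_def)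
  qed (use x in \<open>auto simp: gram_def\<close>)
qed

text \<open>A signed permutation matrix is orthogonal. This provides the inverse of an isometry as a
  product of integral matrices.\<close>

lemma gram_transpose: "transpose_mat gram * gram = 1\<^sub>m n"
proof (rule eq_matI)
  fix i j assume "i < dim_row (1\<^sub>m n :: 'a mat)" "j < dim_col (1\<^sub>m n :: 'a mat)"
  then have ij: "i < n" "j < n" by auto
  have "(transpose_mat gram * gram) $$ (i, j)
      = (\<Sum>l<n. (if i = \<tau> l then \<epsilon> l else 0) * (if j = \<tau> l then \<epsilon> l else 0))"
    using mat_mult_entry[of "transpose_mat gram" n gram i j] ij by (simp add: gram_def)
  also have "\<dots> = (\<Sum>l<n. if l = \<tau> i then (if i = j then 1 else 0) else 0)"
  proof (rule sum.cong)
    fix l assume "l \<in> {..<n}"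
    then show "(if i = \<tau> l then \<epsilon> l else 0) * (if j = \<tau> l then \<epsilon> l else 0)
        = (if l = \<tau> i then (if i = j then 1 else 0) else 0)"
      using \<tau>_eq[of i l] \<tau>_eq[of j l] sign_square[of l] ij by auto
  qed simp
  finally show "(transpose_mat gram * gram) $$ (i, j) = 1\<^sub>m n $$ (i, j)"
    using \<tau>_less[OF ij(1)] ij by simp
qed (use carrier_matD[OF gram_carrier] in simp_all)

lemma transport_mult:
  assumes "x \<in> carrier_mat n n" "y \<in> carrier_mat n n"
  shows "transpose_mat (x * y) * gram * (x * y) = transpose_mat y * (transpose_mat x * gram * x) * y"
proof -
  let ?X = "transpose_mat x" and ?Y = "transpose_mat y"
  have c: "?X \<in> carrier_mat n n" "?Y \<in> carrier_mat n n" using assms by auto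
  note a = assoc_mult_mat[of _ n n _ n _ n]
  have "transpose_mat (x * y) = ?Y * ?X" by (rule transpose_mult[OF assms])
  then show ?thesis using assms c by (simp add: a mult_carrier_mat[of _ n n])
qed

lemma isom_mult:
  assumes "x \<in> isom" "y \<in> isom"
  shows "x * y \<in> isom"
  using assms transport_mult[of x y] by (simp add: isom_def det_mult[of _ n] mult_carrier_mat[of _ n n])

lemma isom_inverse:
  assumes x: "x \<in> isom" and S: "\<And>i j. i < n \<Longrightarrow> j < n \<Longrightarrow> x $$ (i, j) \<in> S"
  shows "\<exists>y\<in>isom. y * x = 1\<^sub>m n \<and> (\<forall>i<n. \<forall>j<n. y $$ (i, j) \<in> S)"
proof -
  let ?T = "transpose_mat gram" and ?X = "transpose_mat x"
  \<comment> \<open>The form equation says that gram^-1 x^T gram inverts x, and gram^-1 is the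
    transpose of gram.\<close>
  let ?y = "?T * (?X * gram)"
  have xc: "x \<in> carrier_mat n n" and form: "?X * gram * x = gram" using x by (auto simp: isom_def)
  have T: "?T \<in> carrier_mat n n" and X: "?X \<in> carrier_mat n n" using xc gram_carrier by simp_all
  note XG = mult_carrier_mat[OF X gram_carrier]
  note c = T X XG mult_carrier_mat[OF T XG]
  have "?y * x = ?T * (?X * gram * x)" by (rule assoc_mult_mat[OF T XG xc])
  then have yx: "?y * x = 1\<^sub>m n" by (simp add: form gram_transpose)
  have xy: "x * ?y = 1\<^sub>m n" by (rule mat_mult_left_right_inverse[OF c(4) xc yx])
  have "transpose_mat ?y * gram * ?y = transpose_mat (x * ?y) * gram * (x * ?y)"
    using transport_mult[OF xc c(4)] form by simp
  also have "\<dots> = gram"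
    unfolding xy using left_mult_one_mat[OF gram_carrier] right_mult_one_mat[OF gram_carrier] by simp
  finally have "transpose_mat ?y * gram * ?y = gram" .
  moreover have "det ?y = 1" if b
  proof -
    have "det x = 1" using x that unfolding isom_def by blast
    then show ?thesis using det_mult[OF c(4) xc] unfolding yx by simp
  qed
  ultimately have y: "?y \<in> isom" using c(4) unfolding isom_def by blast
  have gS: "gram $$ (i, j) \<in> S" if "i < n" "j < n" for i j
    using that sign_closed by (simp add: gram_def)
  have mS: "(u * v) $$ (i, j) \<in> S" if "u \<in> carrier_mat n n" "v \<in> carrier_mat n n"
    "\<And>i j. i < n \<Longrightarrow> j < n \<Longrightarrow> u $$ (i, j) \<in> S" "\<And>i j. i < n \<Longrightarrow> j < n \<Longrightarrow> v $$ (i, j) \<in> S"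
    "i < n" "j < n" for u v i j
    unfolding mat_mult_entry[OF that(1,2,5,6)] by (intro sum_closed mult_closed that) auto
  have "?y $$ (i, j) \<in> S" if "i < n" "j < n" for i j
  proof (rule mS[OF c(1,3) _ _ that])
    show "?T $$ (i, j) \<in> S" if "i < n" "j < n" for i j using gS that carrier_matD[OF gram_carrier] by simp
    show "(?X * gram) $$ (i, j) \<in> S" if "i < n" "j < n" for i j
      by (rule mS[OF c(2) gram_carrier _ gS that]) (use S xc in simp)
  qed
  then show ?thesis using y yx by blast
qed

lemma wt_\<tau>: "i < n \<Longrightarrow> wt i + wt (\<tau> i) = 2"
proof -
  assume i: "i < n"
  have "i = c \<or> i = \<tau> c \<or> (i \<noteq> c \<and> i \<noteq> \<tau> c \<and> \<tau> i \<noteq> c \<and> \<tau> i \<noteq> \<tau> c)"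
    using \<tau>_\<tau>[OF i] \<tau>_\<tau>[OF c_less] by metis
  then show ?thesis using \<tau>_c \<tau>_\<tau>[OF c_less] by (elim disjE) (simp_all add: wt_def)
qed

text \<open>Because wt i + wt (\<tau> i) = 2, the diagonal matrix scales the form by the constant
  \<pi>^-2, and this constant drops out of the conjugate.\<close>

lemma isom_conj:
  assumes x: "x \<in> isom"
  shows "mat n n (\<lambda>(i, j). \<pi> ^ wt j * x $$ (i, j) / \<pi> ^ wt i) \<in> isom"
proof -
  let ?y = "mat n n (\<lambda>(i, j). \<pi> ^ wt j * x $$ (i, j) / \<pi> ^ wt i)"
  have xc: "x \<in> carrier_mat n n" using x by (simp add: isom_def)
  have yc: "?y \<in> carrier_mat n n" by simp
  have form: "(\<Sum>l<n. x $$ (l, i) * \<epsilon> l * x $$ (\<tau> l, j)) = (if j = \<tau> i then \<epsilon> i else 0)"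
    if "i < n" "j < n" for i j
    using x form_iff[OF xc] that by (simp add: isom_def)
  have "(\<Sum>l<n. ?y $$ (l, i) * \<epsilon> l * ?y $$ (\<tau> l, j)) = (if j = \<tau> i then \<epsilon> i else 0)"
    if ij: "i < n" "j < n" for i j
  proof -
    have "(\<Sum>l<n. ?y $$ (l, i) * \<epsilon> l * ?y $$ (\<tau> l, j))
        = (\<Sum>l<n. \<pi> ^ (wt i + wt j) / \<pi> ^ 2 * (x $$ (l, i) * \<epsilon> l * x $$ (\<tau> l, j)))"
    proof (rule sum.cong)
      fix l assume "l \<in> {..<n}"
      then have l: "l < n" by simp
      have "\<pi> ^ 2 = \<pi> ^ wt l * \<pi> ^ wt (\<tau> l)" unfolding wt_\<tau>[OF l, symmetric] power_add ..
      then show "?y $$ (l, i) * \<epsilon> l * ?y $$ (\<tau> l, j)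
          = \<pi> ^ (wt i + wt j) / \<pi> ^ 2 * (x $$ (l, i) * \<epsilon> l * x $$ (\<tau> l, j))"
        using ij l \<tau>_less[OF l] by (simp add: power_add)
    qed simp
    also have "\<dots> = \<pi> ^ (wt i + wt j) / \<pi> ^ 2 * (if j = \<tau> i then \<epsilon> i else 0)"
      unfolding form[OF ij, symmetric] by (simp add: sum_distrib_left)
    finally show ?thesis using wt_\<tau>[OF ij(1)] by simp
  qed
  then have "transpose_mat ?y * gram * ?y = gram" using form_iff[OF yc] by blast
  then show ?thesis using x xc det_conj_diagonal[OF xc, of wt] by (simp add: isom_def)
qed

sublocale weighted_group S \<pi> p q n c wt isom
proof
  fix x :: "'a mat" assume x: "x \<in> isom"
  show "x \<in> carrier_mat n n" using x by (simp add: isom_def)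
  show "mat n n (\<lambda>(i, j). \<pi> ^ wt j * x $$ (i, j) / \<pi> ^ wt i) \<in> isom" by (rule isom_conj[OF x])
  show "\<exists>y\<in>isom. y * x = 1\<^sub>m n \<and> (\<forall>i<n. \<forall>j<n. y $$ (i, j) \<in> S)"
    if "\<And>i j. i < n \<Longrightarrow> j < n \<Longrightarrow> x $$ (i, j) \<in> S"
    by (rule isom_inverse[OF x that])
  fix y :: "'a mat" assume "y \<in> isom"
  then show "x * y \<in> isom" using x by (intro isom_mult)
next
  show "1\<^sub>m n \<in> isom"
    using left_mult_one_mat[OF gram_carrier] right_mult_one_mat[OF gram_carrier] by (simp add: isom_def)
qed (use c_less in \<open>auto simp: wt_def\<close>)

lemma H_form:
  assumes "x \<in> H m" "i < n" "j < n"
  shows "(\<Sum>l<n. x $$ (l, i) * \<epsilon> l * x $$ (\<tau> l, j)) = (if j = \<tau> i then \<epsilon> i else 0)"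
proof -
  have "x \<in> isom" using assms(1) unfolding H_def by blast
  then have "x \<in> carrier_mat n n" "transpose_mat x * gram * x = gram" unfolding isom_def by blast+
  then show ?thesis using form_iff assms(2,3) by blast
qed

definition red_wt :: "nat \<Rightarrow> nat" where
  "red_wt i = (if b \<and> i = \<tau> c then 0 else wt i)"

text \<open>In the orthogonal case the entry opposite to the distinguished one is determined by the rest of
  the column, because the column is isotropic; this is why its reduced weight is zero.\<close>

lemma cj_H_first_column:
  assumes x: "x \<in> H m" and cc: "x $$ (c, c) - 1 \<in> level 1"
    and col: "\<And>i. i < n \<Longrightarrow> i \<noteq> c \<Longrightarrow> x $$ (i, c) \<in> level (max 1 (m + red_wt i))"
  shows "cj x \<in> H m"
proof -
  let ?c' = "\<tau> c"
  have c': "?c' < n" "?c' \<noteq> c" "\<tau> ?c' = c" using \<tau>_less[OF c_less] \<tau>_c \<tau>_\<tau>[OF c_less] by auto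
  have S: "x $$ (i, j) \<in> S" if "i < n" "j < n" for i j using H_entry(1)[OF x that] .
  have mid: "x $$ (i, c) \<in> level (m + 1)" if "i < n" "i \<noteq> c" "i \<noteq> ?c'" for i
    using col[OF that(1,2)] that by (simp add: red_wt_def wt_def)
  \<comment> \<open>x_cc is congruent to 1 and \<open>\<epsilon> c\<close> is a sign, so both may be
    cancelled when testing membership in a level.\<close>
  have cancel: "y \<in> level k" if "y \<in> S" "x $$ (c, c) * (\<epsilon> c * y) \<in> level k" for y k
  proof -
    have "\<epsilon> c * y \<in> level k"
      using level_cancel[OF S[OF c_less c_less] cc _ that(2)] that(1) sign_closed[OF c_less] by simp
    then have "\<epsilon> c * (\<epsilon> c * y) \<in> level k" using sign_closed[OF c_less] by auto
    then show ?thesis using sign_square[OF c_less] by (simp flip: mult.assoc)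
  qed
  \<comment> \<open>Columns c and j pair to zero unless j = \<tau> c; the summands at c and \<tau> c
    are separated from the middle ones.\<close>
  have split: "x $$ (c, c) * (\<epsilon> c * x $$ (?c', j)) + x $$ (?c', c) * \<epsilon> ?c' * x $$ (c, j)
      + (\<Sum>l\<in>{..<n} - {c} - {?c'}. x $$ (l, c) * \<epsilon> l * x $$ (\<tau> l, j)) = 0"
    if "j < n" "j \<noteq> ?c'" for j
    using H_form[OF x c_less that(1)] that(2) c' c_less
      sum.remove[of "{..<n}" c "\<lambda>l. x $$ (l, c) * \<epsilon> l * x $$ (\<tau> l, j)"]
      sum.remove[of "{..<n} - {c}" ?c' "\<lambda>l. x $$ (l, c) * \<epsilon> l * x $$ (\<tau> l, j)"]
    by (simp add: mult.assoc add.assoc)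
  have opp: "x $$ (?c', c) \<in> level (m + 2)"
  proof (cases b)
    case False
    then show ?thesis using col[OF c'(1,2), unfolded red_wt_def wt_def] c' by simp
  next
    case True
    let ?r = "\<Sum>l\<in>{..<n} - {c} - {?c'}. x $$ (l, c) * \<epsilon> l * x $$ (\<tau> l, c)"
    have "x $$ (l, c) * \<epsilon> l * x $$ (\<tau> l, c) \<in> level (m + 2)" if "l \<in> {..<n} - {c} - {?c'}" for l
    proof -
      have l: "l < n" "l \<noteq> c" "l \<noteq> ?c'" using that by auto
      then have l': "\<tau> l < n" "\<tau> l \<noteq> c" "\<tau> l \<noteq> ?c'" using \<tau>_less[of l] \<tau>_\<tau>[of l] \<tau>_\<tau>[OF c_less] by auto
      \<comment> \<open>Both entries lie in level m + 1, so the product reaches level 2 m + 2, which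
        is inside the required level m + 2.\<close>
      have "x $$ (l, c) * \<epsilon> l * x $$ (\<tau> l, c) \<in> level ((m + 1) + (m + 1))"
        using mid[OF l] mid[OF l'] sign_closed[OF l(1)] by (intro level_mult level_mult_right)
      then show ?thesis by (rule level_antimono) simp
    qed
    then have r: "?r \<in> level (m + 2)" by (intro level_sum)
    have "of_nat 2 * (x $$ (c, c) * (\<epsilon> c * x $$ (?c', c))) = - ?r"
      using split[OF c_less c'(2)[symmetric]] sign_\<tau>[OF c_less] True
      by (simp add: algebra_simps eq_neg_iff_add_eq_0)
    then have "of_nat 2 * (x $$ (c, c) * (\<epsilon> c * x $$ (?c', c))) \<in> level (m + 2)" using level_uminus[OF r] by simp
    then have "x $$ (c, c) * (\<epsilon> c * x $$ (?c', c)) \<in> level (m + 2)"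
      using of_nat_cancel[OF odd] S c' c_less sign_closed by simp
    then show ?thesis using cancel S c' c_less by simp
  qed
  \<comment> \<open>Between the row of \<tau> c and a middle column the weight also drops by one. By
    \<open>split\<close> this entry is controlled by the entries of column c, so no further
    condition arises.\<close>
  have row: "x $$ (?c', j) \<in> level (m + 1)" if j: "j < n" "j \<noteq> ?c'" for j
  proof (rule cancel[OF S[OF c'(1) j(1)]])
    let ?r = "\<Sum>l\<in>{..<n} - {c} - {?c'}. x $$ (l, c) * \<epsilon> l * x $$ (\<tau> l, j)"
    have "?r \<in> level (m + 1)"
      using mid S sign_closed \<tau>_less j by (intro level_sum level_mult_right) auto
    moreover have "x $$ (?c', c) * \<epsilon> ?c' * x $$ (c, j) \<in> level (m + 1)"
      using level_antimono[OF opp, of "m + 1"] S sign_closed c' c_less j by (intro level_mult_right) auto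
    ultimately have "- (x $$ (?c', c) * \<epsilon> ?c' * x $$ (c, j) + ?r) \<in> level (m + 1)" by auto
    moreover have "x $$ (c, c) * (\<epsilon> c * x $$ (?c', j)) = - (x $$ (?c', c) * \<epsilon> ?c' * x $$ (c, j) + ?r)"
      using split[OF j] by (simp only: eq_neg_iff_add_eq_0 add.assoc)
    ultimately show "x $$ (c, c) * (\<epsilon> c * x $$ (?c', j)) \<in> level (m + 1)" by simp
  qed
  show ?thesis
  proof (rule cj_H[OF x])
    fix i j assume ij: "i < n" "j < n" "i \<noteq> j" and w: "wt j < wt i"
    show "x $$ (i, j) \<in> level (m + (wt i - wt j))"
    proof (cases "j = c")
      case True
      then show ?thesis using opp mid[OF ij(1)] ij c' by (cases "i = ?c'") (auto simp: wt_def)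
    next
      case False
      then have "i = ?c'" "j \<noteq> ?c'" "wt i - wt j = 1" using w c' by (auto simp: wt_def split: if_splits)
      then show ?thesis using row[OF ij(2)] by simp
    qed
  qed
qed

subsection \<open>The bilinear form\<close>

definition B :: "(nat \<Rightarrow> 'a) \<Rightarrow> (nat \<Rightarrow> 'a) \<Rightarrow> 'a" where
  "B v w = (\<Sum>l<n. v l * \<epsilon> l * w (\<tau> l))"

abbreviation e :: "nat \<Rightarrow> nat \<Rightarrow> 'a" where "e j \<equiv> (\<lambda>i. delta i j)"

lemma B_left: "B (\<lambda>i. v i + a * u i) w = B v w + a * B u w"
  by (simp add: B_def algebra_simps sum.distrib sum_distrib_left)

lemma B_right: "B w (\<lambda>i. v i + a * u i) = B w v + a * B w u"
  by (simp add: B_def algebra_simps sum.distrib sum_distrib_left)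

lemma B_cong: "(\<And>i. i < n \<Longrightarrow> v i = v' i) \<Longrightarrow> (\<And>i. i < n \<Longrightarrow> w i = w' i) \<Longrightarrow> B v w = B v' w'"
  by (simp add: B_def \<tau>_less)

lemma B_e: "j < n \<Longrightarrow> B (e j) w = \<epsilon> j * w (\<tau> j)"
  by (simp add: B_def mult.assoc)

lemma bij_\<tau>: "bij_betw \<tau> {..<n} {..<n}"
  by (rule bij_betwI[where g = \<tau>]) (auto simp: \<tau>_less \<tau>_\<tau>)

lemma B_swap: "B v w = (if b then 1 else - 1) * B w v"
proof -
  have "B v w = (\<Sum>l<n. v (\<tau> l) * \<epsilon> (\<tau> l) * w (\<tau> (\<tau> l)))"
    unfolding B_def by (rule sum.reindex_bij_betw[OF bij_\<tau>, symmetric])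
  also have "\<dots> = (\<Sum>l<n. (if b then 1 else - 1) * (w l * \<epsilon> l * v (\<tau> l)))"
    by (rule sum.cong) (auto simp: \<tau>_\<tau> sign_\<tau>)
  finally show ?thesis unfolding B_def by (simp add: sum_distrib_left)
qed

lemma B_app:
  assumes x: "x \<in> H m"
  shows "B (app x v) (app x w) = B v w"
proof -
  have "B (app x v) (app x w)
      = (\<Sum>l<n. \<Sum>i<n. \<Sum>j<n. v i * w j * (x $$ (l, i) * \<epsilon> l * x $$ (\<tau> l, j)))"
    unfolding B_def
  proof (rule sum.cong)
    fix l
    have "app x v l * \<epsilon> l * app x w (\<tau> l) = \<epsilon> l * (app x v l * app x w (\<tau> l))" by simp
    also have "\<dots> = \<epsilon> l * (\<Sum>i<n. \<Sum>j<n. (x $$ (l, i) * v i) * (x $$ (\<tau> l, j) * w j))"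
      unfolding app_def sum_product ..
    also have "\<dots> = (\<Sum>i<n. \<Sum>j<n. v i * w j * (x $$ (l, i) * \<epsilon> l * x $$ (\<tau> l, j)))"
      by (simp add: sum_distrib_left mult_ac)
    finally show "app x v l * \<epsilon> l * app x w (\<tau> l)
      = (\<Sum>i<n. \<Sum>j<n. v i * w j * (x $$ (l, i) * \<epsilon> l * x $$ (\<tau> l, j)))" .
  qed simp
  also have "\<dots> = (\<Sum>i<n. \<Sum>j<n. \<Sum>l<n. v i * w j * (x $$ (l, i) * \<epsilon> l * x $$ (\<tau> l, j)))"
    by (subst sum.swap) (intro sum.cong refl sum.swap)
  also have "\<dots> = (\<Sum>i<n. \<Sum>j<n. v i * w j * (if j = \<tau> i then \<epsilon> i else 0))"
    using H_form[OF x] by (intro sum.cong refl) (simp flip: sum_distrib_left)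
  also have "\<dots> = (\<Sum>i<n. \<Sum>j<n. if j = \<tau> i then v i * \<epsilon> i * w j else 0)"
    by (intro sum.cong refl) auto
  also have "\<dots> = B v w" unfolding B_def by (intro sum.cong refl) (simp add: \<tau>_less)
  finally show ?thesis .
qed

lemma isometry_matrix:
  assumes "\<And>i j. i < n \<Longrightarrow> j < n \<Longrightarrow> B (f (e i)) (f (e j)) = B (e i) (e j)"
  shows "transpose_mat (mat n n (\<lambda>(i, j). f (e j) i)) * gram * mat n n (\<lambda>(i, j). f (e j) i) = gram"
proof -
  let ?x = "mat n n (\<lambda>(i, j). f (e j) i)"
  have "(\<Sum>l<n. ?x $$ (l, i) * \<epsilon> l * ?x $$ (\<tau> l, j)) = (if j = \<tau> i then \<epsilon> i else 0)"
    if ij: "i < n" "j < n" for i j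
  proof -
    have "(\<Sum>l<n. ?x $$ (l, i) * \<epsilon> l * ?x $$ (\<tau> l, j)) = B (f (e i)) (f (e j))"
      unfolding B_def using ij \<tau>_less by (intro sum.cong) auto
    also have "\<dots> = \<epsilon> i * delta (\<tau> i) j" using assms[OF ij] B_e[OF ij(1)] by simp
    finally show ?thesis by (auto simp: delta_def)
  qed
  then show ?thesis by (subst form_iff) auto
qed

text \<open>The symplectic transvection w + t B(w, u) u preserves B because B is alternating. It
  displaces e_c along u, with B(e_c, u) = \<open>\<epsilon> c * u (\<tau> c)\<close>.\<close>

lemma transvection:
  assumes "\<not> b" and u: "\<And>i. i < n \<Longrightarrow> u i \<in> S" and t: "t \<in> level m"
  shows "\<exists>y\<in>H m. \<forall>i<n. y $$ (i, c) = delta i c + t * (\<epsilon> c * u (\<tau> c)) * u i"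
proof -
  define f where "f w = (\<lambda>i. w i + (t * B w u) * u i)" for w
  let ?y = "mat n n (\<lambda>(i, j). f (e j) i)"
  have sw: "B v w = - B w v" for v w using B_swap[of v w] \<open>\<not> b\<close> by simp
  have "2 * B u u = 0" using sw[of u u] by simp
  then have uu: "B u u = 0" using two_nonzero[OF odd] by simp
  have "B (f v) (f w) = B v w" for v w
    unfolding f_def B_left B_right uu using sw[of u w] by (simp add: algebra_simps)
  then have form: "transpose_mat ?y * gram * ?y = gram" by (intro isometry_matrix)
  have entry: "?y $$ (i, j) = delta i j + t * (\<epsilon> j * u (\<tau> j)) * u i" if "i < n" "j < n" for i j
    using that B_e[OF that(2)] by (simp add: f_def)
  have l: "t * (\<epsilon> j * u (\<tau> j)) * u i \<in> level m" if "i < n" "j < n" for i j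
    using t u that sign_closed \<tau>_less by (intro level_mult_right mult_closed) auto
  have "?y $$ (i, j) \<in> S \<and> ?y $$ (i, j) - delta i j \<in> level m" if "i < n" "j < n" for i j
    unfolding entry[OF that] using l[OF that] subsetD[OF level_subset l[OF that]] by simp
  moreover have "?y \<in> isom" unfolding isom_def using form \<open>\<not> b\<close> by simp
  ultimately have "?y \<in> H m" unfolding H_def by blast
  then show ?thesis using entry c_less by blast
qed

text \<open>The square of a Siegel transformation: squaring makes the determinant trivially one.\<close>

lemma siegel:
  assumes b and v: "\<And>i. i < n \<Longrightarrow> v i \<in> level m" "v c = 0" "v (\<tau> c) = 0"
  shows "\<exists>y\<in>H m. \<forall>i<n. y $$ (i, c) = delta i c + 4 * v i + - (8 * B v v) * delta i (\<tau> c)"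
proof -
  let ?u = "e (\<tau> c)"
  \<comment> \<open>The Siegel transformation for the isotropic vector e_(\<tau> c) and the vector 2
    v orthogonal to it; the factor 2 absorbs the usual 1/2 in the quadratic term.\<close>
  define f where "f w = (\<lambda>i. (w i + (2 * B w ?u) * v i) + - (2 * B w v + 2 * B v v * B w ?u) * ?u i)" for w
  let ?x = "mat n n (\<lambda>(i, j). f (e j) i)"
  have c': "\<tau> c < n" "\<tau> (\<tau> c) = c" using \<tau>_less[OF c_less] \<tau>_\<tau>[OF c_less] by auto
  have sw: "B y w = B w y" for y w using B_swap[of y w] \<open>b\<close> by simp
  have uu: "B ?u ?u = 0" "B ?u v = 0" "B v ?u = 0"
    using B_e[OF c'(1)] sw[of v ?u] v c' \<tau>_c by (auto simp: delta_def)
  have "B (f y) (f w) = B y w" for y w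
    unfolding f_def B_left B_right uu using sw[of v w] sw[of ?u w] by (simp add: algebra_simps)
  then have form: "transpose_mat ?x * gram * ?x = gram" by (intro isometry_matrix)
  have xc: "?x \<in> carrier_mat n n" by simp
  have lin: "(\<Sum>j<n. ?x $$ (i, j) * w j) = f w i" if i: "i < n" for w i
  proof -
    have L: "(\<Sum>j<n. ?x $$ (i, j) * w j) = (\<Sum>j<n. delta i j * w j)
        + 2 * (\<Sum>j<n. w j * \<epsilon> j * ?u (\<tau> j)) * v i
        - (2 * (\<Sum>j<n. w j * \<epsilon> j * v (\<tau> j)) + 2 * B v v * (\<Sum>j<n. w j * \<epsilon> j * ?u (\<tau> j))) * ?u i"
      using i by (simp add: f_def B_e algebra_simps sum.distrib sum_subtractf sum_distrib_left sum_distrib_right)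
    show ?thesis by (subst L) (use i in \<open>simp add: f_def B_def algebra_simps\<close>)
  qed
  let ?y = "?x * ?x"
  \<comment> \<open>Siegel transformations with the same isotropic vector compose by adding
    parameters, so the square belongs to 4 v, with quadratic coefficient 16/2 = 8.\<close>
  have "f (f w) i = w i + (4 * B w ?u) * v i + - (4 * B w v + 8 * B v v * B w ?u) * ?u i" for w i
  proof -
    have "B (f w) ?u = B w ?u" "B (f w) v = B w v + 2 * B v v * B w ?u"
      by (simp_all add: f_def B_left uu del: mult_minus_left)
    then show ?thesis unfolding f_def[of "f w"] by (simp add: f_def algebra_simps)
  qed
  moreover have "?y $$ (i, j) = f (f (e j)) i" if ij: "i < n" "j < n" for i j
    using mat_mult_entry[OF xc xc ij] lin[OF ij(1), of "f (e j)"] ij by simp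
  ultimately have entry: "?y $$ (i, j) = delta i j + ((4 * (\<epsilon> j * ?u (\<tau> j))) * v i
      + - (4 * (\<epsilon> j * v (\<tau> j)) + 8 * B v v * (\<epsilon> j * ?u (\<tau> j))) * ?u i)" if "i < n" "j < n" for i j
    using that B_e[OF that(2)] by (simp add: add.assoc)
  have vS: "v i \<in> S" if "i < n" for i using subsetD[OF level_subset v(1)[OF that]] .
  have vv: "B v v \<in> level m"
    unfolding B_def using v(1) vS sign_closed \<tau>_less by (intro level_sum level_mult_right) auto
  have l: "(4 * (\<epsilon> j * ?u (\<tau> j))) * v i
      + - (4 * (\<epsilon> j * v (\<tau> j)) + 8 * B v v * (\<epsilon> j * ?u (\<tau> j))) * ?u i \<in> level m" if ij: "i < n" "j < n" for i j
  proof (intro level_add)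
    show "(4 * (\<epsilon> j * ?u (\<tau> j))) * v i \<in> level m"
      using v(1)[OF ij(1)] sign_closed[OF ij(2)] by (intro level_mult_left mult_closed) auto
    have P: "4 * (\<epsilon> j * v (\<tau> j)) \<in> level m"
      using v(1) sign_closed ij \<tau>_less by (intro level_mult_left) auto
    have Q: "8 * B v v * (\<epsilon> j * ?u (\<tau> j)) \<in> level m"
      using vv sign_closed[OF ij(2)] by (intro level_mult_right level_mult_left mult_closed) auto
    show "- (4 * (\<epsilon> j * v (\<tau> j)) + 8 * B v v * (\<epsilon> j * ?u (\<tau> j))) * ?u i \<in> level m"
      by (rule level_mult_right[OF _ level_uminus[OF level_add[OF P Q]]]) simp
  qed
  have "?y $$ (i, j) \<in> S \<and> ?y $$ (i, j) - delta i j \<in> level m" if "i < n" "j < n" for i j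
    unfolding entry[OF that] using l[OF that] subsetD[OF level_subset l[OF that]] by simp
  moreover have "?y \<in> isom"
  proof -
    \<comment> \<open>The form is nondegenerate, so the determinant of an isometry has square
      1.\<close>
    have "det gram \<noteq> 0"
      using det_mult[of "transpose_mat gram" n gram] by (auto simp: gram_transpose)
    moreover have "det (transpose_mat ?x * gram * ?x) = det ?x * det gram * det ?x"
      using xc by (simp add: det_mult[of _ n] det_transpose[of _ n] mult_carrier_mat[of _ n n])
    ultimately have "det ?x * det ?x = 1" unfolding form by simp
    then have "det ?y = 1" using det_mult[OF xc xc] by simp
    moreover have "transpose_mat ?y * gram * ?y = gram" using transport_mult[OF xc xc] form by simp
    ultimately show ?thesis unfolding isom_def using mult_carrier_mat[OF xc xc] by blast
  qed
  ultimately have "?y \<in> H m" unfolding H_def by blast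
  moreover have "?y $$ (i, c) = delta i c + 4 * v i + - (8 * B v v) * delta i (\<tau> c)" if "i < n" for i
    using entry[OF that c_less] v sign_orth[OF \<open>b\<close> c_less] by (simp add: delta_def)
  ultimately show ?thesis by blast
qed

subsection \<open>Rigidity\<close>

lemma eq_one_if_fixes:
  assumes x: "x \<in> H m" and "\<And>i j. i < n \<Longrightarrow> j < n \<Longrightarrow> app x (e j) i = delta i j"
  shows "x = 1\<^sub>m n"
proof (rule eq_matI)
  fix i j assume "i < dim_row (1\<^sub>m n :: 'a mat)" "j < dim_col (1\<^sub>m n :: 'a mat)"
  then have "i < n" "j < n" by simp_all
  then show "x $$ (i, j) = 1\<^sub>m n $$ (i, j)"
    using assms(2)[of i j] app_delta[of j x i] by (simp add: delta_def)
qed (use carrier_matD[OF H_carrier[OF x]] in simp_all)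

lemma rigid_first:
  assumes x: "x \<in> H m" and hyp: "rigid_hyp m x"
  obtains \<alpha> where "\<alpha> \<in> S" "\<alpha> - 1 \<in> level 1" "\<And>i. i < n \<Longrightarrow> app x (e c) i = \<alpha> * e c i"
  using rigid_hypE[OF hyp x H_one, of "e c"] c_less by (auto simp: delta_def)

lemma square_eq_one:
  assumes "\<mu> \<in> S" "\<mu> - 1 \<in> level 1" "\<mu> * \<mu> = 1"
  shows "\<mu> = 1"
  using root_of_unity[OF odd assms(1,2)] assms(3) by (simp add: power2_eq_square)

text \<open>For each u with coordinate 1 at \<tau> c, the transvections with parameters \<pi>^m and
  -\<pi>^m make u an eigenvector for \<alpha>. These vectors and e_c span, so x is scalar;
  invariance of B(e_c, e_(\<tau> c)) gives \<alpha>^2 = 1.\<close>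

lemma rigid_symplectic:
  assumes nb: "\<not> b" and x: "x \<in> H m" and hyp: "rigid_hyp m x"
  shows "x = 1\<^sub>m n"
proof -
  obtain \<alpha> where \<alpha>: "\<alpha> \<in> S" "\<alpha> - 1 \<in> level 1" "\<And>i. i < n \<Longrightarrow> app x (e c) i = \<alpha> * e c i"
    using rigid_first[OF x hyp] by blast
  let ?c' = "\<tau> c"
  have c': "?c' < n" "?c' \<noteq> c" "\<tau> ?c' = c" using \<tau>_less[OF c_less] \<tau>_c \<tau>_\<tau>[OF c_less] by auto
  have eig: "app x u i = \<alpha> * u i"
    if u: "\<And>i. i < n \<Longrightarrow> u i \<in> S" "u ?c' = 1" and i: "i < n" for u i
  proof -
    obtain y where y: "y \<in> H m" "\<And>i. i < n \<Longrightarrow> y $$ (i, c) = delta i c + \<pi> ^ m * \<epsilon> c * u i"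
      using transvection[where u = u, OF nb u(1) power_level[of m]] u(2) by auto
    obtain \<mu> where \<mu>: "\<And>i. i < n \<Longrightarrow>
        app x (\<lambda>i. delta i c + \<pi> ^ m * \<epsilon> c * u i) i = \<mu> * (delta i c + \<pi> ^ m * \<epsilon> c * u i)"
      using rigid_hypE[OF hyp x y] by blast
    obtain z where z: "z \<in> H m" "\<And>i. i < n \<Longrightarrow> z $$ (i, c) = delta i c + - (\<pi> ^ m * \<epsilon> c) * u i"
      using transvection[where u = u, OF nb u(1) level_uminus[OF power_level[of m]]] u(2) by auto
    obtain \<nu> where \<nu>: "\<And>i. i < n \<Longrightarrow>
        app x (\<lambda>i. delta i c + - (\<pi> ^ m * \<epsilon> c) * u i) i = \<nu> * (delta i c + - (\<pi> ^ m * \<epsilon> c) * u i)"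
      using rigid_hypE[OF hyp x z] by blast
    show ?thesis
      by (rule eigenvector_of_pair[OF two_nonzero[OF odd] _ c'(1,2) _ \<alpha>(3) \<mu> \<nu> i])
        (use u(2) sign_nonzero[OF c_less] in auto)
  qed
  have e: "app x (e j) i = \<alpha> * delta i j" if ij: "i < n" "j < n" for i j
  proof (cases "j = c \<or> j = ?c'")
    case True
    then show ?thesis using \<alpha>(3)[OF ij(1)] eig[of "e ?c'" i] ij by (auto simp: delta_def)
  next
    case False
    \<comment> \<open>e_j has coordinate 0 at \<tau> c, so it is written as a difference of two
      vectors with coordinate 1 there.\<close>
    have "app x (\<lambda>i. delta i ?c' + 1 * delta i j) i = \<alpha> * (delta i ?c' + 1 * delta i j)"
      using False ij by (intro eig) (auto simp: delta_def)
    moreover have "app x (e ?c') i = \<alpha> * delta i ?c'"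
      using ij by (intro eig) (auto simp: delta_def)
    ultimately show ?thesis unfolding app_add by (simp add: algebra_simps)
  qed
  have "B (app x (e c)) (app x (e ?c')) = B (\<lambda>i. \<alpha> * e c i) (\<lambda>i. \<alpha> * e ?c' i)"
    using e c_less c' by (intro B_cong) auto
  moreover have "B (\<lambda>i. \<alpha> * e c i) (\<lambda>i. \<alpha> * e ?c' i) = \<alpha> * \<alpha> * B (e c) (e ?c')"
    by (simp add: B_def sum_distrib_left mult_ac)
  moreover have "B (e c) (e ?c') = \<epsilon> c" using B_e[OF c_less] by (simp add: delta_def)
  ultimately have "\<alpha> * \<alpha> * \<epsilon> c = \<epsilon> c" using B_app[OF x, of "e c" "e ?c'"] by simp
  then have "\<alpha> * \<alpha> = 1" using sign_nonzero[OF c_less] by simp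
  then have "\<alpha> = 1" using square_eq_one \<alpha> by simp
  then show ?thesis using e by (intro eq_one_if_fixes[OF x]) simp
qed

text \<open>For an anisotropic \<^term>\<open>v\<close> orthogonal to the hyperbolic plane, pairing the eigenvectors of
  \<open>siegel\<close> with the first basis vector determines their eigenvalues.\<close>

lemma rigid_anisotropic:
  assumes b and x: "x \<in> H m" and hyp: "rigid_hyp m x"
    and v: "\<And>i. i < n \<Longrightarrow> v i \<in> S" "v c = 0" "v (\<tau> c) = 0" "B v v \<noteq> 0" and i: "i < n"
  shows "app x v i = v i" "app x (e c) i = e c i" "app x (e (\<tau> c)) i = e (\<tau> c) i"
proof -
  let ?c' = "\<tau> c" and ?t = "\<pi> ^ m"
  have c': "?c' < n" "?c' \<noteq> c" "\<tau> ?c' = c" using \<tau>_less[OF c_less] \<tau>_c \<tau>_\<tau>[OF c_less] by auto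
  have two: "(2::'a) \<noteq> 0" using two_nonzero[OF odd] .
  have pow2: "(4::'a) \<noteq> 0" "(8::'a) \<noteq> 0"
  proof -
    have two_power: "coprime (2 ^ k) p" for k using odd by simp
    show "(4::'a) \<noteq> 0" "(8::'a) \<noteq> 0"
      using of_nat_nonzero[OF two_power[of 2]] of_nat_nonzero[OF two_power[of 3]] by simp_all
  qed
  obtain \<alpha> where \<alpha>: "\<alpha> \<in> S" "\<alpha> - 1 \<in> level 1" "\<And>i. i < n \<Longrightarrow> app x (e c) i = \<alpha> * e c i"
    using rigid_first[OF x hyp] by blast
  define d where "d = - (8 * (?t * ?t * B v v))"
  have d: "d \<noteq> 0" using pow2 v(4) by (simp add: d_def)
  \<comment> \<open>The image of e_c under the transformation of \<open>siegel\<close> for s v. Its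
    last coefficient depends on s through s^2, so d is common to s = \<pi>^m and s =
    -\<pi>^m.\<close>
  define W where "W s = (\<lambda>i. (delta i c + (4 * s) * v i) + d * e ?c' i)" for s
  have eig: "\<exists>\<mu>. \<mu> \<in> S \<and> \<mu> - 1 \<in> level 1 \<and> \<mu> * \<alpha> = 1 \<and> (\<forall>i<n. app x (W s) i = \<mu> * W s i)"
    if s: "s \<in> level m" "s * s = ?t * ?t" for s
  proof -
    have "B (\<lambda>i. s * v i) (\<lambda>i. s * v i) = ?t * ?t * B v v"
      unfolding s(2)[symmetric] by (simp add: B_def sum_distrib_left mult_ac)
    then obtain y where y: "y \<in> H m" "\<And>i. i < n \<Longrightarrow> y $$ (i, c) = W s i"
      using siegel[OF \<open>b\<close>, of "\<lambda>i. s * v i" m] v(1-3) s(1) by (auto simp: W_def d_def mult.assoc)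
    obtain \<mu> where \<mu>: "\<mu> \<in> S" "\<mu> - 1 \<in> level 1" "\<And>i. i < n \<Longrightarrow> app x (W s) i = \<mu> * W s i"
      using rigid_hypE[OF hyp x y] by blast
    \<comment> \<open>e_c pairs with W s to its coordinate d at \<tau> c, which is nonzero as v is
      anisotropic; invariance of B therefore gives \<mu> \<alpha> = 1 for both signs of s.\<close>
    have "B (app x (e c)) (app x (W s)) = B (\<lambda>i. \<alpha> * e c i) (\<lambda>i. \<mu> * W s i)"
      using \<alpha>(3) \<mu>(3) by (intro B_cong) auto
    moreover have "B (\<lambda>i. \<alpha> * e c i) (\<lambda>i. \<mu> * W s i) = \<mu> * \<alpha> * B (e c) (W s)"
      by (simp add: B_def sum_distrib_left mult_ac)
    moreover have "B (e c) (W s) = d"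
      using B_e[OF c_less] sign_orth[OF \<open>b\<close> c_less] v(3) c' by (simp add: W_def delta_def)
    ultimately have "\<mu> * \<alpha> * d = d" using B_app[OF x, of "e c" "W s"] by simp
    then have "\<mu> * \<alpha> = 1" using d by simp
    then show ?thesis using \<mu> by blast
  qed
  obtain \<mu> where \<mu>: "\<mu> \<in> S" "\<mu> - 1 \<in> level 1" "\<mu> * \<alpha> = 1" "\<And>i. i < n \<Longrightarrow> app x (W ?t) i = \<mu> * W ?t i"
    using eig[of ?t] by auto
  obtain \<nu> where \<nu>: "\<nu> * \<alpha> = 1" "\<And>i. i < n \<Longrightarrow> app x (W (- ?t)) i = \<nu> * W (- ?t) i"
    using eig[of "- ?t"] level_uminus[OF power_level] by auto
  have "\<mu> * \<alpha> = \<nu> * \<alpha>" using \<mu>(3) \<nu>(1) by simp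
  moreover have "\<alpha> \<noteq> 0" using \<nu>(1) by auto
  ultimately have "\<nu> = \<mu>" by simp
  have appW: "app x (W s) j = app x (e c) j + (4 * s) * app x v j + d * app x (e ?c') j" for s j
    by (simp only: W_def app_add)
  have xv: "app x v j = \<mu> * v j" if j: "j < n" for j
  proof -
    \<comment> \<open>The difference of the two eigenvectors is 8 \<pi>^m v, and their eigenvalues
      agree.\<close>
    have 1: "app x (W ?t) j - app x (W (- ?t)) j = 8 * ?t * app x v j" unfolding appW by (simp add: algebra_simps)
    have 2: "\<mu> * W ?t j - \<mu> * W (- ?t) j = 8 * ?t * (\<mu> * v j)" by (simp add: W_def algebra_simps)
    have "8 * ?t * app x v j = 8 * ?t * (\<mu> * v j)"
      by (simp only: 1[symmetric] 2[symmetric] \<mu>(4)[OF j] \<nu>(2)[OF j] \<open>\<nu> = \<mu>\<close>)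
    then show ?thesis using pow2 by simp
  qed
  \<comment> \<open>x preserves the nonzero value B(v, v), so \<mu>^2 = 1 and \<mu> = 1; then
    \<alpha> = 1 by \<mu> \<alpha> = 1.\<close>
  have "B (app x v) (app x v) = B (\<lambda>i. \<mu> * v i) (\<lambda>i. \<mu> * v i)" using xv by (intro B_cong) auto
  moreover have "B (\<lambda>i. \<mu> * v i) (\<lambda>i. \<mu> * v i) = \<mu> * \<mu> * B v v"
    by (simp add: B_def sum_distrib_left mult_ac)
  ultimately have "\<mu> * \<mu> * B v v = B v v" using B_app[OF x, of v v] by simp
  then have "\<mu> * \<mu> = 1" using v(4) by simp
  then have \<mu>1: "\<mu> = 1" using square_eq_one \<mu> by simp
  then have \<alpha>1: "\<alpha> = 1" using \<mu>(3) by simp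
  show xv1: "app x v i = v i" using xv[OF i] \<mu>1 by simp
  show xc1: "app x (e c) i = e c i" using \<alpha>(3)[OF i] \<alpha>1 by simp
  have "d * app x (e ?c') i = d * e ?c' i"
    using \<mu>(4)[OF i] xv1 xc1 unfolding appW \<mu>1 by (simp add: W_def)
  then show "app x (e ?c') i = e ?c' i" using d by simp
qed

text \<open>Anisotropic vectors span the complement of the hyperbolic plane: e_j + e_(\<tau> j) and
  e_j - e_(\<tau> j), of values 2 and -2, or e_j itself if \<tau> j = j. One such vector, supplied
  by \<open>rank\<close>, also settles e_c and e_(\<tau> c).\<close>

lemma rigid_orthogonal:
  assumes b and x: "x \<in> H m" and hyp: "rigid_hyp m x"
  shows "x = 1\<^sub>m n"
proof -
  let ?c' = "\<tau> c"
  have two: "(2::'a) \<noteq> 0" using two_nonzero[OF odd] .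
  have sw: "B y w = B w y" for y w using B_swap[of y w] \<open>b\<close> by simp
  have Be: "B (e i) (e j) = (if j = \<tau> i then 1 else 0)" if "i < n" for i j
    using B_e[OF that] sign_orth[OF \<open>b\<close> that] by (simp add: delta_def)
  define ok where "ok v \<longleftrightarrow> (\<forall>i<n. v i \<in> S) \<and> v c = 0 \<and> v ?c' = 0 \<and> B v v \<noteq> 0" for v
  have fix_ok: "app x v i = v i" "app x (e c) i = e c i" "app x (e ?c') i = e ?c' i"
    if "ok v" "i < n" for v i
    using rigid_anisotropic[OF \<open>b\<close> x hyp, of v i] that by (auto simp: ok_def)
  have pair: "ok (\<lambda>i. e j i + a * e (\<tau> j) i)" if "j < n" "j \<noteq> c" "j \<noteq> ?c'" "\<tau> j \<noteq> j" "a = 1 \<or> a = -1" for j a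
  proof -
    have "\<tau> j \<noteq> c" "\<tau> j \<noteq> ?c'" using that(1-3) \<tau>_\<tau>[of j] \<tau>_\<tau>[OF c_less] by auto
    moreover have "B (\<lambda>i. e j i + a * e (\<tau> j) i) (\<lambda>i. e j i + a * e (\<tau> j) i) = 2 * a"
      unfolding B_left B_right using Be that(1,4) \<tau>_less[of j] \<tau>_\<tau>[of j] by simp
    ultimately show ?thesis using that two by (auto simp: ok_def delta_def)
  qed
  have single: "ok (e j)" if "j < n" "j \<noteq> c" "j \<noteq> ?c'" "\<tau> j = j" for j
    using that Be[of j j] by (auto simp: ok_def delta_def)
  have mid: "app x (e j) i = e j i" if j: "j < n" "j \<noteq> c" "j \<noteq> ?c'" and i: "i < n" for i j
  proof (cases "\<tau> j = j")
    case True
    then show ?thesis using fix_ok(1)[OF single i] j by blast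
  next
    case False
    have "app x (e j) i + 1 * app x (e (\<tau> j)) i = e j i + 1 * e (\<tau> j) i"
      using fix_ok(1)[OF pair[OF j False, of 1] i] unfolding app_add by simp
    moreover have "app x (e j) i + - 1 * app x (e (\<tau> j)) i = e j i + - 1 * e (\<tau> j) i"
      using fix_ok(1)[OF pair[OF j False, of "- 1"] i] unfolding app_add by simp
    ultimately have "(app x (e j) i + 1 * app x (e (\<tau> j)) i) + (app x (e j) i + - 1 * app x (e (\<tau> j)) i)
        = (e j i + 1 * e (\<tau> j) i) + (e j i + - 1 * e (\<tau> j) i)" by (simp only:)
    then have "2 * app x (e j) i = 2 * e j i" by (simp add: algebra_simps)
    then show ?thesis using two by simp
  qed
  obtain j where j: "j < n" "j \<noteq> c" "j \<noteq> ?c'" using rank[OF \<open>b\<close>] by blast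
  then obtain v where v: "ok v" using single[OF j] pair[OF j, of 1] by blast
  show ?thesis
  proof (rule eq_one_if_fixes[OF x])
    fix i j assume ij: "i < n" "j < n"
    show "app x (e j) i = delta i j"
      using mid[OF ij(2) _ _ ij(1)] fix_ok(2,3)[OF v ij(1)] by (cases "j = c"; cases "j = ?c'") auto
  qed
qed

lemma rigid: "x \<in> H m \<Longrightarrow> rigid_hyp m x \<Longrightarrow> x = 1\<^sub>m n"
  using rigid_symplectic rigid_orthogonal by blast

text \<open>Weight 2 at \<tau> c calls for the symplectic column modulo \<pi>^2. For orthogonal
  groups isotropy controls that entry, so the column modulo \<pi> is enough.\<close>

theorem form_index_le:
  assumes "real q ^ ((if b then 1 else 2) * n) \<le> B'"
  shows "self_similarity_index_le (G 0) B'"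
proof (rule integral_points_index_le[where w = "if b then 1 else 2"])
  fix x assume x: "x \<in> H 0"
    and col: "\<And>i. i < n \<Longrightarrow> x $$ (i, c) - delta i c \<in> level (if b then 1 else 2)"
  show "cj x \<in> H 0"
  proof (rule cj_H_first_column[OF x])
    show "x $$ (c, c) - 1 \<in> level 1"
      using level_antimono[OF col[OF c_less], of 1] by (simp add: delta_def)
    fix i assume i: "i < n" "i \<noteq> c"
    show "x $$ (i, c) \<in> level (max 1 (0 + red_wt i))"
      using level_antimono[OF col[OF i(1)], of "max 1 (0 + red_wt i)"] i(2)
      by (auto simp: delta_def red_wt_def wt_def split: if_splits)
  qed
qed (use assms rigid in \<open>auto simp: rigid_hyp_def\<close>)

theorem form_congruence_index_le:
  assumes m: "1 \<le> m" and B': "real q ^ (if b then n - 2 else n) \<le> B'"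
  shows "self_similarity_index_le (G m) B'"
proof (rule congruence_subgroup_index_le[where h = red_wt, OF m])
  fix x assume x: "x \<in> H m"
    and col: "\<And>i. i < n \<Longrightarrow> i \<noteq> c \<Longrightarrow> x $$ (i, c) \<in> level (m + red_wt i)"
  show "cj x \<in> H m"
  proof (rule cj_H_first_column[OF x])
    show "x $$ (c, c) - 1 \<in> level 1"
      using level_antimono[OF H_entry(2)[OF x c_less c_less] m] by (simp add: delta_def)
    show "x $$ (i, c) \<in> level (max 1 (m + red_wt i))" if "i < n" "i \<noteq> c" for i
      using col[OF that] m by (simp add: max_def)
  qed
next
  have c': "\<tau> c \<in> {..<n} - {c}" using \<tau>_less[OF c_less] \<tau>_c by simp
  \<comment> \<open>Each of the n - 2 middle indices contributes 1 to the exponent, and \<tau> c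
    contributes 2 in the symplectic and 0 in the orthogonal case.\<close>
  have "(\<Sum>i\<in>{..<n} - {c}. red_wt i) = red_wt (\<tau> c) + (\<Sum>i\<in>{..<n} - {c} - {\<tau> c}. red_wt i)"
    using c' by (intro sum.remove) auto
  also have "(\<Sum>i\<in>{..<n} - {c} - {\<tau> c}. red_wt i) = (\<Sum>i\<in>{..<n} - {c} - {\<tau> c}. 1)"
    by (rule sum.cong) (auto simp: red_wt_def wt_def)
  also have "\<dots> = n - 2" using c' c_less by (simp add: card_Diff_singleton)
  finally have "(\<Sum>i\<in>{..<n} - {c}. red_wt i) = (if b then n - 2 else n)"
    using c' c_less \<tau>_c by (auto simp: red_wt_def wt_def)
  then show "real q ^ (\<Sum>i\<in>{..<n} - {c}. red_wt i) \<le> B'" using B' by simp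
next
  fix i j assume "i < n" "j < n" "j \<noteq> c"
  then show "red_wt i \<le> Suc (red_wt j)" by (auto simp: red_wt_def wt_def)
qed (use rigid in \<open>auto simp: rigid_hyp_def red_wt_def wt_def\<close>)

end

section \<open>Translation to the matrix groups of the statement\<close>

lemma (in uniformized_ring) residue_eq_iff:
  fixes R :: "'a ring"
  assumes R: "carrier R = S" "\<And>a b. a \<otimes>\<^bsub>R\<^esub> b = a * b" "\<And>a b. a \<oplus>\<^bsub>R\<^esub> b = a + b"
  shows "residue R (\<pi> ^ m) x = residue R (\<pi> ^ m) y \<longleftrightarrow> x - y \<in> level m"
proof -
  have res: "residue R (\<pi> ^ m) z = (\<lambda>a. a + z) ` level m" for z
    by (auto simp: cgenideal_def a_r_coset_def' R level_def mult.commute)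
  show ?thesis
    unfolding res
  proof
    assume eq: "(\<lambda>a. a + x) ` level m = (\<lambda>a. a + y) ` level m"
    have "0 + x \<in> (\<lambda>a. a + y) ` level m" unfolding eq[symmetric] by blast
    then show "x - y \<in> level m" by auto
  next
    assume xy: "x - y \<in> level m"
    have sub: "(\<lambda>a. a + v) ` level m \<subseteq> (\<lambda>a. a + w) ` level m" if vw: "v - w \<in> level m" for v w
    proof (rule image_subsetI)
      fix a assume "a \<in> level m"
      then show "a + v \<in> (\<lambda>a. a + w) ` level m"
        using level_add[OF _ vw] by (intro image_eqI[of _ _ "a + (v - w)"]) simp_all
    qed
    have "y - x \<in> level m" using level_uminus[OF xy] by simp
    then show "(\<lambda>a. a + x) ` level m = (\<lambda>a. a + y) ` level m" using sub xy by blast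
  qed
qed

lemma elements_mat_eq:
  assumes x: "x \<in> carrier_mat n k"
  shows "elements_mat x = {x $$ (i, j) | i j. i < n \<and> j < k}"
proof (intro equalityI subsetI)
  fix a assume "a \<in> elements_mat x"
  then obtain i j where "i < dim_row x" "j < dim_col x" "a = x $$ (i, j)" using elements_matD by blast
  then show "a \<in> {x $$ (i, j) | i j. i < n \<and> j < k}" unfolding carrier_matD[OF x] by blast
next
  fix a assume "a \<in> {x $$ (i, j) | i j. i < n \<and> j < k}"
  then obtain i j where "i < n" "j < k" "a = x $$ (i, j)" by blast
  then show "a \<in> elements_mat x" by (rule elements_matI[OF x])
qed

text \<open>Connects the definitions by integral entries and reduced matrices with the levels used
  above: equal residues modulo \<pi>^m mean a difference in \<open>level m\<close>.\<close>

lemma (in weighted_group) mat_groups: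
  fixes R :: "'a ring"
  assumes R: "carrier R = S" "\<And>a b. a \<otimes>\<^bsub>R\<^esub> b = a * b" "\<And>a b. a \<oplus>\<^bsub>R\<^esub> b = a + b"
    and A: "A = {x \<in> carrier_mat n n. P x}"
  shows "mat_group n {x \<in> square_mats R n. P x} = G 0"
    and "congruence_kernel R (\<pi> ^ m) (mat_group n {x \<in> square_mats R n. P x}) = G m"
proof -
  have sq: "x \<in> square_mats R n \<longleftrightarrow> x \<in> carrier_mat n n \<and> (\<forall>i<n. \<forall>j<n. x $$ (i, j) \<in> S)" for x
  proof (cases "x \<in> carrier_mat n n")
    case True
    show ?thesis unfolding square_mats_def mem_Collect_eq R(1) elements_mat_eq[OF True] subset_iff
      using True by metis
  qed (simp add: square_mats_def)
  have A_iff: "x \<in> A \<longleftrightarrow> x \<in> carrier_mat n n \<and> P x" for x by (simp add: A)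
  have H_iff: "x \<in> H m \<longleftrightarrow> x \<in> H 0 \<and> (\<forall>i<n. \<forall>j<n. x $$ (i, j) - delta i j \<in> level m)" for x m
    unfolding H_def mem_Collect_eq level_0 using diff_closed[OF _ delta_closed] by meson
  have H_0: "x \<in> {x \<in> square_mats R n. P x} \<longleftrightarrow> x \<in> H 0" for x
    unfolding H_def A_iff mem_Collect_eq sq level_0 using diff_closed[OF _ delta_closed] by meson
  have "{x \<in> square_mats R n. P x} = H 0" by (rule Set.set_eqI) (rule H_0)
  then show 0: "mat_group n {x \<in> square_mats R n. P x} = G 0" by simp
  have "map_mat (residue R (\<pi> ^ m)) x = map_mat (residue R (\<pi> ^ m)) (1\<^sub>m n) \<longleftrightarrow>
      (\<forall>i<n. \<forall>j<n. x $$ (i, j) - delta i j \<in> level m)" if "x \<in> carrier_mat n n" for x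
    using that residue_eq_iff[OF R, of m] by (auto simp: mat_eq_iff delta_def)
  then have H_m: "x \<in> {x \<in> H 0. map_mat (residue R (\<pi> ^ m)) x = map_mat (residue R (\<pi> ^ m)) (1\<^sub>m n)}
      \<longleftrightarrow> x \<in> H m" for x
    unfolding mem_Collect_eq H_iff[of x m] using H_carrier[of x 0] by meson
  have "{x \<in> H 0. map_mat (residue R (\<pi> ^ m)) x = map_mat (residue R (\<pi> ^ m)) (1\<^sub>m n)} = H m"
    by (rule Set.set_eqI) (rule H_m)
  then show "congruence_kernel R (\<pi> ^ m) (mat_group n {x \<in> square_mats R n. P x}) = G m"
    unfolding 0 by (simp add: congruence_kernel_def mat_group_def)
qed

section \<open>Numerical estimates and entries of the orthogonal forms\<close>

lemma half_le_prod:
  fixes Q :: real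
  assumes "2 \<le> Q"
  shows "1 / 2 \<le> (\<Prod>i = 1..l. 1 - 1 / Q ^ (i + 1))"
proof -
  \<comment> \<open>The extra term, called h below, strengthens the induction hypothesis; the
    inductive step then amounts to h^2 / 2 <= h / 4, that is h <= 1/2.\<close>
  have "1 / 2 + 1 / 2 ^ (l + 1) \<le> (\<Prod>i = 1..l. 1 - 1 / Q ^ (i + 1))"
  proof (induction l)
    case (Suc l)
    define h :: real where "h = 1 / 2 ^ (l + 1)"
    have h: "0 \<le> h" "h \<le> 1 / 2" by (auto simp: h_def field_simps)
    have "1 / Q ^ (l + 2) \<le> 1 / 2 ^ (l + 2)"
      using assms by (intro divide_left_mono power_mono mult_pos_pos) auto
    then have "1 - h / 2 \<le> 1 - 1 / Q ^ (Suc l + 1)" by (simp add: h_def field_simps)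
    then have "(1 / 2 + h) * (1 - h / 2) \<le> (\<Prod>i = 1..l. 1 - 1 / Q ^ (i + 1)) * (1 - 1 / Q ^ (Suc l + 1))"
      using Suc h unfolding h_def[symmetric] by (intro mult_mono) auto
    moreover have "1 / 2 + h / 2 \<le> (1 / 2 + h) * (1 - h / 2)"
      using h mult_right_mono[OF h(2,1)] by (simp add: algebra_simps)
    ultimately show ?case by (simp add: h_def)
  qed simp
  moreover have "(0::real) \<le> 1 / 2 ^ (l + 1)" by simp
  ultimately show ?thesis by linarith
qed

text \<open>i + 1 <= 2 i for i >= 1, so each factor dominates the corresponding one of
  \<open>half_le_prod\<close>.\<close>

lemma half_le_prod_even:
  fixes Q :: real
  assumes "2 \<le> Q"
  shows "1 / 2 \<le> (\<Prod>i = 1..l. 1 - 1 / Q ^ (2 * i))"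
proof -
  have "(\<Prod>i = 1..l. 1 - 1 / Q ^ (i + 1)) \<le> (\<Prod>i = 1..l. 1 - 1 / Q ^ (2 * i))"
  proof (rule prod_mono)
    fix i assume "i \<in> {1..l}"
    then have "Q ^ (i + 1) \<le> Q ^ (2 * i)" using assms by (intro power_increasing) auto
    then have "1 / Q ^ (2 * i) \<le> 1 / Q ^ (i + 1)" using assms by (intro divide_left_mono mult_pos_pos) auto
    moreover have "1 / Q ^ (i + 1) \<le> 1" using assms one_le_power[of Q "i + 1"] by simp
    ultimately show "0 \<le> 1 - 1 / Q ^ (i + 1) \<and> 1 - 1 / Q ^ (i + 1) \<le> 1 - 1 / Q ^ (2 * i)" by simp
  qed
  then show ?thesis using half_le_prod[OF assms, of l] by linarith
qed

text \<open>A loss by the factor 2^r is paid for by r further powers of Q.\<close>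

lemma power_le_scaled_power:
  fixes Q P :: real
  assumes "2 \<le> Q" "1 / 2 ^ r \<le> P" "M + r \<le> N"
  shows "Q ^ M \<le> Q ^ N * P"
proof -
  have "Q ^ M * 2 ^ r \<le> Q ^ M * Q ^ r" using assms(1) by (intro mult_left_mono power_mono) auto
  also have "\<dots> \<le> Q ^ N" using assms(1,3) by (simp flip: power_add)
  finally have "Q ^ M \<le> Q ^ N * (1 / 2 ^ r)" by (simp add: field_simps)
  also have "\<dots> \<le> Q ^ N * P" using assms(1,2) by (intro mult_left_mono) auto
  finally show ?thesis .
qed

lemma less_prime_imp_coprime:
  fixes k p :: nat
  assumes "Factorial_Ring.prime p" "0 < k" "k < p"
  shows "coprime k p"
  using assms by (metis coprime_commute dvd_imp_le not_le prime_imp_coprime)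

lemma even_orthogonal_form_carrier: "even_orthogonal_form l \<in> carrier_mat (2 * l) (2 * l)"
  unfolding even_orthogonal_form_def carrier_mat_def by simp

lemma even_orthogonal_form_entry:
  assumes "i < 2 * l" "j < 2 * l"
  shows "even_orthogonal_form l $$ (i, j) = (if j = (if i < l then i + l else i - l) then 1 else 0)"
  using assms unfolding even_orthogonal_form_def by (cases "i < l"; cases "j < l") auto

lemma odd_orthogonal_form_entry:
  assumes ij: "i < 2 * l + 1" "j < 2 * l + 1"
  shows "orthogonal_form (2 * l + 1) $$ (i, j)
    = (if j = (if i = 0 then 0 else if i \<le> l then i + l else i - l) then 1 else 0)"
proof -
  note dim = carrier_matD[OF even_orthogonal_form_carrier[of l]]
  have form: "orthogonal_form (2 * l + 1)
      = four_block_mat (1\<^sub>m 1) (0\<^sub>m 1 (2 * l)) (0\<^sub>m (2 * l) 1) (even_orthogonal_form l)"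
    by (simp add: orthogonal_form_def)
  have entry: "orthogonal_form (2 * l + 1) $$ (i, j) =
      (if i < 1 then if j < 1 then 1\<^sub>m 1 $$ (i, j) else 0\<^sub>m 1 (2 * l) $$ (i, j - 1)
       else if j < 1 then 0\<^sub>m (2 * l) 1 $$ (i - 1, j) else even_orthogonal_form l $$ (i - 1, j - 1))"
    unfolding form using ij by (subst index_mat_four_block(1)) (simp_all add: dim)
  consider "i = 0" "j = 0" | "i = 0" "j \<noteq> 0" | "i \<noteq> 0" "j = 0" | "i \<noteq> 0" "j \<noteq> 0" by blast
  then show ?thesis
  proof cases
    case 4
    then have "orthogonal_form (2 * l + 1) $$ (i, j) = even_orthogonal_form l $$ (i - 1, j - 1)"
      using entry by simp
    also have "\<dots> = (if j - 1 = (if i - 1 < l then i - 1 + l else i - 1 - l) then 1 else 0)"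
      by (rule even_orthogonal_form_entry) (use 4 ij in auto)
    also have "j - 1 = (if i - 1 < l then i - 1 + l else i - 1 - l)
        \<longleftrightarrow> j = (if i = 0 then 0 else if i \<le> l then i + l else i - l)"
      using 4 ij by (cases "i \<le> l") auto
    finally show ?thesis .
  qed (use ij entry in auto)
qed

theorem corollary5:
  fixes p d e f q l m :: nat
    and \<iota> :: "(nat \<Rightarrow> rat) set \<Rightarrow> 'a::field"
    and R :: "'a ring" and \<pi> :: 'a
  assumes "Factorial_Ring.prime p"
    and "padic_extension p \<iota> d"
    and "R = integer_ring p \<iota>"
    and "uniformizer R \<pi>"
    and "has_ramification_index p R \<pi> e"
    and "has_inertia_degree p \<iota> R \<pi> f"
    and "q = p ^ f"
    and "l \<ge> 1" and "m \<ge> e"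
  shows "((l\<^sup>2 + 2 * l) * d \<le> p \<longrightarrow>
           self_similarity_index_le (SL R (l + 1))
             (real q ^ (l + (l\<^sup>2 + 2 * l) * e) * (\<Prod>i = 1..l. 1 - 1 / real q ^ (i + 1))) \<and>
           self_similarity_index_le (congruence_kernel R (\<pi> ^ m) (SL R (l + 1))) (real q ^ l))
       \<and> ((2 * l\<^sup>2 + l) * d \<le> p \<longrightarrow>
           self_similarity_index_le (Sp R (2 * l))
             (real q ^ (2 * l + (2 * l\<^sup>2 + l) * e) * (\<Prod>i = 1..l. 1 - 1 / real q ^ (2 * i))) \<and>
           self_similarity_index_le (congruence_kernel R (\<pi> ^ m) (Sp R (2 * l))) (real q ^ (2 * l)))
       \<and> (l \<ge> 2 \<and> (2 * l\<^sup>2 - l) * d \<le> p \<longrightarrow>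
           self_similarity_index_le (SO R (2 * l))
             (real q ^ (2 * l - 2 + (2 * l\<^sup>2 - l) * e) * (1 - 1 / real q ^ l)
                * (\<Prod>i = 1..l - 1. 1 - 1 / real q ^ (2 * i))) \<and>
           self_similarity_index_le (congruence_kernel R (\<pi> ^ m) (SO R (2 * l)))
             (real q ^ (2 * l - 2)))
       \<and> ((2 * l\<^sup>2 + l) * d \<le> p \<longrightarrow>
           self_similarity_index_le (SO R (2 * l + 1))
             (real q ^ (2 * l - 1 + (2 * l\<^sup>2 + l) * e) * (\<Prod>i = 1..l. 1 - 1 / real q ^ (2 * i))) \<and>
           self_similarity_index_le (congruence_kernel R (\<pi> ^ m) (SO R (2 * l + 1)))
             (real q ^ (2 * l - 1)))"
proof -
  note U = uniformized_integer_ring[OF assms(1-6)]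
  have e: "1 \<le> e" and d: "1 \<le> d" by (rule U)+
  have m: "1 \<le> m" using e assms(9) by simp
  interpret U: uniformized_ring "carrier R" \<pi> p q using U(1) assms(7) by simp
  have R: "carrier R = carrier R" "\<And>a b. a \<otimes>\<^bsub>R\<^esub> b = a * b" "\<And>a b. a \<oplus>\<^bsub>R\<^esub> b = a + b"
    by (simp_all add: assms(3) integer_ring_def ring_of_type_algebra_def)
  have q: "p \<le> q" by (rule U.residue_count_ge[OF assms(7)])
  have q2: "2 \<le> real q" using q prime_ge_2_nat[OF assms(1)] by linarith
  have l2: "l \<le> l\<^sup>2" by (simp add: power2_eq_square)
  have bound: "N \<le> p" if "N * d \<le> p" for N
    using le_trans[OF mult_le_mono2[OF d, of N] that] by simp
  have scale: "N \<le> N * e" for N using mult_le_mono2[OF e, of N] by simp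
  have odd: "coprime 2 p" if "3 \<le> p" using less_prime_imp_coprime[OF assms(1), of 2] that by simp
  let ?\<tau> = "\<lambda>i. if i < l then i + l else i - l" and ?\<tau>' = "\<lambda>i. if i = 0 then 0 else if i \<le> l then i + l else i - l"
  show ?thesis
  proof (intro conjI impI; (elim conjE)?)
    assume "(l\<^sup>2 + 2 * l) * d \<le> p"
    then have p: "l\<^sup>2 + 2 * l \<le> p" by (rule bound)
    \<comment> \<open>Here l + 1 < l^2 + 2 l <= p, so l + 1 is prime to p, and p >= 3 is
      odd.\<close>
    interpret special_linear "carrier R" \<pi> p q "l + 1"
      using p l2 assms(8) odd less_prime_imp_coprime[OF assms(1), of "l + 1"] by unfold_locales auto
    note groups = mat_groups[OF R, of "\<lambda>x. det x = 1", folded SL_def, OF refl]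
    \<comment> \<open>The column modulo \<pi> has l + 1 entries; one more power of q pays for the
      product, which is at least 1/2.\<close>
    have N: "l + 1 + 1 \<le> l + (l\<^sup>2 + 2 * l) * e" using scale[of "l\<^sup>2 + 2 * l"] l2 assms(8) by linarith
    show "self_similarity_index_le (SL R (l + 1))
        (real q ^ (l + (l\<^sup>2 + 2 * l) * e) * (\<Prod>i = 1..l. 1 - 1 / real q ^ (i + 1)))"
      unfolding groups(1)
      by (rule SL_index_le, rule power_le_scaled_power[OF q2, of 1])
        (use half_le_prod[OF q2, of l] N in auto)
    show "self_similarity_index_le (congruence_kernel R (\<pi> ^ m) (SL R (l + 1))) (real q ^ l)"
      unfolding groups(2) by (rule SL_congruence_index_le[OF m]) simp
  next
    assume "(2 * l\<^sup>2 + l) * d \<le> p"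
    then have p: "2 * l\<^sup>2 + l \<le> p" by (rule bound)
    interpret form_group "carrier R" \<pi> p q "2 * l" 0 ?\<tau> "\<lambda>i. if i < l then 1 else - 1" False
      using p l2 assms(8) odd by unfold_locales auto
    have gram: "gram = symplectic_form (2 * l div 2)"
      unfolding gram_def symplectic_form_def by (rule eq_matI) auto
    have isom: "isom = {x \<in> carrier_mat (2 * l) (2 * l).
        transpose_mat x * symplectic_form (2 * l div 2) * x = symplectic_form (2 * l div 2)}"
      by (simp add: isom_def gram)
    note groups = mat_groups[OF R isom, folded Sp_def]
    \<comment> \<open>The column has 2 l entries modulo \<pi>^2; one more power of q pays for the
      product.\<close>
    have N: "2 * (2 * l) + 1 \<le> 2 * l + (2 * l\<^sup>2 + l) * e"
      using scale[of "2 * l\<^sup>2 + l"] l2 assms(8) by linarith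
    show "self_similarity_index_le (Sp R (2 * l))
        (real q ^ (2 * l + (2 * l\<^sup>2 + l) * e) * (\<Prod>i = 1..l. 1 - 1 / real q ^ (2 * i)))"
      unfolding groups(1)
      by (rule form_index_le, rule power_le_scaled_power[OF q2, of 1])
        (use half_le_prod_even[OF q2, of l] N in auto)
    show "self_similarity_index_le (congruence_kernel R (\<pi> ^ m) (Sp R (2 * l))) (real q ^ (2 * l))"
      unfolding groups(2) by (rule form_congruence_index_le[OF m]) simp
  next
    assume l: "2 \<le> l" and ld: "(2 * l\<^sup>2 - l) * d \<le> p"
    have p: "2 * l\<^sup>2 - l \<le> p" by (rule bound[OF ld])
    have "2 * l \<le> l\<^sup>2" using l by (simp add: power2_eq_square)
    then have l3: "3 * l \<le> 2 * l\<^sup>2 - l" by linarith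
    \<comment> \<open>The witness 1 for \<open>rank\<close> differs from 0 and from its partner l
      because l >= 2.\<close>
    interpret form_group "carrier R" \<pi> p q "2 * l" 0 ?\<tau> "\<lambda>i. 1" True
      using p l3 l odd by unfold_locales (auto intro!: exI[of _ 1])
    have gram: "gram = orthogonal_form (2 * l)"
      unfolding gram_def orthogonal_form_def even_orthogonal_form_def by (rule eq_matI) auto
    have isom: "isom = {x \<in> carrier_mat (2 * l) (2 * l).
        det x = 1 \<and> transpose_mat x * orthogonal_form (2 * l) * x = orthogonal_form (2 * l)}"
      by (auto simp: isom_def gram)
    note groups = mat_groups[OF R isom, folded SO_def]
    \<comment> \<open>The extra factor and the product are each at least 1/2, hence the allowance of
      two powers of q.\<close>
    have "1 / 2 * (1 / 2) \<le> (1 - 1 / real q ^ l) * (\<Prod>i = 1..l - 1. 1 - 1 / real q ^ (2 * i))"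
    proof (rule mult_mono)
      have "real q ^ 1 \<le> real q ^ l" by (rule power_increasing) (use q2 l in auto)
      then have "2 \<le> real q ^ l" using q2 unfolding power_one_right by linarith
      then have "1 / real q ^ l \<le> 1 / 2" using q2 by (intro divide_left_mono) auto
      then show "1 / 2 \<le> 1 - 1 / real q ^ l" by simp
      then show "0 \<le> 1 - 1 / real q ^ l" by simp
    qed (use half_le_prod_even[OF q2] in auto)
    moreover have "4 \<le> (2 * l\<^sup>2 - l) * e" using le_trans[OF l3 scale] l by linarith
    then have "2 * l + 2 \<le> 2 * l - 2 + (2 * l\<^sup>2 - l) * e" using l by linarith
    ultimately show "self_similarity_index_le (SO R (2 * l))
        (real q ^ (2 * l - 2 + (2 * l\<^sup>2 - l) * e) * (1 - 1 / real q ^ l)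
                * (\<Prod>i = 1..l - 1. 1 - 1 / real q ^ (2 * i)))"
      unfolding groups(1) mult.assoc[of "real q ^ _"]
      by (intro form_index_le power_le_scaled_power[OF q2, of 2]) auto
    show "self_similarity_index_le (congruence_kernel R (\<pi> ^ m) (SO R (2 * l))) (real q ^ (2 * l - 2))"
      unfolding groups(2) by (rule form_congruence_index_le[OF m]) simp
  next
    assume "(2 * l\<^sup>2 + l) * d \<le> p"
    then have p: "2 * l\<^sup>2 + l \<le> p" by (rule bound)
    \<comment> \<open>Index 0 carries the anisotropic basis vector, fixed by the involution; so the
      distinguished index is 1, and 0 is the witness for \<open>rank\<close>.\<close>
    interpret form_group "carrier R" \<pi> p q "2 * l + 1" 1 ?\<tau>' "\<lambda>i. 1" True
      using p l2 assms(8) odd by unfold_locales (auto intro!: exI[of _ 0])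
    have gram: "gram = orthogonal_form (2 * l + 1)"
    proof (rule eq_matI)
      fix i j assume "i < dim_row (orthogonal_form (2 * l + 1) :: 'a mat)"
        "j < dim_col (orthogonal_form (2 * l + 1) :: 'a mat)"
      then have ij: "i < 2 * l + 1" "j < 2 * l + 1"
        using carrier_matD[OF even_orthogonal_form_carrier[of l, where 'a = 'a]]
        by (simp_all add: orthogonal_form_def)
      show "gram $$ (i, j) = orthogonal_form (2 * l + 1) $$ (i, j)"
        unfolding odd_orthogonal_form_entry[OF ij] gram_def index_mat(1)[OF ij] by simp
    qed (use carrier_matD[OF even_orthogonal_form_carrier[of l, where 'a = 'a]]
      in \<open>unfold gram_def, simp_all add: orthogonal_form_def\<close>)
    have isom: "isom = {x \<in> carrier_mat (2 * l + 1) (2 * l + 1).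
        det x = 1 \<and> transpose_mat x * orthogonal_form (2 * l + 1) * x = orthogonal_form (2 * l + 1)}"
      unfolding isom_def gram by auto
    note groups = mat_groups[OF R isom, folded SO_def]
    have "3 \<le> (2 * l\<^sup>2 + l) * e" using scale[of "2 * l\<^sup>2 + l"] l2 assms(8) by linarith
    then have N: "2 * l + 1 + 1 \<le> 2 * l - 1 + (2 * l\<^sup>2 + l) * e" using assms(8) by linarith
    show "self_similarity_index_le (SO R (2 * l + 1))
        (real q ^ (2 * l - 1 + (2 * l\<^sup>2 + l) * e) * (\<Prod>i = 1..l. 1 - 1 / real q ^ (2 * i)))"
      unfolding groups(1)
      by (rule form_index_le, rule power_le_scaled_power[OF q2, of 1])
        (use half_le_prod_even[OF q2, of l] N in auto)
    show "self_similarity_index_le (congruence_kernel R (\<pi> ^ m) (SO R (2 * l + 1))) (real q ^ (2 * l - 1))"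
      unfolding groups(2) by (rule form_congruence_index_le[OF m]) simp
  qed
qed

end
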